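(* Let $R$ be a measurable function on the unit circle $\mathbb T$ with $|R(t)|\le 1$ a.e. and $\log(1-|R|)\in L^1(\mathbb T)$, and let $\check K_{n,m},\widetilde{\check K}_{n,m}\in L^R$, $\check b_j,\check\omega_j,\check\alpha_j,\check\rho_j$ be as defined in the context. For $n\in\mathbb Z$, with $b=\check b_{2n}$, $\omega=\check\omega_{2n}$ (boundary values on $\mathbb T$), put $$\check\Sigma^{(11)}_{n,n}=\begin{bmatrix}\frac12\frac{1+b\omega}{1-b\omega}&\frac{b}{1-b\omega}\\[2mm] \frac{\omega}{1-\omega b}&\frac12\frac{1+\omega b}{1-\omega b}\end{bmatrix}+\begin{bmatrix}\frac12\frac{1+\overline\omega\,\overline b}{1-\overline\omega\,\overline b}&\frac{\overline\omega}{1-\overline b\,\overline\omega}\\[2mm] \frac{\overline b}{1-\overline\omega\,\overline b}&\frac12\frac{1+\overline b\,\overline\omega}{1-\overline b\,\overline\omega}\end{bmatrix}.$$ Then the $2\times2$ matrix spectral measure of the unitary operator $U_R$ with respect to the pair of vectors $\check K_{n,n}$, $\widetilde{\check K}_{n+1,n}$ is absolutely continuous with respect to the normalized Lebesgue measure, with density $$\begin{bmatrix}1&0\\[1mm] -\frac{\check\alpha_{2n}}{\check\rho_{2n}}&\frac{t}{\check\rho_{2n}}\end{bmatrix}\check\Sigma^{(11)}_{n,n}(t)\begin{bmatrix}1&-\frac{\overline{\check\alpha}_{2n}}{\check\rho_{2n}}\\[1mm] 0&\frac{\overline t}{\check\rho_{2n}}\end{bmatrix}.$$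
   Context: $L^R$ is the Hilbert space of (classes of) measurable functions $f=\begin{bmatrix}f_1\\ f_2\end{bmatrix}:\mathbb T\to\mathbb C^2$ with finite norm for the inner product $\langle f,g\rangle=\int_{\mathbb T} g(t)^*\begin{bmatrix}1&\overline{R(t)}\\R(t)&1\end{bmatrix}^{-1}f(t)\,dm(t)$, $m$ the normalized Lebesgue measure. $U_R$ is the unitary operator of multiplication by the independent variable $t$ on $L^R$. $L^2=L^2(\mathbb T)$, $H^2_+$ is the Hardy space of the disk, $H^2_-=L^2\ominus H^2_+$. The spectral measure of $U_R$ with respect to a pair of vectors $(\psi_1,\psi_2)$ is the $2\times 2$ matrix measure with $(i,j)$ entry $\langle E_{U_R}(\cdot)\psi_j,\psi_i\rangle$, where $E_{U_R}$ is the spectral measure of $U_R$; thus $\Sigma$ is its density iff $\langle U_R^k\psi_j,\psi_i\rangle=\int_{\mathbb T}t^k\Sigma_{ij}(t)\,dm(t)$ for all $k\in\mathbb Z$. For $n,m\in\mathbb Z$ let $\check{\mathcal H}_{n,m}$ be the closure in $L^R$ of $\left\{\begin{bmatrix}1&\overline R\\R&1\end{bmatrix}\begin{bmatrix}t^n h_+\\ \overline t^{\,m}h_-\end{bmatrix}: h_+\in H^2_+,\ h_-\in H^2_-\right\}$. The subspaces $\check{\mathcal H}_{n+1,m}$ and $\check{\mathcal H}_{n,m+1}$ have codimension one in $\check{\mathcal H}_{n,m}$, and $U_R$ maps $\check{\mathcal H}_{n,m+1}$ onto $\check{\mathcal H}_{n+1,m}$. Let $\check K_{n,m}$ be the unit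 vector in $\check{\mathcal H}_{n,m}\ominus\check{\mathcal H}_{n+1,m}$ normalized by $\left\langle\begin{bmatrix}1\\R\end{bmatrix}t^n,\check K_{n,m}\right\rangle>0$, and let $\widetilde{\check K}_{n,m}$ be the unit vector in $\check{\mathcal H}_{n,m}\ominus\check{\mathcal H}_{n,m+1}$ normalized by $\left\langle\widetilde{\check K}_{n,m},\begin{bmatrix}\overline R\\1\end{bmatrix}\overline t^{\,m+1}\right\rangle>0$. Let $A_0=A_{0,n,m}:\check{\mathcal H}_{n,m}\to\check{\mathcal H}_{n,m}$, $A_0h=U_RP_{\check{\mathcal H}_{n,m+1}}h$, where $P$ denotes orthogonal projection. For $|\zeta|<1$ put $\check b_{n+m}(\zeta)=\zeta\left\langle(I-\zeta A_0^* )^{-1}\widetilde{\check K}_{n,m},\check K_{n,m}\right\rangle$. Let $P_\perp$ be the orthogonal projection of $L^R$ onto $\check{\mathcal H}_{n,m}^\perp$ and $A_\perp=P_\perp U_R^*|_{\check{\mathcal H}_{n,m}^\perp}$; put $$\check\omega_{n+m}(\zeta)=\left\langle U_R^*\check K_{n,m},\widetilde{\check K}_{n,m}\right\rangle+\zeta\left\langle U_R^*(I-\zeta A_\perp)^{-1}P_\perp U_R^*\check K_{n,m},\widetilde{\check K}_{n,m}\right\rangle .$$ (So $\check b_{n+m}$ and $\check\omega_{n+m}$ are the characteristic functions of the adjoints of the unitary colligations whose feedback coupling is $U_R$.) These functions depend only on the sum $n+m$ and are analytic and bounded by $1$ in the disk. The number $\check\alpha_{n+m}:=\langle\check K_{n,m},\widetilde{\check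 K}_{n,m}\rangle$ also depends only on $n+m$, satisfies $|\check\alpha_{n+m}|<1$, and $\check\rho_j:=\sqrt{1-|\check\alpha_j|^2}$. *)

theory Defs
  imports "HOL-Analysis.Analysis"
begin

text \<open>
  Normalized Lebesgue measure on the unit circle. The completion is taken so that measurable
  means Lebesgue measurable.
\<close>

definition circ :: "complex measure" where
  "circ = completion (distr (restrict_space lborel {0..<1})
     (restrict_space borel (sphere 0 1)) (\<lambda>x. cis (2 * pi * x)))"

definition log_integrable :: "(complex \<Rightarrow> real) \<Rightarrow> bool" where
  "log_integrable f \<longleftrightarrow> (AE t in circ. f t > 0) \<and> integrable circ (\<lambda>t. ln (f t))"
  \<comment> \<open>The first clause is needed because \<open>ln 0 = 0\<close> in HOL, whereas here \<open>log 0\<close> is minus infinity.\<close>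

definition L2 :: "(complex \<Rightarrow> complex) set" where
  "L2 = {f \<in> borel_measurable circ. integrable circ (\<lambda>t. (norm (f t))\<^sup>2)}"

definition H2_plus :: "(complex \<Rightarrow> complex) set" where
  "H2_plus = {f \<in> L2. \<forall>k::int. k < 0 \<longrightarrow> (LINT t|circ. cnj (t powi k) * f t) = 0}"
  \<comment> \<open>The Hardy space as a subspace of \<open>L2\<close> of the circle, that is, via boundary values.\<close>

definition H2_minus :: "(complex \<Rightarrow> complex) set" where
  "H2_minus = {f \<in> L2. \<forall>h\<in>H2_plus. (LINT t|circ. cnj (h t) * f t) = 0}"

text \<open>
  Vectors of \<open>L\<^sup>R\<close> are represented by functions, two of them being the same vector iff
  they agree almost everywhere. Operators are defined on representatives; each of the choices
  below is unique up to a null set whenever the object it describes exists.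
\<close>

type_synonym vfun = "complex \<Rightarrow> complex ^ 2"

definition WR :: "(complex \<Rightarrow> complex) \<Rightarrow> complex \<Rightarrow> complex ^ 2 ^ 2" where
  "WR R t = vector [vector [1, cnj (R t)], vector [R t, 1]]"

definition ip_density :: "(complex \<Rightarrow> complex) \<Rightarrow> vfun \<Rightarrow> vfun \<Rightarrow> complex \<Rightarrow> complex" where
  "ip_density R f g t = (\<Sum>i\<in>UNIV. cnj (g t $ i) * (matrix_inv (WR R t) *v f t) $ i)"

definition LR :: "(complex \<Rightarrow> complex) \<Rightarrow> vfun set" where
  "LR R = {f \<in> borel_measurable circ. integrable circ (ip_density R f f)}"

definition ip :: "(complex \<Rightarrow> complex) \<Rightarrow> vfun \<Rightarrow> vfun \<Rightarrow> complex" where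
  "ip R f g = (LINT t|circ. ip_density R f g t)"

definition normR :: "(complex \<Rightarrow> complex) \<Rightarrow> vfun \<Rightarrow> real" where
  "normR R f = sqrt (Re (ip R f f))"

definition closure_LR :: "(complex \<Rightarrow> complex) \<Rightarrow> vfun set \<Rightarrow> vfun set" where
  "closure_LR R S = {f \<in> LR R. \<forall>e>0. \<exists>g\<in>S. normR R (\<lambda>t. f t - g t) < e}"

definition orth :: "(complex \<Rightarrow> complex) \<Rightarrow> vfun set \<Rightarrow> vfun set" where
  "orth R S = {f \<in> LR R. \<forall>h\<in>S. ip R f h = 0}"

definition proj :: "(complex \<Rightarrow> complex) \<Rightarrow> vfun set \<Rightarrow> vfun \<Rightarrow> vfun" where
  "proj R S f = (SOME g. g \<in> S \<and> (\<forall>h\<in>S. ip R (\<lambda>t. f t - g t) h = 0))"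

definition adj_on :: "(complex \<Rightarrow> complex) \<Rightarrow> vfun set \<Rightarrow> (vfun \<Rightarrow> vfun) \<Rightarrow> vfun \<Rightarrow> vfun" where
  "adj_on R S A g = (SOME k. k \<in> S \<and> (\<forall>h\<in>S. ip R (A h) g = ip R h k))"

definition resolvent_on :: "vfun set \<Rightarrow> (vfun \<Rightarrow> vfun) \<Rightarrow> complex \<Rightarrow> vfun \<Rightarrow> vfun" where
  "resolvent_on S A z g = (SOME x. x \<in> S \<and> (AE t in circ. x t - z *s A x t = g t))"
  \<comment> \<open>\<open>(I - z A)\<^sup>-\<^sup>1 g\<close>, where \<open>A\<close> is an operator on \<open>S\<close>.\<close>

definition U :: "vfun \<Rightarrow> vfun" where
  "U f = (\<lambda>t. t *s f t)"

definition U_adj :: "(complex \<Rightarrow> complex) \<Rightarrow> vfun \<Rightarrow> vfun" where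
  "U_adj R = adj_on R (LR R) U"

definition U_pow :: "int \<Rightarrow> vfun \<Rightarrow> vfun" where
  "U_pow k f = (\<lambda>t. t powi k *s f t)"

definition Hc :: "(complex \<Rightarrow> complex) \<Rightarrow> int \<Rightarrow> int \<Rightarrow> vfun set" where
  "Hc R n m = closure_LR R
     {(\<lambda>t. WR R t *v vector [t powi n * hp t, cnj t powi m * hm t]) | hp hm.
        hp \<in> H2_plus \<and> hm \<in> H2_minus}"

definition is_K :: "(complex \<Rightarrow> complex) \<Rightarrow> int \<Rightarrow> int \<Rightarrow> vfun \<Rightarrow> bool" where
  "is_K R n m K \<longleftrightarrow>
     K \<in> Hc R n m \<and> (\<forall>h\<in>Hc R (n + 1) m. ip R K h = 0) \<and> normR R K = 1 \<and>
     (let c = ip R (\<lambda>t. t powi n *s vector [1, R t]) K in Im c = 0 \<and> Re c > 0)"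

definition is_Kt :: "(complex \<Rightarrow> complex) \<Rightarrow> int \<Rightarrow> int \<Rightarrow> vfun \<Rightarrow> bool" where
  "is_Kt R n m K \<longleftrightarrow>
     K \<in> Hc R n m \<and> (\<forall>h\<in>Hc R n (m + 1). ip R K h = 0) \<and> normR R K = 1 \<and>
     (let c = ip R K (\<lambda>t. cnj t powi (m + 1) *s vector [cnj (R t), 1]) in Im c = 0 \<and> Re c > 0)"

definition A0 :: "(complex \<Rightarrow> complex) \<Rightarrow> int \<Rightarrow> int \<Rightarrow> vfun \<Rightarrow> vfun" where
  "A0 R n m h = U (proj R (Hc R n (m + 1)) h)"

definition A_perp :: "(complex \<Rightarrow> complex) \<Rightarrow> int \<Rightarrow> int \<Rightarrow> vfun \<Rightarrow> vfun" where
  "A_perp R n m f = proj R (orth R (Hc R n m)) (U_adj R f)"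

text \<open>
  In the next three definitions \<open>K\<close> and \<open>Kt\<close> are meant to satisfy \<^const>\<open>is_K\<close> and \<^const>\<open>is_Kt\<close>
  for the same \<open>R n m\<close>; the results depend only on \<open>n + m\<close>.
\<close>

definition b_check ::
  "(complex \<Rightarrow> complex) \<Rightarrow> int \<Rightarrow> int \<Rightarrow> vfun \<Rightarrow> vfun \<Rightarrow> complex \<Rightarrow> complex" where
  "b_check R n m K Kt z =
     z * ip R (resolvent_on (Hc R n m) (adj_on R (Hc R n m) (A0 R n m)) z Kt) K"

definition omega_check ::
  "(complex \<Rightarrow> complex) \<Rightarrow> int \<Rightarrow> int \<Rightarrow> vfun \<Rightarrow> vfun \<Rightarrow> complex \<Rightarrow> complex" where
  "omega_check R n m K Kt z =
     ip R (U_adj R K) Kt +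
     z * ip R (U_adj R (resolvent_on (orth R (Hc R n m)) (A_perp R n m) z
                          (proj R (orth R (Hc R n m)) (U_adj R K)))) Kt"

definition alpha_check :: "(complex \<Rightarrow> complex) \<Rightarrow> vfun \<Rightarrow> vfun \<Rightarrow> complex" where
  "alpha_check R K Kt = ip R K Kt"

definition rho_of :: "complex \<Rightarrow> real" where
  "rho_of a = sqrt (1 - (norm a)\<^sup>2)"

definition bdry :: "(complex \<Rightarrow> complex) \<Rightarrow> complex \<Rightarrow> complex" where
  "bdry F t = Lim (at_left (1::real)) (\<lambda>r. F (of_real r * t))"
  \<comment> \<open>Radial limits; for bounded analytic functions they exist almost everywhere (Fatou).\<close>

definition Sigma11 :: "complex \<Rightarrow> complex \<Rightarrow> complex ^ 2 ^ 2" where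
  "Sigma11 b w =
     vector [vector [(1/2) * ((1 + b * w) / (1 - b * w)), b / (1 - b * w)],
             vector [w / (1 - w * b), (1/2) * ((1 + w * b) / (1 - w * b))]] +
     vector [vector [(1/2) * ((1 + cnj w * cnj b) / (1 - cnj w * cnj b)), cnj w / (1 - cnj b * cnj w)],
             vector [cnj b / (1 - cnj w * cnj b), (1/2) * ((1 + cnj b * cnj w) / (1 - cnj b * cnj w))]]"

definition E_U :: "complex set \<Rightarrow> vfun \<Rightarrow> vfun" where
  "E_U D f = (\<lambda>t. indicator D t *s f t)"
  \<comment> \<open>The spectral measure of \<open>U\<close>, the operator of multiplication by the independent variable.\<close>

text \<open>
  The matrix measure with entries \<open>\<langle>E(D) \<psi>\<^sub>j, \<psi>\<^sub>i\<rangle>\<close> is absolutely continuous with density \<open>S\<close>.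
  Both descriptions of this are required: the one by sets, and the one by trigonometric moments,
  which characterizes the spectral measure of the unitary operator \<open>U\<close>.
\<close>

definition has_spectral_density ::
  "(complex \<Rightarrow> complex) \<Rightarrow> vfun \<Rightarrow> vfun \<Rightarrow> (complex \<Rightarrow> complex ^ 2 ^ 2) \<Rightarrow> bool" where
  "has_spectral_density R \<psi>1 \<psi>2 S \<longleftrightarrow>
     (let \<psi> = (\<lambda>i::2. if i = 1 then \<psi>1 else \<psi>2) in
      \<forall>i j. integrable circ (\<lambda>t. S t $ i $ j) \<and>
        (\<forall>D\<in>sets circ. ip R (E_U D (\<psi> j)) (\<psi> i) = (LINT t:D|circ. S t $ i $ j)) \<and>
        (\<forall>k. ip R (U_pow k (\<psi> j)) (\<psi> i) = (LINT t|circ. t powi k * S t $ i $ j)))"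

end

theory Submission
  imports Defs "HOL-Complex_Analysis.Cauchy_Integral_Formula"
begin

text \<open>
  Let \<open>K\<close>, \<open>Kt\<close> be the defect vectors of \<open>H = Hc R n m\<close>. On \<open>H\<close> the adjoint of \<open>A0\<close> sends \<open>g\<close> to
  \<open>cnj t (g - \<langle>g,K\<rangle> K)\<close>, and on the orthogonal complement \<open>A_perp\<close> sends \<open>f\<close> to
  \<open>cnj t f - \<langle>cnj t f,Kt\<rangle> Kt\<close>. Hence both resolvent equations are solved by a division by
  \<open>1 - z cnj t\<close>, and the Neumann series shows that the solution lies in the correct closed
  subspace; completeness of \<open>L\<^sup>R\<close> and the projection theorem are not needed.
  Write \<open>C\<^sub>u z\<close> for the integral of \<open>u / (1 - z cnj t)\<close> and \<open>p\<close>, \<open>q\<close>, \<open>s\<close> for the pointwise inner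
  products of \<open>(K,K)\<close>, \<open>(Kt,Kt)\<close>, \<open>(Kt,K)\<close>, and let \<open>r = cnj (t s)\<close>. Pairing the two solutions with
  \<open>K\<close> and \<open>Kt\<close> gives \<open>b C\<^sub>p = z C\<^sub>s\<close>, \<open>C\<^sub>q - b C\<^sub>r = 1\<close>, \<open>C\<^sub>r = \<omega> C\<^sub>q\<close> and \<open>C\<^sub>p - 1 = \<omega> z C\<^sub>s\<close>,
  so \<open>C\<^sub>p = C\<^sub>q = 1 / (1 - b \<omega>)\<close>. In the entries of \<open>Sigma11\<close> this produces Poisson integrals, whose
  radial limits show that \<open>Sigma11\<close> is the pointwise Gram matrix of \<open>(K, t Kt)\<close>. The transformation in
  the theorem comes from \<open>Kt\<^bsub>n+1,n\<^esub> = (Kt - cnj \<alpha> K) / \<rho>\<close>.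

  Poisson integrals of integrable functions converge almost everywhere by the Hardy-Littlewood
  maximal inequality. A holomorphic \<open>F\<close> with \<open>Re F \<ge> 0\<close> has finite radial limits because
  \<open>1 / (1 + F)\<close> is bounded, hence the Poisson integral of a boundary function, which vanishes on a null
  set only since the integral means of \<open>sqrt (1 + F)\<close> are bounded; Cauchy transforms are
  combinations of such \<open>F\<close>.
\<close>

section \<open>Normalized Lebesgue measure on the circle\<close>

text \<open>The obstacle is that \<open>bdry\<close> asks for the boundary values of b and \<omega>
  separately. Convergence of Poisson integrals only controls a Cauchy transform plus the conjugate
  of another one; it yields sums such as those in the entries of \<open>Sigma11\<close>, not the two
  functions inside them. Hence the separate treatment of radial limits of Cauchy transforms.
  Dividing by these limits is legitimate because \<open>K\<close> has norm 1: the Cauchy kernel has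
  real part at least 1/2, so Re C_p \<ge> 1/2 in the disk, and this bound survives at the boundary.
  The other recurrent difficulty is that projections, adjoints and resolvents are picked by
  \<open>SOME\<close> among representatives. Each is handled by exhibiting one explicit object that
  fits the description; then the choice fits it too, and for projections and adjoints it agrees with
  the explicit one almost everywhere.\<close>

abbreviation circ0 :: "complex measure" where
  "circ0 \<equiv> distr (restrict_space lborel {0..<1}) (restrict_space borel (sphere 0 1)) (\<lambda>x. cis (2 * pi * x))"

lemma measurable_cis_circle [measurable]:
  "(\<lambda>x. cis (2 * pi * x)) \<in> restrict_space lborel {0..<1::real} \<rightarrow>\<^sub>M restrict_space borel (sphere 0 1)"
  by (intro measurable_restrict_space2 measurable_restrict_space1)
     (auto intro!: borel_measurable_continuous_onI continuous_intros)

lemma space_circ: "space circ = sphere 0 1"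
  by (simp add: circ_def space_restrict_space)

lemma emeasure_circ_space: "emeasure circ (space circ) = 1"
proof -
  have "emeasure circ0 (sphere 0 1) = emeasure lborel {0..<1::real}"
    by (subst emeasure_distr)
       (auto simp: sets_restrict_space emeasure_restrict_space space_restrict_space
         vimage_def intro!: arg_cong[where f="emeasure lborel"])
  moreover have "emeasure lborel {0..<1::real} = 1" by simp
  moreover have "sphere 0 1 \<in> sets circ0" by (auto simp: sets_restrict_space)
  ultimately show ?thesis
    unfolding space_circ circ_def by simp
qed

interpretation circ: finite_measure circ by (rule finite_measureI) (simp add: emeasure_circ_space)
interpretation circ: complete_measure circ unfolding circ_def by (rule completion.complete_measure_axioms)

lemma measurable_circ_borel: "f \<in> borel_measurable borel \<Longrightarrow> f \<in> borel_measurable circ"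
  unfolding circ_def by (intro measurable_completion) (simp add: measurable_restrict_space1)

text \<open>Holds because \<open>circ\<close> is complete: the preimages of a set under the two
  functions differ by a subset of a null set. Vectors are known only up to null sets, so
  measurability has to pass along almost everywhere equality.\<close>

lemma AE_circ_cong_measurable:
  fixes f g :: "complex \<Rightarrow> 'b::topological_space"
  assumes "f \<in> borel_measurable circ" "AE t in circ. f t = g t"
  shows "g \<in> borel_measurable circ"
proof (rule measurableI)
  fix A :: "'b set" assume A: "A \<in> sets borel"
  show "g -` A \<inter> space circ \<in> sets circ"
  proof (rule circ.in_sets_AE)
    show "f -` A \<inter> space circ \<in> sets circ" using assms(1) A by (rule measurable_sets)
    show "AE x in circ. (x \<in> f -` A \<inter> space circ) = (x \<in> g -` A \<inter> space circ)"
      using assms(2) by eventually_elim auto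
  qed auto
qed auto

lemma integrable_circ_AE_cong:
  fixes f g :: "complex \<Rightarrow> 'b::{banach, second_countable_topology}"
  assumes "integrable circ f" "AE t in circ. f t = g t"
  shows "integrable circ g"
  using assms AE_circ_cong_measurable[of f g] by (subst integrable_cong_AE[of g _ f]) auto

lemma integral_circ_AE_cong:
  fixes f g :: "complex \<Rightarrow> 'b::{banach, second_countable_topology}"
  assumes "AE t in circ. f t = g t"
  shows "integral\<^sup>L circ f = integral\<^sup>L circ g"
proof (cases "f \<in> borel_measurable circ")
  case True
  then show ?thesis using assms AE_circ_cong_measurable by (intro integral_cong_AE) auto
next
  \<comment> \<open>Neither function is measurable here, so both integrals have the default value
    0.\<close>
  case False
  have "AE t in circ. g t = f t" using assms by auto
  then have "g \<notin> borel_measurable circ" using False AE_circ_cong_measurable by blast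
  with False show ?thesis
    by (metis borel_measurable_integrable not_integrable_integral_eq)
qed

text \<open>Real and imaginary parts that are measurable for the completion have Borel versions. The
  result is set to 0 off the circle to be Borel on the whole plane, the form in which it can be
  pulled back to [0,1).\<close>

lemma circ_borel_version:
  fixes u :: "complex \<Rightarrow> complex"
  assumes "u \<in> borel_measurable circ"
  obtains v where "v \<in> borel_measurable borel" "AE t in circ. u t = v t"
proof -
  have m: "(\<lambda>t. Re (u t)) \<in> borel_measurable (completion circ0)" "(\<lambda>t. Im (u t)) \<in> borel_measurable (completion circ0)"
    using assms by (auto simp flip: circ_def)
  obtain g1 g2 where g: "g1 \<in> borel_measurable circ0" "AE t in circ0. Re (u t) = g1 t"
     "g2 \<in> borel_measurable circ0" "AE t in circ0. Im (u t) = g2 t"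
    using completion_ex_borel_measurable_real[OF m(1)] completion_ex_borel_measurable_real[OF m(2)] by auto
  define v where "v = (\<lambda>t. if t \<in> sphere 0 1 then Complex (g1 t) (g2 t) else 0)"
  have "(\<lambda>t. Complex (g1 t) (g2 t)) \<in> borel_measurable (restrict_space borel (sphere 0 1))"
  proof -
    have "g1 \<in> borel_measurable (restrict_space borel (sphere 0 1))" "g2 \<in> borel_measurable (restrict_space borel (sphere 0 1))"
      using g by simp_all
    then show ?thesis by (simp add: borel_measurable_complex_iff)
  qed
  then have "v \<in> borel_measurable borel"
    unfolding v_def by (subst (asm) measurable_restrict_space_iff[where c=0]) auto
  moreover have "AE t in circ. u t = v t"
  proof -
    have "AE t in circ0. Re (u t) = g1 t \<and> Im (u t) = g2 t" using g by auto
    then have "AE t in circ. Re (u t) = g1 t \<and> Im (u t) = g2 t" unfolding circ_def by (rule AE_completion)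
    then show ?thesis using AE_space[of circ]
      by eventually_elim (auto simp: v_def space_circ complex_eq_iff)
  qed
  ultimately show ?thesis by (rule that)
qed

section \<open>Transfer between the circle and the unit interval\<close>

lemma
  fixes v :: "complex \<Rightarrow> 'b::{banach, second_countable_topology}"
  assumes v: "v \<in> borel_measurable borel"
  shows integrable_circ_iff: "integrable circ v \<longleftrightarrow> set_integrable lborel {0..<1} (\<lambda>x. v (cis (2 * pi * x)))"
    and integral_circ_eq: "integral\<^sup>L circ v = (LINT x:{0..<1}|lborel. v (cis (2 * pi * x)))"
proof -
  have m: "v \<in> borel_measurable (restrict_space borel (sphere 0 1))" using v by (rule measurable_restrict_space1)
  show "integrable circ v \<longleftrightarrow> set_integrable lborel {0..<1} (\<lambda>x. v (cis (2 * pi * x)))"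
    unfolding circ_def set_integrable_def using m
    by (subst integrable_completion, simp, subst integrable_distr_eq[OF measurable_cis_circle m])
       (simp add: integrable_restrict_space)
  show "integral\<^sup>L circ v = (LINT x:{0..<1}|lborel. v (cis (2 * pi * x)))"
    unfolding circ_def set_lebesgue_integral_def using m
    by (subst integral_completion, simp, subst integral_distr[OF measurable_cis_circle m])
       (simp add: integral_restrict_space)
qed

text \<open>A measurable inverse of the parametrization by full turns in [0,1). It is written with
  \<open>arccos\<close> so that measurability follows from continuity; \<open>Arg2pi\<close> serves
  only to show that the parametrization is onto.\<close>

definition circle_angle :: "complex \<Rightarrow> real" where
  "circle_angle t = (if Im t \<ge> 0 then arccos (Re t) else 2 * pi - arccos (Re t)) / (2 * pi)"

lemma circle_angle_cis:
  assumes "0 \<le> x" "x < 1" shows "circle_angle (cis (2 * pi * x)) = x"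
proof (cases "x \<le> 1/2")
  case True
  then have "2 * pi * x \<le> pi" by simp
  then have "sin (2 * pi * x) \<ge> 0" "arccos (cos (2 * pi * x)) = 2 * pi * x"
    using assms by (auto intro!: sin_ge_zero arccos_cos)
  then show ?thesis by (simp add: circle_angle_def)
next
  case False
  then have "2 * pi * x > pi" "2 * pi * x < 2 * pi" using assms by simp_all
  then have "sin (2 * pi * x) < 0" by (intro sin_lt_zero) auto
  moreover have "cos (2 * pi * x) = cos (2 * pi - 2 * pi * x)" by (simp add: cos_diff)
  moreover have "arccos (cos (2 * pi - 2 * pi * x)) = 2 * pi - 2 * pi * x"
    using \<open>2 * pi * x > pi\<close> \<open>2 * pi * x < 2 * pi\<close> by (intro arccos_cos) auto
  ultimately show ?thesis by (simp add: circle_angle_def)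
qed

lemma cis_circle_angle:
  assumes "norm t = 1" shows "circle_angle t \<in> {0..<1} \<and> cis (2 * pi * circle_angle t) = t"
proof -
  define y where "y = Arg2pi t / (2 * pi)"
  have y: "0 \<le> y" "y < 1" using Arg2pi[of t] by (simp_all add: y_def divide_less_eq)
  have "2 * pi * y = Arg2pi t" by (simp add: y_def)
  moreover have "t = cis (Arg2pi t)" using assms Arg2pi[of t] by (simp add: cis_conv_exp is_Arg_def)
  ultimately have "t = cis (2 * pi * y)" by (simp only:)
  then show ?thesis using y circle_angle_cis[OF y] by (simp only:) simp
qed

lemma measurable_circle_angle: "circle_angle \<in> borel_measurable (restrict_space borel (sphere 0 1))"
proof -
  have [measurable]: "(\<lambda>t. arccos (Re t)) \<in> borel_measurable (restrict_space borel (sphere 0 1))"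
    using abs_Re_le_cmod
    by (intro borel_measurable_continuous_on_restrict continuous_on_arccos continuous_intros)
       (auto simp: abs_le_iff dest: sym, (smt (verit) abs_Re_le_cmod)+)
  have [measurable]: "Im \<in> borel_measurable (restrict_space borel (sphere 0 1))"
    by (intro measurable_restrict_space1) simp
  show ?thesis unfolding circle_angle_def by measurable
qed

text \<open>A null set of angles is carried to the circle as its preimage under
  \<open>circle_angle\<close>, whose parameters all lie in that null set again. The open interval
  suffices since a single point of the circle is null.\<close>

lemma AE_circI:
  assumes "AE x in lborel. x \<in> {0<..<1} \<longrightarrow> Q (cis (2 * pi * x))"
  shows "AE t in circ. Q t"
proof -
  obtain N where N: "N \<in> null_sets lborel" "{x. \<not> (x \<in> {0<..<1} \<longrightarrow> Q (cis (2 * pi * x)))} \<subseteq> N"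
    using assms by (auto simp: eventually_ae_filter)
  \<comment> \<open>The hypothesis says nothing about x = 0, so this parameter joins the exceptional
    set.\<close>
  define N1 where "N1 = N \<union> {0}"
  have N1: "N1 \<in> null_sets lborel" unfolding N1_def using N(1) by (intro null_sets.Un) auto
  define M where "M = circle_angle -` N1 \<inter> sphere 0 1"
  have M: "M \<in> sets circ0"
    using measurable_sets[OF measurable_circle_angle, of N1] N1
    by (auto simp: M_def space_restrict_space null_sets_def)
  have eq: "(\<lambda>x. cis (2 * pi * x)) -` M \<inter> {0..<1} \<subseteq> N1"
    using circle_angle_cis by (auto simp: M_def)
  have "emeasure circ0 M = emeasure (restrict_space lborel {0..<1}) ((\<lambda>x. cis (2 * pi * x)) -` M \<inter> {0..<1})"
    using M by (subst emeasure_distr) (auto simp: space_restrict_space)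
  also have "\<dots> = emeasure lborel ((\<lambda>x. cis (2 * pi * x)) -` M \<inter> {0..<1})"
    by (intro emeasure_restrict_space) auto
  also have "\<dots> \<le> emeasure lborel N1" using eq N1 by (intro emeasure_mono) auto
  also have "\<dots> = 0" using N1 by auto
  finally have "M \<in> null_sets circ0" using M by auto
  then have "AE t in circ0. t \<notin> M" by (rule AE_not_in)
  then have "AE t in circ. t \<notin> M" unfolding circ_def by (rule AE_completion)
  then show ?thesis using AE_space[of circ]
  proof eventually_elim
    case (elim t)
    then have "norm t = 1" by (simp add: space_circ)
    then have "circle_angle t \<notin> N1" "circle_angle t \<in> {0..<1}" "cis (2 * pi * circle_angle t) = t"
      using elim cis_circle_angle[of t] by (auto simp: M_def)
    then have "circle_angle t \<in> {0<..<1}" "circle_angle t \<notin> N" by (auto simp: N1_def less_le)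
    then have "Q (cis (2 * pi * circle_angle t))" using N(2) by blast
    then show ?case using \<open>cis (2 * pi * circle_angle t) = t\<close> by simp
  qed
qed

section \<open>Trigonometric moments of the normalized Lebesgue measure\<close>

lemma cis_powi: "cis x powi k = cis (of_int k * x)"
  by (cases k rule: int_cases2) (simp_all add: power_int_minus Complex.DeMoivre)

lemma has_integral_cis:
  "((\<lambda>x. cis (2 * pi * of_int k * x)) has_integral (if k = 0 then 1 else 0)) {0..1}"
proof (cases "k = 0")
  case True
  have "((\<lambda>x::real. 1::complex) has_integral 1) {0..1}"
    using has_integral_const_real[of "1::complex" 0 1] by (simp del: has_integral_const_real)
  then show ?thesis using True by (simp del: has_integral_const_real)
next
  case False
  have d: "((\<lambda>x. cis (2 * pi * of_int k * x) / (2 * pi * of_int k * \<i>)) has_vector_derivative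
         cis (2 * pi * of_int k * x)) (at x within {0..1})" for x :: real
  proof -
    have "((\<lambda>z. exp (\<i> * (2 * pi * of_int k) * z) / (2 * pi * of_int k * \<i>)) has_field_derivative
        exp (\<i> * (2 * pi * of_int k) * of_real x)) (at (of_real x))"
      using False by (auto intro!: derivative_eq_intros simp: field_simps)
    then show ?thesis
      by (drule_tac has_vector_derivative_real_field) (simp add: cis_conv_exp mult_ac)
  qed
  have "((\<lambda>x. cis (2 * pi * of_int k * x)) has_integral
      cis (2 * pi * of_int k * 1) / (2 * pi * of_int k * \<i>) - cis (2 * pi * of_int k * 0) / (2 * pi * of_int k * \<i>)) {0..1}"
    by (rule fundamental_theorem_of_calculus) (use d in auto)
  moreover have "cis (2 * pi * of_int k) = 1" by (rule cis_multiple_2pi) simp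
  ultimately show ?thesis using False by simp
qed

lemma integral_circ_powi: "(LINT t|circ. t powi k) = (if k = 0 then 1 else 0)"
proof -
  have m: "(\<lambda>t::complex. t powi k) \<in> borel_measurable borel"
    by (cases k rule: int_cases2) (auto simp: power_int_minus)
  let ?f = "\<lambda>x::real. cis (2 * pi * of_int k * x)"
  have c: "continuous_on UNIV ?f" by (intro continuous_intros)
  have mf [measurable]: "?f \<in> borel_measurable borel" using c by (rule borel_measurable_continuous_onI)
  have si: "set_integrable lborel {0..1} ?f"
    unfolding set_integrable_def
    by (intro borel_integrable_compact) (auto intro: continuous_on_subset[OF c])
  have "(LINT t|circ. t powi k) = (LINT x:{0..<1}|lborel. ?f x)"
    using integral_circ_eq[OF m] by (simp add: cis_powi mult_ac)
  also have "\<dots> = (LINT x:{0..1}|lborel. ?f x)"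
    by (intro set_integral_cong_set) (auto simp: set_borel_measurable_def intro!: AE_I[where N="{1}"])
  also have "\<dots> = integral {0..1} ?f" by (rule set_borel_integral_eq_integral) (rule si)
  also have "\<dots> = (if k = 0 then 1 else 0)" using has_integral_cis[of k] by (rule integral_unique)
  finally show ?thesis .
qed

section \<open>Poisson integrals\<close>

text \<open>The weak type estimate, from the Vitali covering lemma: a point with a large average is
  the center of an interval of half-length r whose \<open>h\<close>-mass exceeds 2 r \<gamma>.
  Disjoint ones among these intervals, enlarged five times, still cover the bad set, and an enlarged
  interval has length 10 r. \<open>T\<close> is this countable cover rather than the bad set itself,
  which makes its measurability immediate.\<close>

lemma hardy_littlewood_maximal:
  fixes h :: "real \<Rightarrow> real"
  assumes h: "integrable lborel h" and nn: "\<And>y. h y \<ge> 0" and l: "\<gamma> > 0"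
  shows "\<exists>T\<in>lmeasurable. measure lebesgue T \<le> 5 / \<gamma> * (LINT y|lborel. h y) \<and>
    (\<forall>x s. x \<notin> T \<longrightarrow> s > 0 \<longrightarrow> (LINT y:cball x s|lborel. h y) \<le> 2 * s * \<gamma>)"
proof -
  define I where "I = (LINT y|lborel. h y)"
  have si: "set_integrable lborel A h" if "A \<in> sets lborel" for A
    unfolding set_integrable_def using that h by (intro integrable_mult_indicator) auto
  define E where "E = {x. \<exists>s>0. (LINT y:cball x s|lborel. h y) > 2 * s * \<gamma>}"
  define r where "r = (\<lambda>x. SOME s. s > 0 \<and> (LINT y:cball x s|lborel. h y) > 2 * s * \<gamma>)"
  have r: "r x > 0" "(LINT y:cball x (r x)|lborel. h y) > 2 * r x * \<gamma>" if "x \<in> E" for x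
  proof -
    have "\<exists>s. s > 0 \<and> (LINT y:cball x s|lborel. h y) > 2 * s * \<gamma>" using that by (auto simp: E_def)
    from someI_ex[OF this] show "r x > 0" "(LINT y:cball x (r x)|lborel. h y) > 2 * r x * \<gamma>"
      by (simp_all add: r_def)
  qed
  have le_I: "(LINT y:A|lborel. h y) \<le> I" if "A \<in> sets lborel" for A
    unfolding I_def set_lebesgue_integral_def
    by (intro integral_mono h) (use si[OF that] nn in \<open>auto simp: set_integrable_def indicator_def\<close>)
  \<comment> \<open>The covering lemma requires bounded radii; the total mass of \<open>h\<close>
    provides the bound.\<close>
  have rb: "0 < r x \<and> r x \<le> I / (2 * \<gamma>)" if "x \<in> E" for x
  proof -
    have "2 * r x * \<gamma> \<le> I" using r[OF that] le_I[of "cball x (r x)"] by simp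
    then show ?thesis using r[OF that] l by (simp add: field_simps)
  qed
  have "E \<subseteq> (\<Union>x\<in>E. cball x (r x))" using r by force
  then obtain C where C: "countable C" "C \<subseteq> E"
     "pairwise (\<lambda>i j. disjnt (cball i (r i)) (cball j (r j))) C"
     "E \<subseteq> (\<Union>i\<in>C. cball i (5 * r i))"
    using Vitali_covering_lemma_cballs[of E "\<lambda>x. x" r E "I / (2 * \<gamma>)", OF _ rb] by auto
  have bound: "measure lebesgue (\<Union>i\<in>F. cball i (5 * r i)) \<le> 5 / \<gamma> * I" if F: "F \<subseteq> C" "finite F" for F
  proof -
    have "measure lebesgue (\<Union>i\<in>F. cball i (5 * r i)) \<le> (\<Sum>i\<in>F. measure lebesgue (cball i (5 * r i)))"
      using F by (intro measure_UNION_le) auto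
    also have "\<dots> \<le> (\<Sum>i\<in>F. 5 / \<gamma> * (LINT y:cball i (r i)|lborel. h y))"
    proof (rule sum_mono)
      fix i assume "i \<in> F"
      then have i: "i \<in> E" using F C by auto
      have "measure lebesgue (cball i (5 * r i)) = 10 * r i"
        using r(1)[OF i] by (simp add: cball_eq_atLeastAtMost)
      then show "measure lebesgue (cball i (5 * r i)) \<le> 5 / \<gamma> * (LINT y:cball i (r i)|lborel. h y)"
        using r[OF i] l by (simp add: field_simps)
    qed
    also have "\<dots> = 5 / \<gamma> * (\<Sum>i\<in>F. (LINT y:cball i (r i)|lborel. h y))"
      by (simp add: sum_distrib_left)
    also have "(\<Sum>i\<in>F. (LINT y:cball i (r i)|lborel. h y)) = (LINT y:(\<Union>i\<in>F. cball i (r i))|lborel. h y)"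
      using F C(3)
      by (intro set_integral_finite_Union[symmetric] si)
         (auto simp: disjoint_family_on_def pairwise_def disjnt_def subset_eq)
    also have "\<dots> \<le> I" using F by (intro le_I) auto
    finally show ?thesis using l by (simp add: mult_left_mono divide_right_mono)
  qed
  show ?thesis
  proof (intro bexI conjI allI impI)
    show "(\<Union>i\<in>C. cball i (5 * r i)) \<in> lmeasurable"
      by (rule fmeasurable_UN_bound[OF C(1) _ bound]) auto
    show "measure lebesgue (\<Union>i\<in>C. cball i (5 * r i)) \<le> 5 / \<gamma> * (LINT y|lborel. h y)"
      unfolding I_def[symmetric] by (rule measure_UN_bound[OF C(1) _ bound]) auto
    fix x s :: real assume "x \<notin> (\<Union>i\<in>C. cball i (5 * r i))" "s > 0"
    then have "x \<notin> E" using C(4) by blast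
    then show "(LINT y:cball x s|lborel. h y) \<le> 2 * s * \<gamma>" using \<open>s > 0\<close>
      unfolding E_def by (metis (mono_tags, lifting) mem_Collect_eq not_le)
  qed
qed

text \<open>If i is the least index with |w| \<le> 2^i \<delta>, the term j = i alone dominates the
  kernel: for i > 0 minimality gives |w| > 2^(i-1) \<delta>, and for i = 0 the kernel is at most
  1/\<delta>. The point is to replace the kernel by indicators of intervals, to which averages
  apply.\<close>

lemma cauchy_kernel_dyadic:
  fixes \<delta> w :: real
  assumes "\<delta> > 0" "\<bar>w\<bar> \<le> 2 ^ J * \<delta>"
  shows "\<delta> / (\<delta>\<^sup>2 + w\<^sup>2) \<le> (\<Sum>j\<le>J. 4 / (4 ^ j * \<delta>) * indicator {..2 ^ j * \<delta>} \<bar>w\<bar>)"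
proof -
  define i where "i = (LEAST j. \<bar>w\<bar> \<le> 2 ^ j * \<delta>)"
  have i: "\<bar>w\<bar> \<le> 2 ^ i * \<delta>" "i \<le> J" unfolding i_def using assms(2) by (auto intro: LeastI Least_le)
  have "\<delta> / (\<delta>\<^sup>2 + w\<^sup>2) \<le> 4 / (4 ^ i * \<delta>)"
  proof (cases i)
    case 0
    have "\<delta> / (\<delta>\<^sup>2 + w\<^sup>2) \<le> \<delta> / \<delta>\<^sup>2" using assms(1)
      by (intro divide_left_mono) (auto intro!: mult_pos_pos add_pos_nonneg)
    also have "\<dots> \<le> 4 / \<delta>" using assms(1) by (simp add: power2_eq_square field_simps)
    finally show ?thesis using 0 by simp
  next
    case (Suc k)
    then have "\<not> \<bar>w\<bar> \<le> 2 ^ k * \<delta>" using not_less_Least[of k "\<lambda>j. \<bar>w\<bar> \<le> 2 ^ j * \<delta>"] by (auto simp flip: i_def)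
    then have "(2 ^ k * \<delta>)\<^sup>2 \<le> \<bar>w\<bar>\<^sup>2" using assms(1) by (intro power_mono) auto
    moreover have "(2 ^ k * \<delta>)\<^sup>2 = 4 ^ k * \<delta>\<^sup>2"
    proof -
      have "(4::real) ^ k = 2 ^ k * 2 ^ k" by (simp flip: power_mult_distrib)
      then show ?thesis by (simp add: power2_eq_square)
    qed
    ultimately have "4 ^ k * \<delta>\<^sup>2 \<le> \<delta>\<^sup>2 + w\<^sup>2" by (simp add: add_increasing)
    then have "\<delta> / (\<delta>\<^sup>2 + w\<^sup>2) \<le> \<delta> / (4 ^ k * \<delta>\<^sup>2)"
      using assms(1) by (intro divide_left_mono mult_pos_pos) (auto intro: add_pos_nonneg)
    also have "\<dots> = 4 / (4 ^ i * \<delta>)" using Suc assms(1) by (simp add: power2_eq_square)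
    finally show ?thesis .
  qed
  also have "\<dots> = 4 / (4 ^ i * \<delta>) * indicator {..2 ^ i * \<delta>} \<bar>w\<bar>" using i by simp
  also have "\<dots> \<le> (\<Sum>j\<le>J. 4 / (4 ^ j * \<delta>) * indicator {..2 ^ j * \<delta>} \<bar>w\<bar>)"
    using i assms(1) by (intro member_le_sum) auto
  finally show ?thesis .
qed

text \<open>In the dyadic majorant the interval of half-length 2^j \<delta> contributes at most
  4/(4^j \<delta>) times 2 (2^j \<delta>) \<gamma>, that is 8 \<gamma> / 2^j, and the geometric
  series gives 16 \<gamma>. The bounded support makes finitely many scales suffice.\<close>

lemma cauchy_kernel_average_le:
  fixes h :: "real \<Rightarrow> real" and z :: real
  assumes h: "integrable lborel h" and nn: "\<And>y. h y \<ge> 0" and \<delta>: "\<delta> > 0"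
    and supp: "\<And>y. \<bar>z - y\<bar> > B \<Longrightarrow> h y = 0"
    and avg: "\<And>s. s > 0 \<Longrightarrow> (LINT y:cball z s|lborel. h y) \<le> 2 * s * \<gamma>"
  shows "integrable lborel (\<lambda>y. \<delta> / (\<delta>\<^sup>2 + (z - y)\<^sup>2) * h y)"
    and "(LINT y|lborel. \<delta> / (\<delta>\<^sup>2 + (z - y)\<^sup>2) * h y) \<le> 16 * \<gamma>"
proof -
  have [measurable]: "h \<in> borel_measurable borel" using h by auto
  obtain J :: nat where J: "2 ^ J > B / \<delta>" using real_arch_pow[of 2 "B / \<delta>"] by auto
  have pos: "\<delta>\<^sup>2 + x\<^sup>2 > 0" for x using \<delta> by (intro add_pos_nonneg) auto
  show i1: "integrable lborel (\<lambda>y. \<delta> / (\<delta>\<^sup>2 + (z - y)\<^sup>2) * h y)"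
  proof (rule Bochner_Integration.integrable_bound[of _ "\<lambda>y. 1 / \<delta> * h y"])
    have "\<delta> / (\<delta>\<^sup>2 + (z - y)\<^sup>2) \<le> \<delta> / \<delta>\<^sup>2" for y using \<delta> pos[of "z - y"] by (intro divide_left_mono) auto
    then have "\<delta> / (\<delta>\<^sup>2 + (z - y)\<^sup>2) \<le> 1 / \<delta>" for y using \<delta> by (simp add: power2_eq_square)
    then have "\<delta> / (\<delta>\<^sup>2 + (z - y)\<^sup>2) * h y \<le> 1 / \<delta> * h y" for y using nn by (intro mult_right_mono)
    moreover have "0 \<le> \<delta> / (\<delta>\<^sup>2 + (z - y)\<^sup>2) * h y" for y
      using \<delta> nn pos[of "z - y"] by (intro mult_nonneg_nonneg divide_nonneg_nonneg) auto
    ultimately show "AE y in lborel. norm (\<delta> / (\<delta>\<^sup>2 + (z - y)\<^sup>2) * h y) \<le> norm (1 / \<delta> * h y)"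
      using \<delta> nn by (intro AE_I2) (simp add: abs_of_nonneg)
  qed (use h in auto)
  have si: "integrable lborel (\<lambda>y. indicator (cball z s) y * h y)" for s
    using integrable_mult_indicator[of "cball z s" lborel h] h by simp
  have avg0: "\<gamma> \<ge> 0"
  proof -
    have "0 \<le> (LINT y:cball z 1|lborel. h y)" unfolding set_lebesgue_integral_def using nn by (intro integral_nonneg_AE) auto
    also have "\<dots> \<le> 2 * 1 * \<gamma>" by (rule avg) simp
    finally show ?thesis by simp
  qed
  have "(LINT y|lborel. \<delta> / (\<delta>\<^sup>2 + (z - y)\<^sup>2) * h y)
     \<le> (LINT y|lborel. (\<Sum>j\<le>J. 4 / (4 ^ j * \<delta>) * (indicator (cball z (2 ^ j * \<delta>)) y * h y)))"
  proof (rule integral_mono[OF i1])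
    show "integrable lborel (\<lambda>y. \<Sum>j\<le>J. 4 / (4 ^ j * \<delta>) * (indicator (cball z (2 ^ j * \<delta>)) y * h y))"
      using si by (intro Bochner_Integration.integrable_sum integrable_mult_right) auto
    fix y
    show "\<delta> / (\<delta>\<^sup>2 + (z - y)\<^sup>2) * h y \<le> (\<Sum>j\<le>J. 4 / (4 ^ j * \<delta>) * (indicator (cball z (2 ^ j * \<delta>)) y * h y))"
    proof (cases "\<bar>z - y\<bar> > B")
      case True then show ?thesis using supp by simp
    next
      case False
      have "B < 2 ^ J * \<delta>" using J \<delta> by (simp add: field_simps)
      then have "\<bar>z - y\<bar> \<le> 2 ^ J * \<delta>" using False by linarith
      from mult_right_mono[OF cauchy_kernel_dyadic[OF \<delta> this] nn[of y]]
      show ?thesis by (simp add: sum_distrib_right mult.assoc indicator_def dist_real_def cong: if_cong)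
    qed
  qed
  also have "\<dots> = (\<Sum>j\<le>J. 4 / (4 ^ j * \<delta>) * (LINT y:cball z (2 ^ j * \<delta>)|lborel. h y))"
    using si by (simp add: Bochner_Integration.integral_sum set_lebesgue_integral_def)
  also have "\<dots> \<le> (\<Sum>j\<le>J. 4 / (4 ^ j * \<delta>) * (2 * (2 ^ j * \<delta>) * \<gamma>))"
    using \<delta> by (intro sum_mono mult_left_mono avg) auto
  also have "\<dots> = (\<Sum>j\<le>J. 8 * \<gamma> * (1 / 2) ^ j)"
  proof (rule sum.cong)
    fix j :: nat
    have "(4::real) ^ j = 2 ^ j * 2 ^ j" by (simp flip: power_mult_distrib)
    then show "4 / (4 ^ j * \<delta>) * (2 * (2 ^ j * \<delta>) * \<gamma>) = 8 * \<gamma> * (1 / 2) ^ j"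
      using \<delta> by (simp add: field_simps)
  qed simp
  also have "\<dots> = 8 * \<gamma> * (\<Sum>j\<le>J. (1 / 2) ^ j)" by (simp add: sum_distrib_left)
  also have "(\<Sum>j\<le>J. (1 / 2 :: real) ^ j) \<le> 2"
    by (subst sum_gp0) (simp add: field_simps)
  finally show "(LINT y|lborel. \<delta> / (\<delta>\<^sup>2 + (z - y)\<^sup>2) * h y) \<le> 16 * \<gamma>" using avg0 by (simp add: mult_left_mono)
qed

section \<open>Cauchy and Poisson kernels on the circle\<close>

text \<open>The geometric series in z cnj t may be integrated term by term, because the L1 norms of
  its terms decay like \<open>norm z ^ k\<close>. Thus the Taylor coefficients of the Cauchy
  integral are the Fourier coefficients of \<open>u\<close> of nonnegative index.\<close>

lemma circ_cauchy_kernel_sums: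
  assumes u: "integrable circ u" and z: "norm z < 1"
  shows "(\<lambda>k. z ^ k * (LINT t|circ. cnj t ^ k * u t)) sums (LINT t|circ. u t / (1 - z * cnj t))"
    and "integrable circ (\<lambda>t. u t / (1 - z * cnj t))"
proof -
  have m [measurable]: "(\<lambda>t. cnj t ^ k) \<in> borel_measurable circ" for k
    by (intro measurable_circ_borel borel_measurable_continuous_onI continuous_intros)
  have mz [measurable]: "(\<lambda>t. inverse (1 - z * cnj t)) \<in> borel_measurable circ"
    by (intro measurable_circ_borel borel_measurable_inverse borel_measurable_continuous_onI continuous_intros)
  have mu [measurable]: "u \<in> borel_measurable circ" using u by auto
  define f where "f = (\<lambda>k t. (z * cnj t) ^ k * u t)"
  have nf: "norm (f k t) = norm z ^ k * norm (u t)" if "norm t = 1" for k t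
    using that by (simp add: f_def norm_mult norm_power)
  have AE1: "AE t in circ. norm t = 1" using AE_space[of circ] by eventually_elim (simp add: space_circ)
  have fi: "integrable circ (f k)" for k
  proof (rule Bochner_Integration.integrable_bound[OF u])
    show "f k \<in> borel_measurable circ" unfolding f_def power_mult_distrib by measurable
    show "AE t in circ. norm (f k t) \<le> norm (u t)"
      using AE1 by eventually_elim (use z in \<open>auto simp: nf intro!: mult_left_le_one_le power_le_one\<close>)
  qed
  have s1: "AE t in circ. summable (\<lambda>k. norm (f k t))"
    using AE1 by eventually_elim (use z in \<open>auto simp: nf intro!: summable_mult2 summable_geometric\<close>)
  have "(LINT t|circ. norm (f k t)) = norm z ^ k * (LINT t|circ. norm (u t))" for k
  proof -
    have "(LINT t|circ. norm (f k t)) = (LINT t|circ. norm z ^ k * norm (u t))"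
      by (rule integral_circ_AE_cong) (use AE1 in eventually_elim, simp add: nf)
    then show ?thesis by simp
  qed
  then have s2: "summable (\<lambda>k. LINT t|circ. norm (f k t))"
    using z by (auto intro!: summable_mult2 summable_geometric)
  have eq: "AE t in circ. (\<Sum>k. f k t) = u t / (1 - z * cnj t)"
    using AE1
  proof eventually_elim
    case (elim t)
    then have "norm (z * cnj t) < 1" using z by (simp add: norm_mult)
    from sums_mult2[OF geometric_sums[OF this], of "u t"]
    show ?case by (simp add: f_def sums_iff)
  qed
  show "integrable circ (\<lambda>t. u t / (1 - z * cnj t))"
    using integrable_suminf[OF fi s1 s2] eq by (rule integrable_circ_AE_cong)
  have "(LINT t|circ. f k t) = z ^ k * (LINT t|circ. cnj t ^ k * u t)" for k
    by (simp add: f_def power_mult_distrib mult.assoc)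
  then show "(\<lambda>k. z ^ k * (LINT t|circ. cnj t ^ k * u t)) sums (LINT t|circ. u t / (1 - z * cnj t))"
    using sums_integral[OF fi s1 s2] integral_circ_AE_cong[OF eq] by simp
qed

text \<open>The angle is counted in full turns, so that the kernel has period 1.\<close>

definition poisson_kernel :: "real \<Rightarrow> real \<Rightarrow> real" where
  "poisson_kernel r y = (1 - r\<^sup>2) / (norm (1 - of_real r * cis (2 * pi * y)))\<^sup>2"

text \<open>With v = z cnj w one has Re (1/(1-v)) = (1 - Re v)/|1-v|^2 and |1-v|^2 = 1 - 2 Re v +
  |v|^2. This is the link between Poisson and Cauchy integrals.\<close>

lemma poisson_kernel_eq_Re:
  fixes z w :: complex assumes "norm z < 1" "norm w = 1"
  shows "2 * Re (1 / (1 - z * cnj w)) - 1 = (1 - (norm z)\<^sup>2) / (norm (1 - z * cnj w))\<^sup>2"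
proof -
  define v where "v = z * cnj w"
  have nv: "norm v = norm z" using assms by (simp add: v_def norm_mult)
  have "v \<noteq> 1" using assms nv by (auto simp: v_def)
  then have n: "(norm (1 - v))\<^sup>2 > 0" by auto
  have "Re (1 / (1 - v)) = (1 - Re v) / (norm (1 - v))\<^sup>2"
    by (simp add: Re_divide cmod_power2)
  moreover have "(norm (1 - v))\<^sup>2 = 1 - 2 * Re v + (norm v)\<^sup>2"
    unfolding cmod_power2 by (simp add: power2_eq_square algebra_simps)
  moreover have "2 * ((1 - x) / N) - 1 = (1 - m) / N" if "N > 0" "N = 1 - 2 * x + m" for x m N :: real
    using that by (simp add: field_simps)
  ultimately show ?thesis using n unfolding v_def[symmetric] nv[symmetric] by metis
qed

lemma poisson_kernel_nonneg: "0 \<le> r \<Longrightarrow> r < 1 \<Longrightarrow> poisson_kernel r y \<ge> 0"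
  unfolding poisson_kernel_def by (intro divide_nonneg_nonneg) (simp_all add: power_le_one)

lemma poisson_kernel_shift: "poisson_kernel r (y + 1) = poisson_kernel r y" "poisson_kernel r (y - 1) = poisson_kernel r y"
proof -
  have "cis (2 * pi * (x + 1)) = cis (2 * pi * x)" for x
    by (simp add: distrib_left flip: cis_mult)
  from this[of y] this[of "y - 1"]
  show "poisson_kernel r (y + 1) = poisson_kernel r y" "poisson_kernel r (y - 1) = poisson_kernel r y"
    by (simp_all add: poisson_kernel_def)
qed

lemma sin_ge_half: assumes "0 \<le> x" "x \<le> pi / 2" shows "sin x \<ge> x / (2::real)"
proof -
  have "\<bar>sin x - (\<Sum>m<3. sin_coeff m * x ^ m)\<bar> \<le> inverse (fact 3) * \<bar>x\<bar> ^ 3" by (rule Maclaurin_sin_bound)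
  then have "\<bar>sin x - x\<bar> \<le> x ^ 3 / 6"
    using assms by (simp add: numeral_3_eq_3 sin_coeff_def fact_numeral field_simps)
  moreover have "x ^ 3 / 6 \<le> x / 2"
  proof -
    \<comment> \<open>1.6 is a rational upper bound of pi/2 whose square is below 3.\<close>
    have "x \<le> 1.6" using assms pi_less_4 pi_approx by simp
    then have "x\<^sup>2 \<le> 1.6\<^sup>2" using assms by (intro power_mono) auto
    then have "x * x\<^sup>2 \<le> x * 3" using assms by (intro mult_left_mono) (auto simp: power2_eq_square)
    then show ?thesis by (simp add: power3_eq_cube power2_eq_square)
  qed
  ultimately show ?thesis by linarith
qed

text \<open>The squared denominator is (1-r)^2 + 4 r sin^2 (pi y). Since 4 r \<ge> 1 and |sin (pi
  y)| \<ge> |y| in this range, it is at least (1-r)^2 + y^2; the numerator is (1-r)(1+r) \<le> 2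
  (1-r).\<close>

lemma poisson_kernel_le_near:
  assumes r: "1/2 \<le> r" "r < 1" and y: "\<bar>y\<bar> \<le> 1/2"
  shows "poisson_kernel r y \<le> 2 * ((1 - r) / ((1 - r)\<^sup>2 + y\<^sup>2))"
proof -
  have "(norm (1 - of_real r * cis (2 * pi * y)))\<^sup>2 = (1 - r)\<^sup>2 + 2 * r * (1 - cos (2 * pi * y))"
  proof -
    have "(norm (1 - of_real r * cis (2 * pi * y)))\<^sup>2 = (1 - r * cos (2*pi*y))\<^sup>2 + (r * sin (2*pi*y))\<^sup>2"
      by (simp add: cmod_power2)
    also have "\<dots> = 1 - 2 * r * cos (2*pi*y) + r\<^sup>2 * ((sin (2*pi*y))\<^sup>2 + (cos (2*pi*y))\<^sup>2)"
      by (simp add: power2_eq_square algebra_simps del: sin_cos_squared_add sin_cos_squared_add2 sin_cos_squared_add3)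
    also have "\<dots> = (1 - r)\<^sup>2 + 2 * r * (1 - cos (2 * pi * y))"
      by (simp add: power2_eq_square algebra_simps)
    finally show ?thesis .
  qed
  also have "1 - cos (2 * pi * y) = 2 * (sin (pi * y))\<^sup>2"
    using cos_double_sin[of "pi * y"] by (simp add: mult_ac)
  finally have n: "(norm (1 - of_real r * cis (2 * pi * y)))\<^sup>2 = (1 - r)\<^sup>2 + 4 * r * (sin (pi * y))\<^sup>2" by simp
  have "\<bar>y\<bar> \<le> \<bar>sin (pi * y)\<bar>"
  proof -
    have "sin (pi * \<bar>y\<bar>) \<ge> pi * \<bar>y\<bar> / 2" using y by (intro sin_ge_half) auto
    moreover have "pi * \<bar>y\<bar> / 2 \<ge> \<bar>y\<bar>" using pi_gt3 mult_right_mono[of 2 pi "\<bar>y\<bar>"] by simp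
    ultimately have "\<bar>y\<bar> \<le> sin (pi * \<bar>y\<bar>)" by linarith
    also have "\<dots> \<le> \<bar>sin (pi * y)\<bar>" by (cases "y \<ge> 0") auto
    finally show ?thesis .
  qed
  then have "y\<^sup>2 \<le> (sin (pi * y))\<^sup>2" by (simp add: abs_le_square_iff)
  then have "y\<^sup>2 \<le> 4 * r * (sin (pi * y))\<^sup>2"
    using r mult_right_mono[of 1 "4 * r" "(sin (pi * y))\<^sup>2"] by simp
  then have le: "(1 - r)\<^sup>2 + y\<^sup>2 \<le> (norm (1 - of_real r * cis (2 * pi * y)))\<^sup>2" using n by simp
  have pos: "(1 - r)\<^sup>2 + y\<^sup>2 > 0" using r by (intro add_pos_nonneg) auto
  have "1 - r\<^sup>2 = (1 - r) * (1 + r)" by (simp add: power2_eq_square algebra_simps)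
  also have "\<dots> \<le> (1 - r) * 2" using r by (intro mult_left_mono) auto
  finally have "1 - r\<^sup>2 \<le> 2 * (1 - r)" by simp
  then have "poisson_kernel r y \<le> 2 * (1 - r) / ((1 - r)\<^sup>2 + y\<^sup>2)"
    unfolding poisson_kernel_def using le pos r by (intro frac_le) auto
  then show ?thesis by simp
qed

text \<open>Differences of points of [0,1] fill [-1,1]. One of y, y + 1, y - 1 lies within 1/2 of 0,
  and by periodicity the estimate near 0 applies to it; the other two terms are nonnegative.\<close>

lemma poisson_kernel_le:
  assumes r: "1/2 \<le> r" "r < 1" and y: "\<bar>y\<bar> \<le> 1"
  shows "poisson_kernel r y \<le> 2 * ((1 - r) / ((1 - r)\<^sup>2 + y\<^sup>2)) + 2 * ((1 - r) / ((1 - r)\<^sup>2 + (y + 1)\<^sup>2))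
     + 2 * ((1 - r) / ((1 - r)\<^sup>2 + (y - 1)\<^sup>2))"
proof -
  have nn: "(1 - r) / ((1 - r)\<^sup>2 + a\<^sup>2) \<ge> 0" for a using r by auto
  consider "\<bar>y\<bar> \<le> 1/2" | "\<bar>y + 1\<bar> \<le> 1/2" | "\<bar>y - 1\<bar> \<le> 1/2" using y by linarith
  then show ?thesis
  proof cases
    case 1 then show ?thesis using poisson_kernel_le_near[OF r, of y] nn[of "y + 1"] nn[of "y - 1"] by linarith
  next
    case 2 then show ?thesis using poisson_kernel_le_near[OF r, of "y + 1"] nn[of y] nn[of "y - 1"]
      unfolding poisson_kernel_shift by linarith
  next
    case 3 then show ?thesis using poisson_kernel_le_near[OF r, of "y - 1"] nn[of y] nn[of "y + 1"]
      unfolding poisson_kernel_shift by linarith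
  qed
qed

lemma continuous_poisson_kernel:
  assumes "0 \<le> r" "r < 1" shows "continuous_on UNIV (poisson_kernel r)"
proof -
  have "norm (of_real r * cis (2 * pi * y)) \<noteq> norm (1::complex)" for y using assms by (simp add: norm_mult)
  then have "of_real r * cis (2 * pi * y) \<noteq> 1" for y by metis
  then have "(norm (1 - of_real r * cis (2 * pi * y)))\<^sup>2 \<noteq> 0" for y
    by (metis eq_iff_diff_eq_0 norm_eq_zero power_not_zero)
  then show ?thesis unfolding poisson_kernel_def
    by (intro continuous_on_divide continuous_intros) blast
qed

text \<open>All Fourier coefficients of the constant 1 vanish except the one of index 0, so its
  Cauchy integral is 1; the real part gives the mass of the Poisson kernel.\<close>

lemma poisson_kernel_integral:
  assumes r: "0 \<le> r" "r < 1"
  shows "(LINT x:{0..<1}|lborel. poisson_kernel r (a - x)) = 1"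
proof -
  define z where "z = of_real r * cis (2 * pi * a)"
  have z: "norm z < 1" "norm z = r" using r by (simp_all add: z_def norm_mult)
  have "(\<lambda>k. z ^ k * (LINT t|circ. cnj t ^ k * 1)) sums (LINT t|circ. 1 / (1 - z * cnj t))"
    by (rule circ_cauchy_kernel_sums) (use z in auto)
  moreover have "(LINT t|circ. cnj t ^ k * 1) = (if k = 0 then 1 else 0)" for k
  proof -
    have "(LINT t|circ. cnj t ^ k * 1) = (LINT t|circ. t powi (- int k))"
    proof (rule integral_circ_AE_cong)
      show "AE t in circ. cnj t ^ k * 1 = t powi - int k"
        using AE_space[of circ]
      proof eventually_elim
        case (elim t)
        then have "t * cnj t = 1" by (simp add: space_circ complex_norm_square[symmetric])
        then have "cnj t = inverse t" by (metis inverse_unique)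
        then show ?case by (simp add: power_int_minus power_inverse)
      qed
    qed
    then show ?thesis unfolding integral_circ_powi by simp
  qed
  ultimately have "(\<lambda>k. z ^ k * (if k = 0 then 1 else 0)) sums (LINT t|circ. 1 / (1 - z * cnj t))"
    by (simp only:)
  moreover have "(\<lambda>k. z ^ k * (if k = 0 then 1 else 0)) = (\<lambda>k. if k = 0 then 1 else 0)" by auto
  ultimately have "(\<lambda>k::nat. if k = 0 then 1 else 0) sums (LINT t|circ. 1 / (1 - z * cnj t))" by (simp only:)
  then have C: "(LINT t|circ. 1 / (1 - z * cnj t)) = 1" using sums_single[of 0 "\<lambda>_. 1::complex"] sums_unique2 by blast
  have ki: "integrable circ (\<lambda>t. 1 / (1 - z * cnj t))"
    by (rule circ_cauchy_kernel_sums) (use z in auto)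
  define v where "v = (\<lambda>t. 2 * Re (1 / (1 - z * cnj t)) - 1)"
  have mv: "v \<in> borel_measurable borel" unfolding v_def
    by (intro borel_measurable_diff borel_measurable_times borel_measurable_const measurable_compose[OF _ borel_measurable_Re]
         borel_measurable_divide borel_measurable_continuous_onI continuous_intros)
  have "(LINT t|circ. v t) = 2 * Re (LINT t|circ. 1 / (1 - z * cnj t)) - 1"
    unfolding v_def using ki emeasure_circ_space
    by (subst Bochner_Integration.integral_diff) (auto simp: measure_def)
  then have "(LINT t|circ. v t) = 1" using C by simp
  then have "(LINT x:{0..<1}|lborel. v (cis (2 * pi * x))) = 1" using integral_circ_eq[OF mv] by simp
  moreover have "v (cis (2 * pi * x)) = poisson_kernel r (a - x)" for x
  proof -
    have "v (cis (2 * pi * x)) = (1 - (norm z)\<^sup>2) / (norm (1 - z * cnj (cis (2 * pi * x))))\<^sup>2"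
      unfolding v_def using z by (intro poisson_kernel_eq_Re) auto
    also have "z * cnj (cis (2 * pi * x)) = of_real r * cis (2 * pi * (a - x))"
      by (simp add: z_def cis_cnj cis_mult ring_distribs)
    finally show ?thesis using z by (simp add: poisson_kernel_def)
  qed
  ultimately show ?thesis by simp
qed

section \<open>Poisson integrals in the angular coordinate\<close>

lemma eventually_at_left_1: "eventually (\<lambda>r. 1/2 \<le> r \<and> r < 1) (at_left (1::real))"
  by (rule eventually_at_leftI[of "1/2"]) auto

definition poisson_line :: "real \<Rightarrow> (real \<Rightarrow> real) \<Rightarrow> real \<Rightarrow> real" where
  "poisson_line r u a = (LINT x:{0..<1}|lborel. poisson_kernel r (a - x) * u x)"

lemma poisson_kernel_le_const:
  assumes "0 \<le> r" "r < 1" shows "poisson_kernel r y \<le> (1 - r\<^sup>2) / (1 - r)\<^sup>2"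
proof -
  have "1 - r \<le> norm (1 - of_real r * cis (2 * pi * y))"
    using norm_triangle_ineq2[of 1 "of_real r * cis (2 * pi * y)"] assms by (simp add: norm_mult)
  then have "(1 - r)\<^sup>2 \<le> (norm (1 - of_real r * cis (2 * pi * y)))\<^sup>2" using assms by (intro power_mono) auto
  moreover have "0 \<le> 1 - r\<^sup>2" using assms by (simp add: power_le_one)
  ultimately show ?thesis unfolding poisson_kernel_def using assms by (intro divide_left_mono) (auto intro!: mult_pos_pos)
qed

lemma measurable_poisson_kernel [measurable]:
  assumes "0 \<le> r" "r < 1" shows "(\<lambda>x. poisson_kernel r (a - x)) \<in> borel_measurable borel"
  by (rule measurable_compose[OF _ borel_measurable_continuous_onI[OF continuous_poisson_kernel[OF assms]]]) simp

lemma set_integrable_poisson_kernel: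
  assumes r: "0 \<le> r" "r < 1" and u: "set_integrable lborel {0..<1} u" "u \<in> borel_measurable borel"
  shows "set_integrable lborel {0..<1} (\<lambda>x. poisson_kernel r (a - x) * u x)"
  unfolding set_integrable_def
proof (rule Bochner_Integration.integrable_bound)
  define B where "B = (1 - r\<^sup>2) / (1 - r)\<^sup>2"
  show "integrable lborel (\<lambda>x. B * (indicator {0..<1} x *\<^sub>R u x))"
    using u unfolding set_integrable_def by (intro integrable_mult_right) auto
  have [measurable]: "u \<in> borel_measurable borel" "(\<lambda>x. poisson_kernel r (a - x)) \<in> borel_measurable borel" using u r by auto
  show "(\<lambda>x. indicator {0..<1} x *\<^sub>R (poisson_kernel r (a - x) * u x)) \<in> borel_measurable lborel" by simp
  show "AE x in lborel. norm (indicator {0..<1} x *\<^sub>R (poisson_kernel r (a - x) * u x)) \<le> norm (B * (indicator {0..<1} x *\<^sub>R u x))"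
  proof (rule AE_I2)
    fix x
    have "0 \<le> poisson_kernel r (a - x)" "poisson_kernel r (a - x) \<le> B"
      using poisson_kernel_nonneg[OF r] poisson_kernel_le_const[OF r] by (auto simp: B_def)
    then show "norm (indicator {0..<1} x *\<^sub>R (poisson_kernel r (a - x) * u x)) \<le> norm (B * (indicator {0..<1} x *\<^sub>R u x))"
      by (auto simp: indicator_def abs_mult intro!: mult_right_mono)
  qed
qed

lemma poisson_line_add:
  assumes r: "0 \<le> r" "r < 1" and "set_integrable lborel {0..<1} u" "u \<in> borel_measurable borel"
    and "set_integrable lborel {0..<1} v" "v \<in> borel_measurable borel"
  shows "poisson_line r (\<lambda>x. u x + v x) a = poisson_line r u a + poisson_line r v a"
    and "poisson_line r (\<lambda>x. u x - v x) a = poisson_line r u a - poisson_line r v a"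
  unfolding poisson_line_def
  using set_integrable_poisson_kernel[OF r assms(3,4)] set_integrable_poisson_kernel[OF r assms(5,6)]
  by (simp_all only: distrib_left right_diff_distrib set_integral_add set_integral_diff)

lemma poisson_line_cmult: "poisson_line r (\<lambda>x. u x * c) a = poisson_line r u a * c"
  unfolding poisson_line_def by (simp only: set_integral_mult_left mult.assoc[symmetric])

lemma poisson_line_one: "0 \<le> r \<Longrightarrow> r < 1 \<Longrightarrow> poisson_line r (\<lambda>_. c) a = c"
  using poisson_line_cmult[of r "\<lambda>_. 1" c a] poisson_kernel_integral[of r a] by (simp add: poisson_line_def)

lemma abs_set_integral_01_le:
  fixes f :: "real \<Rightarrow> real"
  assumes "\<And>x. x \<in> {0..<1} \<Longrightarrow> \<bar>f x\<bar> \<le> c" "c \<ge> 0"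
  shows "\<bar>LINT x:{0..<1}|lborel. f x\<bar> \<le> c"
proof (cases "set_integrable lborel {0..<1} f")
  case True
  have "norm (LINT x:{0..<1}|lborel. f x) \<le> (LINT x|lborel. norm (indicator {0..<1} x *\<^sub>R f x))"
    unfolding set_lebesgue_integral_def by (rule integral_norm_bound)
  also have "\<dots> \<le> (LINT x|lborel. indicator {0..<1::real} x *\<^sub>R c)"
  proof (rule integral_mono)
    show "integrable lborel (\<lambda>x. norm (indicator {0..<1} x *\<^sub>R f x))"
      using True unfolding set_integrable_def by (rule integrable_norm)
    have "integrable lborel (indicator {0..<1::real} :: real \<Rightarrow> real)" by (rule integrable_real_indicator) auto
    then show "integrable lborel (\<lambda>x. indicator {0..<1::real} x *\<^sub>R c)" by (rule integrable_scaleR_left)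
  qed (use assms in \<open>auto simp: indicator_def\<close>)
  also have "\<dots> = c" by simp
  finally show ?thesis by simp
next
  \<comment> \<open>A function that is not integrable has integral 0 by default.\<close>
  case False
  then show ?thesis using assms(2) unfolding set_integrable_def set_lebesgue_integral_def
    by (simp add: not_integrable_integral_eq)
qed

lemma set_integrable_01_bounded:
  fixes u :: "real \<Rightarrow> real"
  assumes "u \<in> borel_measurable borel" "\<And>x. \<bar>u x\<bar> \<le> 1"
  shows "set_integrable lborel {0..<1} u"
  unfolding set_integrable_def
  by (rule Bochner_Integration.integrable_bound[of _ "indicator {0..<1} :: real \<Rightarrow> real"])
     (use assms in \<open>auto simp: indicator_def intro!: integrable_real_indicator\<close>)

text \<open>Localization: the constant u a is reproduced by the kernel, and u x - u a vanishes near
  a, where the kernel is large. Away from a the kernel is of order 1 - r.\<close>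

lemma poisson_line_locally_constant:
  assumes u: "u \<in> borel_measurable borel" "\<And>x. \<bar>u x\<bar> \<le> 1" and a: "0 < a" "a < 1"
    and e: "e > 0" "\<And>x. \<bar>a - x\<bar> < e \<Longrightarrow> u x = u a"
  shows "((\<lambda>r. poisson_line r u a) \<longlongrightarrow> u a) (at_left 1)"
proof (rule LIM_zero_cancel, rule Lim_null_comparison)
  \<comment> \<open>Bounding d by a and 1 - a keeps the shifted arguments a - x + 1 and a - x - 1 at
    distance at least d from 0 for every x in [0,1).\<close>
  define d where "d = min e (min a (1 - a))"
  have d: "d > 0" "d \<le> e" "d \<le> a" "d \<le> 1 - a" using a e by (auto simp: d_def)
  have ui: "set_integrable lborel {0..<1} u" by (rule set_integrable_01_bounded[OF u])
  have ci: "set_integrable lborel {0..<1} (\<lambda>_::real. u a)"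
    unfolding set_integrable_def by simp
  \<comment> \<open>Three kernels contribute 2 (1 - r)/d^2 each, and |u x - u a| \<le> 2, hence the
    constant 12.\<close>
  show "\<forall>\<^sub>F r in at_left 1. norm (poisson_line r u a - u a) \<le> 12 * (1 - r) / d\<^sup>2"
    using eventually_at_left_1
  proof eventually_elim
    case (elim r)
    have "poisson_line r u a - u a = poisson_line r u a - poisson_line r (\<lambda>_. u a) a"
      using elim by (simp add: poisson_line_one)
    also have "\<dots> = poisson_line r (\<lambda>x. u x - u a) a"
      using elim ui u ci by (intro poisson_line_add(2)[symmetric]) auto
    also have "\<bar>\<dots>\<bar> \<le> 12 * (1 - r) / d\<^sup>2"
      unfolding poisson_line_def
    proof (rule abs_set_integral_01_le)
      show "0 \<le> 12 * (1 - r) / d\<^sup>2" using elim by auto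
      fix x :: real assume x: "x \<in> {0..<1}"
      have far: "(1 - r) / ((1 - r)\<^sup>2 + w\<^sup>2) \<le> (1 - r) / d\<^sup>2" if "\<bar>w\<bar> \<ge> d" for w
      proof -
        have "d\<^sup>2 \<le> \<bar>w\<bar>\<^sup>2" using that d by (intro power_mono) auto
        then have "d\<^sup>2 \<le> (1 - r)\<^sup>2 + w\<^sup>2" by (simp add: add_increasing)
        then show ?thesis using elim d by (intro divide_left_mono) (auto intro!: mult_pos_pos intro: add_pos_nonneg)
      qed
      show "\<bar>poisson_kernel r (a - x) * (u x - u a)\<bar> \<le> 12 * (1 - r) / d\<^sup>2"
      proof (cases "\<bar>a - x\<bar> < e")
        case True
        then show ?thesis using e(2)[OF True] elim by simp
      next
        case False
        have "poisson_kernel r (a - x) \<le> 2 * ((1 - r) / ((1 - r)\<^sup>2 + (a - x)\<^sup>2)) + 2 * ((1 - r) / ((1 - r)\<^sup>2 + (a - x + 1)\<^sup>2))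
            + 2 * ((1 - r) / ((1 - r)\<^sup>2 + (a - x - 1)\<^sup>2))"
          using elim x a by (intro poisson_kernel_le) auto
        also have "\<dots> \<le> 2 * ((1 - r) / d\<^sup>2) + 2 * ((1 - r) / d\<^sup>2) + 2 * ((1 - r) / d\<^sup>2)"
          using False d x a by (intro add_mono mult_left_mono far) auto
        also have "2 * (x / y) + 2 * (x / y) + 2 * (x / y) = 6 * x / y" for x y :: real by simp
        finally have "poisson_kernel r (a - x) \<le> 6 * (1 - r) / d\<^sup>2" .
        moreover have "poisson_kernel r (a - x) \<ge> 0" using elim by (intro poisson_kernel_nonneg) auto
        moreover have "\<bar>u x - u a\<bar> \<le> 2" using u(2)[of x] u(2)[of a] by linarith
        ultimately have "\<bar>poisson_kernel r (a - x)\<bar> * \<bar>u x - u a\<bar> \<le> (6 * (1 - r) / d\<^sup>2) * 2"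
          by (intro mult_mono) auto
        then show ?thesis by (simp add: abs_mult)
      qed
    qed
    finally show ?case by simp
  qed
  show "((\<lambda>r. 12 * (1 - r) / d\<^sup>2) \<longlongrightarrow> 0) (at_left 1)"
    using d by (auto intro!: tendsto_eq_intros)
qed

text \<open>Cauchy kernels centered at a, a + 1 and a - 1 dominate the Poisson kernel. Each average
  is at most 16 \<gamma> and enters with the factor 2, which gives 96 \<gamma>.\<close>

lemma poisson_line_maximal:
  assumes u: "u \<in> borel_measurable borel" "set_integrable lborel {0..<1} u" and g: "\<gamma> > 0"
  shows "\<exists>T\<in>lmeasurable. measure lebesgue T \<le> 15 / \<gamma> * (LINT x:{0..<1}|lborel. \<bar>u x\<bar>) \<and>
    (\<forall>a r. a \<in> {0<..<1} \<longrightarrow> a \<notin> T \<longrightarrow> 1/2 \<le> r \<longrightarrow> r < 1 \<longrightarrow> \<bar>poisson_line r u a\<bar> \<le> 96 * \<gamma>)"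
proof -
  define h where "h = (\<lambda>x. indicator {0..<1} x * \<bar>u x\<bar>)"
  have h: "integrable lborel h" "\<And>y. h y \<ge> 0"
    using u integrable_abs[of lborel "\<lambda>x. indicator {0..<1} x *\<^sub>R u x"]
    unfolding h_def set_integrable_def by (auto simp: abs_mult)
  obtain T where T: "T \<in> lmeasurable" "measure lebesgue T \<le> 5 / \<gamma> * (LINT y|lborel. h y)"
    "\<And>x s. x \<notin> T \<Longrightarrow> s > 0 \<Longrightarrow> (LINT y:cball x s|lborel. h y) \<le> 2 * s * \<gamma>"
    using hardy_littlewood_maximal[OF h g] by blast
  \<comment> \<open>The translates ensure that for a outside \<open>T'\<close> the points a + 1 and
    a - 1 are outside \<open>T\<close> as well; they triple the measure, whence 15 instead of
    5.\<close>
  define T' where "T' = T \<union> ((+) 1 ` T \<union> (+) (-1) ` T)"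
  have mt: "(+) c ` T \<in> lmeasurable" "measure lebesgue ((+) c ` T) = measure lebesgue T" for c
    using T(1) by (auto simp: measurable_translation measure_translation)
  have T'm: "T' \<in> lmeasurable" unfolding T'_def by (intro fmeasurable.Un T(1) mt)
  have "measure lebesgue T' \<le> measure lebesgue T + (measure lebesgue ((+) 1 ` T) + measure lebesgue ((+) (-1) ` T))"
  proof -
    have "measure lebesgue T' \<le> measure lebesgue T + measure lebesgue ((+) 1 ` T \<union> (+) (-1) ` T)"
      unfolding T'_def by (intro measure_Un_le sets.Un fmeasurableD T(1) mt)
    moreover have "measure lebesgue ((+) 1 ` T \<union> (+) (-1) ` T) \<le> measure lebesgue ((+) 1 ` T) + measure lebesgue ((+) (-1) ` T)"
      by (intro measure_Un_le sets.Un fmeasurableD T(1) mt)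
    ultimately show ?thesis by linarith
  qed
  then have meas: "measure lebesgue T' \<le> 15 / \<gamma> * (LINT x:{0..<1}|lborel. \<bar>u x\<bar>)"
    using T(2) unfolding mt(2) by (simp add: h_def set_lebesgue_integral_def)
  have "\<bar>poisson_line r u a\<bar> \<le> 96 * \<gamma>" if a: "a \<in> {0<..<1}" "a \<notin> T'" and r: "1/2 \<le> r" "r < 1" for a r
  proof -
    define q where "q = (\<lambda>z y. (1 - r) / ((1 - r)\<^sup>2 + (z - y)\<^sup>2) * h y)"
    have q: "integrable lborel (q z)" "(LINT y|lborel. q z y) \<le> 16 * \<gamma>" if "z \<in> {a, a + 1, a - 1}" for z
    proof -
      have z: "z \<notin> T"
      proof
        assume "z \<in> T"
        then have "z \<in> T'" "1 + z \<in> T'" "-1 + z \<in> T'" by (auto simp: T'_def)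
        with that a(2) show False by auto
      qed
      have supp: "h y = 0" if "\<bar>z - y\<bar> > 3" for y using that \<open>z \<in> _\<close> a by (auto simp: h_def indicator_def)
      show "integrable lborel (q z)" "(LINT y|lborel. q z y) \<le> 16 * \<gamma>"
        using cauchy_kernel_average_le[OF h, where \<delta> = "1 - r" and z = z and B = 3 and \<gamma> = \<gamma>] supp T(3)[OF z] r unfolding q_def by auto
    qed
    have "\<bar>poisson_line r u a\<bar> \<le> (LINT x|lborel. norm (indicator {0..<1} x *\<^sub>R (poisson_kernel r (a - x) * u x)))"
      unfolding poisson_line_def set_lebesgue_integral_def real_norm_def[symmetric] by (rule integral_norm_bound)
    also have "\<dots> \<le> (LINT x|lborel. 2 * q a x + 2 * q (a + 1) x + 2 * q (a - 1) x)"
    proof (rule integral_mono)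
      show "integrable lborel (\<lambda>x. norm (indicator {0..<1} x *\<^sub>R (poisson_kernel r (a - x) * u x)))"
        using set_integrable_poisson_kernel[of r u a] r u unfolding set_integrable_def by (intro integrable_norm) auto
      show "integrable lborel (\<lambda>x. 2 * q a x + 2 * q (a + 1) x + 2 * q (a - 1) x)"
        using q by (intro Bochner_Integration.integrable_add integrable_mult_right) auto
      fix x
      show "norm (indicator {0..<1} x *\<^sub>R (poisson_kernel r (a - x) * u x)) \<le> 2 * q a x + 2 * q (a + 1) x + 2 * q (a - 1) x"
      proof (cases "x \<in> {0..<1}")
        case True
        have "poisson_kernel r (a - x) * \<bar>u x\<bar> \<le> (2 * ((1 - r) / ((1 - r)\<^sup>2 + (a - x)\<^sup>2)) + 2 * ((1 - r) / ((1 - r)\<^sup>2 + (a - x + 1)\<^sup>2))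
            + 2 * ((1 - r) / ((1 - r)\<^sup>2 + (a - x - 1)\<^sup>2))) * \<bar>u x\<bar>"
          using r True a by (intro mult_right_mono poisson_kernel_le) auto
        also have "a - x + 1 = a + 1 - x" by simp
        also have "a - x - 1 = a - 1 - x" by simp
        finally show ?thesis using True poisson_kernel_nonneg[of r "a - x"] r
          by (simp add: abs_mult q_def h_def ring_distribs mult.assoc)
      next
        case False
        then show ?thesis by (simp add: q_def h_def)
      qed
    qed
    also have "\<dots> = 2 * (LINT x|lborel. q a x) + 2 * (LINT x|lborel. q (a + 1) x) + 2 * (LINT x|lborel. q (a - 1) x)"
      using q by simp
    also have "\<dots> \<le> 96 * \<gamma>" using q(2)[of a] q(2)[of "a + 1"] q(2)[of "a - 1"] by simp
    finally show ?thesis .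
  qed
  then show ?thesis using T'm meas by blast
qed

section \<open>Almost everywhere convergence for integrable densities\<close>

definition poisson_good :: "(real \<Rightarrow> real) \<Rightarrow> bool" where
  "poisson_good u \<longleftrightarrow> u \<in> borel_measurable borel \<and> set_integrable lborel {0..<1} u \<and>
    (AE a in lborel. a \<in> {0<..<1} \<longrightarrow> ((\<lambda>r. poisson_line r u a) \<longlongrightarrow> u a) (at_left 1))"

text \<open>
  Almost everywhere convergence survives \<open>L\<^sup>1\<close> limits since the maximal inequality controls
  \<open>u - s i\<close> outside small sets. So it suffices to treat indicators of half-lines.
\<close>

lemma poisson_good_limit:
  assumes s: "\<And>i::nat. poisson_good (s i)" and u: "u \<in> borel_measurable borel" "set_integrable lborel {0..<1} u"
    and lim: "(\<lambda>i. LINT x:{0..<1}|lborel. \<bar>u x - s i x\<bar>) \<longlonglongrightarrow> 0"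
  shows "poisson_good u"
proof -
  have sm: "s i \<in> borel_measurable borel" "set_integrable lborel {0..<1} (s i)" for i
    using s by (auto simp: poisson_good_def)
  define S where "S = (\<lambda>e. {a \<in> {0<..<1}. \<not> (\<forall>\<^sub>F r in at_left 1. \<bar>poisson_line r u a - u a\<bar> \<le> e)})"
  have neg: "negligible (S e)" if e: "e > 0" for e
    \<comment> \<open>Negligibility is tested by covers of small measure, which avoids proving that
      \<open>S e\<close> is measurable.\<close>
    unfolding negligible_outer_le
  proof (intro allI impI)
    fix \<epsilon> :: real assume eps: "\<epsilon> > 0"
    \<comment> \<open>The bound 96 \<gamma> of the maximal inequality becomes e/3, one of three
      equal shares of the tolerance e.\<close>
    define \<gamma> where "\<gamma> = e / 288"
    have g: "\<gamma> > 0" using e by (simp add: \<gamma>_def)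
    \<comment> \<open>The two summands bound the measures of \<open>T\<close> (maximal inequality)
      and of \<open>M\<close> (Markov inequality) relative to the L1 distance.\<close>
    define C where "C = 15 / \<gamma> + 3 / e"
    have C: "C > 0" using e g by (auto simp: C_def intro!: add_pos_pos)
    obtain i where i: "(LINT x:{0..<1}|lborel. \<bar>u x - s i x\<bar>) < \<epsilon> / C"
      using order_tendstoD(2)[OF lim, of "\<epsilon> / C"] eps C by (auto simp: eventually_sequentially)
    define h where "h = (\<lambda>x. u x - s i x)"
    have h: "h \<in> borel_measurable borel" "set_integrable lborel {0..<1} h"
      unfolding h_def using u sm by (auto intro!: set_integral_diff)
    define I where "I = (LINT x:{0..<1}|lborel. \<bar>h x\<bar>)"
    have "I < \<epsilon> / C" using i by (simp add: I_def h_def)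
    then have CI: "C * I \<le> \<epsilon>" using C by (simp add: field_simps)
    obtain T where T: "T \<in> lmeasurable" "measure lebesgue T \<le> 15 / \<gamma> * I"
      "\<And>a r. a \<in> {0<..<1} \<Longrightarrow> a \<notin> T \<Longrightarrow> 1/2 \<le> r \<Longrightarrow> r < 1 \<Longrightarrow> \<bar>poisson_line r h a\<bar> \<le> 96 * \<gamma>"
      using poisson_line_maximal[OF h g] unfolding I_def by blast
    define M where "M = {x \<in> space lborel. e / 3 \<le> indicator {0..<1} x * \<bar>h x\<bar>}"
    have hi: "integrable lborel (\<lambda>x. indicator {0..<1} x * \<bar>h x\<bar>)"
      using integrable_abs[OF h(2)[unfolded set_integrable_def]] by (simp add: abs_mult)
    have Mm: "M \<in> sets lborel" unfolding M_def using h(1) by measurable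
    have Me: "emeasure lborel M \<le> ennreal (3 / e * I)"
    proof -
      have "emeasure lborel {x \<in> space lborel. e / 3 \<le> indicator {0..<1} x * \<bar>h x\<bar>} \<le>
         ennreal ((1 / (e / 3)) * (LINT x|lborel. indicator {0..<1} x * \<bar>h x\<bar>))"
        by (rule integral_Markov_inequality[OF hi]) (use e in auto)
      then show ?thesis by (simp add: M_def I_def set_lebesgue_integral_def)
    qed
    have I0: "I \<ge> 0" unfolding I_def set_lebesgue_integral_def by (intro integral_nonneg_AE) auto
    have Mf: "M \<in> lmeasurable" "measure lebesgue M \<le> 3 / e * I"
    proof -
      have "emeasure lebesgue M \<le> ennreal (3 / e * I)" using Me Mm by simp
      moreover from this have "emeasure lebesgue M < \<infinity>" by (metis ennreal_less_top infinity_ennreal_def le_less_trans)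
      ultimately show "M \<in> lmeasurable" "measure lebesgue M \<le> 3 / e * I"
        using Mm I0 e by (auto intro!: fmeasurableI simp: measure_def enn2real_leI)
    qed
    obtain N where N: "N \<in> null_sets lborel"
      "{a. \<not> (a \<in> {0<..<1} \<longrightarrow> ((\<lambda>r. poisson_line r (s i) a) \<longlongrightarrow> s i a) (at_left 1))} \<subseteq> N"
      using s[of i] unfolding poisson_good_def eventually_ae_filter by auto
    have Nf: "N \<in> lmeasurable" "measure lebesgue N = 0"
      using null_sets_completionI[OF N(1)] by (auto simp: fmeasurable_def null_sets_def measure_def)
    have sub: "S e \<subseteq> N \<union> (T \<union> M)"
    proof
      fix a assume "a \<in> S e"
      then have a: "a \<in> {0<..<1}" "\<not> (\<forall>\<^sub>F r in at_left 1. \<bar>poisson_line r u a - u a\<bar> \<le> e)" by (auto simp: S_def)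
      show "a \<in> N \<union> (T \<union> M)"
      proof (rule ccontr)
        assume "a \<notin> N \<union> (T \<union> M)"
        then have n: "a \<notin> N" "a \<notin> T" "a \<notin> M" by auto
        have l: "((\<lambda>r. poisson_line r (s i) a) \<longlongrightarrow> s i a) (at_left 1)" using N(2) n(1) a(1) by blast
        have m: "\<bar>h a\<bar> < e / 3" using n(3) a(1) by (auto simp: M_def)
        have close: "\<forall>\<^sub>F r in at_left 1. dist (poisson_line r (s i) a) (s i a) < e / 3"
          using e by (intro tendstoD[OF l]) auto
        have "\<forall>\<^sub>F r in at_left 1. \<bar>poisson_line r u a - u a\<bar> \<le> e"
          using close eventually_at_left_1
        proof eventually_elim
          case (elim r)
          have "poisson_line r h a = poisson_line r u a - poisson_line r (s i) a"
            unfolding h_def using elim sm u by (intro poisson_line_add(2)) auto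
          moreover have "\<bar>poisson_line r h a\<bar> \<le> e / 3" using T(3)[OF a(1) n(2), of r] elim by (simp add: \<gamma>_def)
          moreover have "\<bar>poisson_line r (s i) a - s i a\<bar> < e / 3" using elim by (simp add: dist_real_def)
          ultimately show ?case using m unfolding h_def by linarith
        qed
        then show False using a(2) by simp
      qed
    qed
    show "\<exists>T. S e \<subseteq> T \<and> T \<in> lmeasurable \<and> measure lebesgue T \<le> \<epsilon>"
    proof (intro exI conjI)
      show "S e \<subseteq> N \<union> (T \<union> M)" by (rule sub)
      show "N \<union> (T \<union> M) \<in> lmeasurable" using Nf T Mf by auto
      have "measure lebesgue (N \<union> (T \<union> M)) \<le> measure lebesgue N + (measure lebesgue T + measure lebesgue M)"
      proof -
        have "measure lebesgue (N \<union> (T \<union> M)) \<le> measure lebesgue N + measure lebesgue (T \<union> M)"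
          by (intro measure_Un_le sets.Un fmeasurableD Nf T(1) Mf(1))
        moreover have "measure lebesgue (T \<union> M) \<le> measure lebesgue T + measure lebesgue M"
          by (intro measure_Un_le fmeasurableD T(1) Mf(1))
        ultimately show ?thesis by linarith
      qed
      also have "\<dots> \<le> 0 + (15 / \<gamma> * I + 3 / e * I)" using Nf T Mf by (intro add_mono) auto
      also have "\<dots> = C * I" by (simp add: C_def ring_distribs)
      finally show "measure lebesgue (N \<union> (T \<union> M)) \<le> \<epsilon>" using CI by simp
    qed
  qed
  have "negligible (\<Union>n. S (1 / Suc n))" by (intro negligible_Union_nat neg) auto
  then have "(\<Union>n. S (1 / Suc n)) \<in> null_sets (completion lborel)" by (simp add: negligible_iff_null_sets)
  then have "AE a in completion lborel. a \<notin> (\<Union>n. S (1 / Suc n))" by (rule AE_not_in)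
  then have "AE a in lborel. a \<notin> (\<Union>n. S (1 / Suc n))" by (simp only: AE_completion_iff)
  then have "AE a in lborel. a \<in> {0<..<1} \<longrightarrow> ((\<lambda>r. poisson_line r u a) \<longlongrightarrow> u a) (at_left 1)"
  proof eventually_elim
    case (elim a)
    show ?case
    proof
      assume a: "a \<in> {0<..<1::real}"
      show "((\<lambda>r. poisson_line r u a) \<longlongrightarrow> u a) (at_left 1)"
      proof (rule tendstoI)
        fix e :: real assume "e > 0"
        then obtain n where n: "inverse (real (Suc n)) < e" using reals_Archimedean by blast
        have "a \<notin> S (1 / Suc n)" using elim by blast
        then have "\<forall>\<^sub>F r in at_left 1. \<bar>poisson_line r u a - u a\<bar> \<le> 1 / Suc n" using a by (auto simp: S_def)
        then show "\<forall>\<^sub>F r in at_left 1. dist (poisson_line r u a) (u a) < e"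
          by eventually_elim (use n in \<open>simp add: dist_real_def inverse_eq_divide\<close>)
      qed
    qed
  qed
  then show ?thesis using u by (simp add: poisson_good_def)
qed

lemma poisson_good_add:
  assumes "poisson_good u" "poisson_good v"
  shows "poisson_good (\<lambda>x. u x + v x)"
proof -
  have m: "u \<in> borel_measurable borel" "v \<in> borel_measurable borel" "set_integrable lborel {0..<1} u" "set_integrable lborel {0..<1} v"
    and ae: "AE a in lborel. a \<in> {0<..<1} \<longrightarrow> ((\<lambda>r. poisson_line r u a) \<longlongrightarrow> u a) (at_left 1)"
     "AE a in lborel. a \<in> {0<..<1} \<longrightarrow> ((\<lambda>r. poisson_line r v a) \<longlongrightarrow> v a) (at_left 1)"
    using assms by (auto simp: poisson_good_def)
  have "AE a in lborel. a \<in> {0<..<1} \<longrightarrow> ((\<lambda>r. poisson_line r (\<lambda>x. u x + v x) a) \<longlongrightarrow> u a + v a) (at_left 1)"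
    using ae
  proof eventually_elim
    case (elim a)
    show ?case
    proof
      assume a: "a \<in> {0<..<1::real}"
      have ev: "\<forall>\<^sub>F r in at_left 1. poisson_line r u a + poisson_line r v a = poisson_line r (\<lambda>x. u x + v x) a"
        using eventually_at_left_1 by eventually_elim (use m in \<open>simp add: poisson_line_add\<close>)
      have "((\<lambda>r. poisson_line r u a + poisson_line r v a) \<longlongrightarrow> u a + v a) (at_left 1)"
        using elim a by (intro tendsto_add) auto
      then show "((\<lambda>r. poisson_line r (\<lambda>x. u x + v x) a) \<longlongrightarrow> u a + v a) (at_left 1)"
        by (rule Lim_transform_eventually) (rule ev)
    qed
  qed
  then show ?thesis using m by (simp add: poisson_good_def set_integral_add)
qed

lemma poisson_good_cmult:
  assumes "poisson_good u" shows "poisson_good (\<lambda>x. u x * c)"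
  using assms unfolding poisson_good_def poisson_line_cmult
  by (auto intro!: tendsto_mult_right elim!: eventually_mono)

lemma poisson_good_const: "poisson_good (\<lambda>_. c)"
proof -
  have "((\<lambda>r. poisson_line r (\<lambda>_. c) a) \<longlongrightarrow> c) (at_left 1)" for a
  proof (rule Lim_transform_eventually[OF tendsto_const])
    show "\<forall>\<^sub>F r in at_left 1. c = poisson_line r (\<lambda>_. c) a"
      using eventually_at_left_1 by eventually_elim (simp add: poisson_line_one)
  qed
  moreover have "set_integrable lborel {0..<1} (\<lambda>_::real. c)"
    using set_integrable_01_bounded[of "\<lambda>_. 1"] set_integrable_mult_left[of c lborel "{0..<1}" "\<lambda>_. 1"] by simp
  ultimately show ?thesis by (simp add: poisson_good_def)
qed

lemma poisson_good_indicator_atMost: "poisson_good (indicator {..c})"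
proof -
  have "((\<lambda>r. poisson_line r (indicator {..c}) a) \<longlongrightarrow> indicator {..c} a) (at_left 1)" if "a \<in> {0<..<1}" "a \<noteq> c" for a
  proof (rule poisson_line_locally_constant)
    show "\<bar>a - c\<bar> > 0" using that by simp
    fix x assume "\<bar>a - x\<bar> < \<bar>a - c\<bar>"
    then show "indicator {..c} x = (indicator {..c} a :: real)" by (auto simp: indicator_def)
  qed (use that in \<open>auto simp: indicator_def\<close>)
  moreover have "AE a in lborel. a \<noteq> c" by (rule AE_lborel_singleton)
  ultimately have "AE a in lborel. a \<in> {0<..<1} \<longrightarrow> ((\<lambda>r. poisson_line r (indicator {..c}) a) \<longlongrightarrow> indicator {..c} a) (at_left 1)"
    by (auto elim!: eventually_mono)
  then show ?thesis by (auto simp: poisson_good_def indicator_def intro!: set_integrable_01_bounded)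
qed

text \<open>Half-lines are stable under intersection and generate the Borel sets. Complements follow
  by linearity, disjoint unions from the L1 limit lemma applied to finite partial unions.\<close>

lemma poisson_good_indicator:
  assumes "A \<in> sets (borel :: real measure)" shows "poisson_good (indicator A)"
proof -
  have A: "A \<in> sigma_sets UNIV (range (\<lambda>a::real. {..a}))"
    using assms by (subst (asm) borel_eq_atMost) simp
  have st: "Int_stable (range (\<lambda>a::real. {..a}))" by (auto simp: Int_stable_def)
  have sub: "range (\<lambda>a::real. {..a}) \<subseteq> Pow UNIV" by simp
  show ?thesis using st sub A
  proof (induction rule: sigma_sets_induct_disjoint[where \<Omega> = UNIV])
    case (basic A) then show ?case using poisson_good_indicator_atMost by auto
  next
    case empty then show ?case using poisson_good_const[of 0] by (simp add: indicator_def)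
  next
    case (compl A)
    have "poisson_good (\<lambda>x. 1 + indicator A x * (-1))"
      using compl by (intro poisson_good_add poisson_good_cmult poisson_good_const) auto
    moreover have "(\<lambda>x. 1 + indicator A x * (-1)) = (indicator (UNIV - A) :: real \<Rightarrow> real)"
      by (auto simp: indicator_def fun_eq_iff)
    ultimately show ?case by simp
  next
    case (union A)
    have sb: "sigma_sets UNIV (range (\<lambda>a::real. {..a})) = sets borel"
      by (subst borel_eq_atMost) simp
    have Am [measurable]: "A i \<in> sets borel" for i using union(2) sb by auto
    define B where "B = (\<lambda>n. \<Union>i<n. A i)"
    have good: "poisson_good (indicator (B n))" for n
    proof (induction n)
      case 0 then show ?case using poisson_good_const[of 0] by (simp add: indicator_def B_def)
    next
      case (Suc n)
      have "A n \<inter> A i = {}" if "i < n" for i using that union(1) by (auto simp: disjoint_family_on_def)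
      then have "A n \<inter> B n = {}" by (auto simp: B_def)
      then have "(indicator (B (Suc n)) :: real \<Rightarrow> real) = (\<lambda>x. indicator (B n) x + indicator (A n) x)"
        by (auto simp: B_def indicator_def fun_eq_iff lessThan_Suc)
      then show ?case using poisson_good_add[OF Suc union(3)[of n]] by simp
    qed
    have Bm [measurable]: "B n \<in> sets borel" for n unfolding B_def by auto
    show ?case
    proof (rule poisson_good_limit[OF good])
      show "indicator (\<Union> (range A)) \<in> borel_measurable borel" by (intro borel_measurable_indicator) auto
      then show "set_integrable lborel {0..<1} (indicator (\<Union> (range A)) :: real \<Rightarrow> real)"
        by (rule set_integrable_01_bounded) (auto simp: indicator_def)
      have "(\<lambda>n. LINT x|lborel. indicator {0..<1} x *\<^sub>R \<bar>indicator (\<Union> (range A)) x - indicator (B n) x\<bar>) \<longlonglongrightarrow> (LINT x|(lborel :: real measure). (0::real))"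
      proof (rule integral_dominated_convergence[where w="indicator {0..<1}"])
        show "AE x in lborel. (\<lambda>n. indicator {0..<1} x *\<^sub>R \<bar>indicator (\<Union> (range A)) x - indicator (B n) x\<bar>) \<longlonglongrightarrow> (0::real)"
        proof (rule AE_I2)
          fix x :: real
          have "\<forall>\<^sub>F n in sequentially. indicator {0..<1} x *\<^sub>R \<bar>indicator (\<Union> (range A)) x - indicator (B n) x\<bar> = (0::real)"
          proof (cases "x \<in> \<Union> (range A)")
            case True
            then obtain i where i: "x \<in> A i" by auto
            show ?thesis
              using eventually_gt_at_top[of i]
              by eventually_elim (use i True in \<open>auto simp: B_def indicator_def\<close>)
          next
            case False then show ?thesis by (auto simp: B_def indicator_def)
          qed
          then show "(\<lambda>n. indicator {0..<1} x *\<^sub>R \<bar>indicator (\<Union> (range A)) x - indicator (B n) x\<bar>) \<longlonglongrightarrow> (0::real)"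
            by (rule tendsto_eventually)
        qed
        show "integrable lborel (indicator {0..<1::real} :: real \<Rightarrow> real)" by (rule integrable_real_indicator) auto
        show "AE x in lborel. norm (indicator {0..<1} x *\<^sub>R \<bar>indicator (\<Union> (range A)) x - indicator (B n) x :: real\<bar>) \<le> (indicator {0..<1} x :: real)" for n
          by (intro AE_I2) (auto simp: indicator_def)
      qed (auto intro!: borel_measurable_indicator borel_measurable_scaleR borel_measurable_abs borel_measurable_diff)
      then show "(\<lambda>n. LINT x:{0..<1}|lborel. \<bar>indicator (\<Union> (range A)) x - indicator (B n) x\<bar>) \<longlonglongrightarrow> (0::real)"
        by (simp add: set_lebesgue_integral_def)
    qed
  qed
qed

lemma poisson_good_integrable:
  assumes "integrable lborel u" shows "poisson_good u"
  using assms
proof (induction rule: integrable_induct)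
  case (base A c)
  then show ?case using poisson_good_cmult[OF poisson_good_indicator[of A], of c] by simp
next
  case (add f g)
  then show ?case by (intro poisson_good_add)
next
  case (lim f s)
  have [measurable]: "f \<in> borel_measurable borel" "\<And>i. s i \<in> borel_measurable borel" using lim by auto
  have si: "set_integrable lborel {0..<1} g" if "integrable lborel g" for g :: "real \<Rightarrow> real"
    unfolding set_integrable_def using that by (intro integrable_mult_indicator) auto
  show ?case
  proof (rule poisson_good_limit[of s f])
    have "(\<lambda>i. LINT x|lborel. indicator {0..<1} x *\<^sub>R \<bar>f x - s i x\<bar>) \<longlonglongrightarrow> (LINT x|(lborel :: real measure). (0::real))"
    \<comment> \<open>The approximants satisfy |s i| \<le> 2 |f|, so the differences are at most 3
      |f|.\<close>
    proof (rule integral_dominated_convergence[where w="\<lambda>x. 3 * norm (f x)"])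
      show "AE x in lborel. (\<lambda>i. indicator {0..<1} x *\<^sub>R \<bar>f x - s i x\<bar>) \<longlonglongrightarrow> 0"
      proof (rule AE_I2)
        fix x :: real
        have "(\<lambda>i. indicator {0..<1} x *\<^sub>R \<bar>f x - s i x\<bar>) \<longlonglongrightarrow> indicator {0..<1} x *\<^sub>R \<bar>f x - f x\<bar>"
          using lim.hyps(2)[of x] by (intro tendsto_intros) auto
        then show "(\<lambda>i. indicator {0..<1} x *\<^sub>R \<bar>f x - s i x\<bar>) \<longlonglongrightarrow> 0" by simp
      qed
      show "AE x in lborel. norm (indicator {0..<1} x *\<^sub>R \<bar>f x - s i x\<bar>) \<le> 3 * norm (f x)" for i
      proof (rule AE_I2)
        fix x :: real
        have "\<bar>s i x\<bar> \<le> 2 * \<bar>f x\<bar>" using lim.hyps(3)[of x i] by simp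
        then show "norm (indicator {0..<1} x *\<^sub>R \<bar>f x - s i x\<bar>) \<le> 3 * norm (f x)" by (auto simp: indicator_def)
      qed
      show "integrable lborel (\<lambda>x. 3 * norm (f x))" using lim.hyps(4) by auto
    qed auto
    then show "(\<lambda>i. LINT x:{0..<1}|lborel. \<bar>f x - s i x\<bar>) \<longlonglongrightarrow> 0" by (simp add: set_lebesgue_integral_def)
  qed (use lim si in auto)
qed

section \<open>From the interval back to the circle\<close>

lemma poisson_circ_real:
  fixes v :: "complex \<Rightarrow> real"
  assumes v: "v \<in> borel_measurable borel" "integrable circ v"
  shows "AE t in circ. ((\<lambda>r. LINT s|circ. (2 * Re (1 / (1 - of_real r * t * cnj s)) - 1) * v s) \<longlongrightarrow> v t) (at_left 1)"
proof (rule AE_circI)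
  define u where "u = (\<lambda>x::real. indicator {0..<1} x * v (cis (2 * pi * x)))"
  have "integrable lborel u" using integrable_circ_iff[OF v(1)] v(2) by (simp add: u_def set_integrable_def)
  then have "poisson_good u" by (rule poisson_good_integrable)
  then have ae: "AE a in lborel. a \<in> {0<..<1} \<longrightarrow> ((\<lambda>r. poisson_line r u a) \<longlongrightarrow> u a) (at_left 1)"
    by (simp add: poisson_good_def)
  have eq: "(LINT s|circ. (2 * Re (1 / (1 - of_real r * cis (2 * pi * a) * cnj s)) - 1) * v s) = poisson_line r u a"
    if r: "1/2 \<le> r" "r < 1" for r a
  proof -
    define z where "z = of_real r * cis (2 * pi * a)"
    have z: "norm z < 1" "norm z = r" using r by (simp_all add: z_def norm_mult)
    have [measurable]: "(\<lambda>s. 1 - z * cnj s) \<in> borel_measurable borel" "v \<in> borel_measurable borel"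
      by (intro borel_measurable_continuous_onI continuous_intros) (rule v(1))
    have m: "(\<lambda>s. (2 * Re (1 / (1 - z * cnj s)) - 1) * v s) \<in> borel_measurable borel"
      by measurable
    have k: "2 * Re (1 / (1 - z * cnj (cis (2 * pi * x)))) - 1 = poisson_kernel r (a - x)" for x
    proof -
      have zc: "z * cnj (cis (2 * pi * x)) = of_real r * cis (2 * pi * (a - x))"
        by (simp add: z_def cis_cnj cis_mult ring_distribs)
      have "2 * Re (1 / (1 - z * cnj (cis (2 * pi * x)))) - 1 = (1 - (norm z)\<^sup>2) / (norm (1 - z * cnj (cis (2 * pi * x))))\<^sup>2"
        using z by (intro poisson_kernel_eq_Re) auto
      then show ?thesis using z(2) unfolding zc by (simp add: poisson_kernel_def)
    qed
    have "(LINT s|circ. (2 * Re (1 / (1 - z * cnj s)) - 1) * v s)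
       = (LINT x:{0..<1}|lborel. (2 * Re (1 / (1 - z * cnj (cis (2 * pi * x)))) - 1) * v (cis (2 * pi * x)))"
      using integral_circ_eq[OF m] by simp
    also have "\<dots> = poisson_line r u a"
      unfolding poisson_line_def k by (intro set_lebesgue_integral_cong) (auto simp: u_def)
    finally show ?thesis by (simp add: z_def)
  qed
  show "AE a in lborel. a \<in> {0<..<1} \<longrightarrow>
     ((\<lambda>r. LINT s|circ. (2 * Re (1 / (1 - of_real r * cis (2 * pi * a) * cnj s)) - 1) * v s) \<longlongrightarrow> v (cis (2 * pi * a))) (at_left 1)"
    using ae
  proof eventually_elim
    case (elim a)
    show ?case
    proof
      assume a: "a \<in> {0<..<1::real}"
      with elim have "((\<lambda>r. poisson_line r u a) \<longlongrightarrow> v (cis (2 * pi * a))) (at_left 1)" by (simp add: u_def)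
      then show "((\<lambda>r. LINT s|circ. (2 * Re (1 / (1 - of_real r * cis (2 * pi * a) * cnj s)) - 1) * v s) \<longlongrightarrow> v (cis (2 * pi * a))) (at_left 1)"
        by (rule Lim_transform_eventually) (use eventually_at_left_1 in eventually_elim, simp add: eq)
    qed
  qed
qed

text \<open>For the kernel value k = 1/(1 - z cnj s) one has 2 Re k - 1 = k + cnj k - 1. So a
  Poisson integral is a Cauchy integral plus the conjugate of another one minus the mean, the form
  in which it is met in the entries of \<open>Sigma11\<close>.\<close>

lemma
  assumes u: "integrable circ u" and z: "norm z < 1"
  shows integrable_poisson_circ: "integrable circ (\<lambda>s. of_real (2 * Re (1 / (1 - z * cnj s)) - 1) * u s)"
    and poisson_integral_eq_cauchy: "(LINT s|circ. of_real (2 * Re (1 / (1 - z * cnj s)) - 1) * u s) =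
      (LINT s|circ. u s / (1 - z * cnj s)) + cnj (LINT s|circ. cnj (u s) / (1 - z * cnj s)) - (LINT s|circ. u s)"
proof -
  have i1: "integrable circ (\<lambda>s. u s / (1 - z * cnj s))" using circ_cauchy_kernel_sums(2)[OF u z] .
  have "integrable circ (\<lambda>s. cnj (u s))" using u by simp
  from integrable_cnj[OF circ_cauchy_kernel_sums(2)[OF this z]]
  have i2: "integrable circ (\<lambda>s. cnj (cnj (u s) / (1 - z * cnj s)))" .
  have kk: "of_real (2 * Re (1 / (1 - z * cnj s)) - 1) * u s = u s / (1 - z * cnj s) + cnj (cnj (u s) / (1 - z * cnj s)) - u s" for s
  proof -
    have "complex_of_real (2 * Re (1 / (1 - z * cnj s))) = 1 / (1 - z * cnj s) + cnj (1 / (1 - z * cnj s))"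
      by (rule complex_add_cnj[symmetric])
    then show ?thesis by (simp add: ring_distribs)
  qed
  show "integrable circ (\<lambda>s. of_real (2 * Re (1 / (1 - z * cnj s)) - 1) * u s)"
    unfolding kk using i1 i2 u by (intro Bochner_Integration.integrable_add Bochner_Integration.integrable_diff)
  show "(LINT s|circ. of_real (2 * Re (1 / (1 - z * cnj s)) - 1) * u s) =
      (LINT s|circ. u s / (1 - z * cnj s)) + cnj (LINT s|circ. cnj (u s) / (1 - z * cnj s)) - (LINT s|circ. u s)"
    unfolding kk Bochner_Integration.integral_cnj[symmetric] using i1 i2 u
    by (simp only: Bochner_Integration.integral_add Bochner_Integration.integral_diff Bochner_Integration.integrable_add)
qed

theorem poisson_integral_radial_limit:
  fixes u :: "complex \<Rightarrow> complex"
  assumes u: "integrable circ u"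
  shows "AE t in circ. ((\<lambda>r. LINT s|circ. of_real (2 * Re (1 / (1 - of_real r * t * cnj s)) - 1) * u s) \<longlongrightarrow> u t) (at_left 1)"
proof -
  obtain v where v: "v \<in> borel_measurable borel" "AE t in circ. u t = v t"
    by (rule circ_borel_version[OF borel_measurable_integrable[OF u]])
  have vi: "integrable circ v" using u v(2) by (rule integrable_circ_AE_cong)
  have re: "AE t in circ. ((\<lambda>r. LINT s|circ. (2 * Re (1 / (1 - of_real r * t * cnj s)) - 1) * Re (v s)) \<longlongrightarrow> Re (v t)) (at_left 1)"
    by (rule poisson_circ_real) (use v(1) vi in auto)
  have im: "AE t in circ. ((\<lambda>r. LINT s|circ. (2 * Re (1 / (1 - of_real r * t * cnj s)) - 1) * Im (v s)) \<longlongrightarrow> Im (v t)) (at_left 1)"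
    by (rule poisson_circ_real) (use v(1) vi in auto)
  show ?thesis using re im v(2) AE_space[of circ]
  proof eventually_elim
    case (elim t)
    then have t: "norm t = 1" by (simp add: space_circ)
    let ?k = "\<lambda>r s. 2 * Re (1 / (1 - of_real r * t * cnj s)) - 1"
    have eq: "Complex (LINT s|circ. ?k r s * Re (v s)) (LINT s|circ. ?k r s * Im (v s)) = (LINT s|circ. of_real (?k r s) * u s)"
      if r: "1/2 \<le> r" "r < 1" for r
    proof -
      have "norm (of_real r * t) < 1" using r t by (simp add: norm_mult)
      note i = integrable_poisson_circ[OF vi this]
      have "(LINT s|circ. of_real (?k r s) * u s) = (LINT s|circ. of_real (?k r s) * v s)"
        by (rule integral_circ_AE_cong) (use v(2) in eventually_elim, simp)
      moreover have "Re (LINT s|circ. of_real (?k r s) * v s) = (LINT s|circ. ?k r s * Re (v s))"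
        by (subst integral_Re[OF i, symmetric]) simp
      moreover have "Im (LINT s|circ. of_real (?k r s) * v s) = (LINT s|circ. ?k r s * Im (v s))"
        by (subst integral_Im[OF i, symmetric]) simp
      ultimately show ?thesis by (simp add: complex_eq_iff)
    qed
    have "((\<lambda>r. Complex (LINT s|circ. ?k r s * Re (v s)) (LINT s|circ. ?k r s * Im (v s))) \<longlongrightarrow> Complex (Re (v t)) (Im (v t))) (at_left 1)"
      using elim by (intro tendsto_Complex) auto
    then have "((\<lambda>r. Complex (LINT s|circ. ?k r s * Re (v s)) (LINT s|circ. ?k r s * Im (v s))) \<longlongrightarrow> u t) (at_left 1)"
      using elim by simp
    then show ?case
      by (rule Lim_transform_eventually) (use eventually_at_left_1 in eventually_elim, simp only: eq)
  qed
qed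

section \<open>Radial limits\<close>

lemma AE_circ_norm: "AE t in circ. norm t = 1"
  using AE_space[of circ] by eventually_elim (simp add: space_circ)

lemma norm_1_mult_cnj: "norm t = 1 \<Longrightarrow> t * cnj t = 1"
  by (simp add: complex_norm_square[symmetric])

lemma continuous_on_sphere_integrable_circ:
  assumes "continuous_on (sphere 0 1) f" shows "integrable circ (f :: complex \<Rightarrow> complex)"
proof -
  have "(\<lambda>t. if t \<in> sphere 0 1 then f t else 0) \<in> borel_measurable borel"
    using assms by (intro borel_measurable_continuous_on_if) auto
  from measurable_circ_borel[OF this] have m: "f \<in> borel_measurable circ"
    by (rule AE_circ_cong_measurable) (use AE_circ_norm in eventually_elim, simp)
  obtain B where "\<And>t. t \<in> sphere 0 1 \<Longrightarrow> norm (f t) \<le> B"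
    using compact_continuous_image[OF assms compact_sphere] compact_imp_bounded
    by (metis bounded_iff imageI)
  then have "AE t in circ. norm (f t) \<le> B"
    using AE_circ_norm by (auto elim!: eventually_mono)
  then show ?thesis using m by (rule circ.integrable_const_bound)
qed

section \<open>Power series on circles and Parseval's identity\<close>

lemma integral_circ_series_mult:
  assumes c: "summable (\<lambda>k. norm (c k))" and u: "integrable circ u"
  shows "(\<lambda>k. c k * (LINT t|circ. t ^ k * u t)) sums (LINT t|circ. (\<Sum>k. c k * t ^ k) * u t)"
proof -
  define f where "f = (\<lambda>k t. c k * t ^ k * u t)"
  have m [measurable]: "u \<in> borel_measurable circ" using u by auto
  have [measurable]: "(\<lambda>t. t ^ k) \<in> borel_measurable circ" for k :: nat
    by (intro measurable_circ_borel) simp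
  have fi: "integrable circ (f k)" for k
  proof (rule Bochner_Integration.integrable_bound[of _ "\<lambda>t. c k * u t"])
    show "f k \<in> borel_measurable circ" unfolding f_def by measurable
    show "AE t in circ. norm (f k t) \<le> norm (c k * u t)"
      using AE_circ_norm by eventually_elim (simp add: f_def norm_mult norm_power)
  qed (use u in auto)
  have s1: "AE t in circ. summable (\<lambda>k. norm (f k t))"
    using AE_circ_norm by eventually_elim (simp add: f_def norm_mult norm_power summable_mult2[OF c])
  have "(LINT t|circ. norm (f k t)) = norm (c k) * (LINT t|circ. norm (u t))" for k
  proof -
    have "(LINT t|circ. norm (f k t)) = (LINT t|circ. norm (c k) * norm (u t))"
      by (rule integral_circ_AE_cong) (use AE_circ_norm in eventually_elim, simp add: f_def norm_mult norm_power)
    then show ?thesis by simp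
  qed
  then have s2: "summable (\<lambda>k. LINT t|circ. norm (f k t))" using summable_mult2[OF c] by simp
  have "AE t in circ. (\<Sum>k. f k t) = (\<Sum>k. c k * t ^ k) * u t"
    using AE_circ_norm
  proof eventually_elim
    case (elim t)
    have "summable (\<lambda>k. norm (c k * t ^ k))" using c elim by (simp add: norm_mult norm_power)
    then show ?case unfolding f_def by (rule suminf_mult2[symmetric, OF summable_norm_cancel])
  qed
  from integral_circ_AE_cong[OF this] sums_integral[OF fi s1 s2]
  show ?thesis by (simp add: f_def mult.assoc)
qed

lemma integral_circ_power_cnj_power: "(LINT t|circ. t ^ k * cnj t ^ l) = (if k = l then 1 else 0)"
proof -
  have "(LINT t|circ. t ^ k * cnj t ^ l) = (LINT t|circ. t powi (int k - int l))"
  proof (rule integral_circ_AE_cong)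
    show "AE t in circ. t ^ k * cnj t ^ l = t powi (int k - int l)"
      using AE_circ_norm
    proof eventually_elim
      case (elim t)
      then have "t * cnj t = 1" "t \<noteq> 0" by (auto simp: norm_1_mult_cnj)
      then have "cnj t = inverse t" by (metis inverse_unique)
      then show ?case using \<open>t \<noteq> 0\<close> by (simp add: power_int_diff divide_inverse power_inverse)
    qed
  qed
  then show ?thesis by (simp add: integral_circ_powi)
qed

text \<open>The integral claims come from integrating the power series on the circle of radius r
  against a test function: \<open>cnj t ^ l\<close> isolates a coefficient, with l = 0 for the mean
  value, and the conjugate of f gives Parseval's identity.\<close>

lemma holomorphic_circle_coefficients:
  assumes f: "f holomorphic_on ball 0 1"
  obtains a where "\<And>w. norm w < 1 \<Longrightarrow> (\<lambda>k. a k * w ^ k) sums f w"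
    and "\<And>r. 0 \<le> r \<Longrightarrow> r < 1 \<Longrightarrow> summable (\<lambda>k. norm (a k * of_real r ^ k))"
    and "\<And>r. 0 \<le> r \<Longrightarrow> r < 1 \<Longrightarrow> (LINT t|circ. f (of_real r * t)) = f 0"
    and "\<And>r. 0 \<le> r \<Longrightarrow> r < 1 \<Longrightarrow> (\<lambda>k. (norm (a k))\<^sup>2 * r ^ (2 * k)) sums (LINT t|circ. (norm (f (of_real r * t)))\<^sup>2)"
proof -
  define a where "a = (\<lambda>k. (deriv ^^ k) f 0 / fact k)"
  have s: "(\<lambda>k. a k * w ^ k) sums f w" if "norm w < 1" for w
    using holomorphic_power_series[OF f, of w] that by (simp add: a_def)
  have ab: "summable (\<lambda>k. norm (a k * of_real r ^ k))" if "0 \<le> r" "r < 1" for r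
  proof (rule powser_insidea)
    \<comment> \<open>The point (1 + r)/2 lies strictly between r and 1; convergence there gives
      absolute convergence at r.\<close>
    have n: "norm (complex_of_real ((1 + r) / 2)) < 1" using that by (simp only: norm_of_real) simp
    show "summable (\<lambda>k. a k * of_real ((1 + r) / 2) ^ k)" using s[OF n] by (simp only: sums_iff)
    show "norm (complex_of_real r) < norm (complex_of_real ((1 + r) / 2))" using that by (simp only: norm_of_real) simp
  qed
  have int: "integrable circ (\<lambda>t. f (of_real r * t))" if r: "0 \<le> r" "r < 1" for r
  proof (rule continuous_on_sphere_integrable_circ)
    show "continuous_on (sphere 0 1) (\<lambda>t. f (of_real r * t))"
      using r by (intro continuous_on_compose2[OF holomorphic_on_imp_continuous_on[OF f]] continuous_intros)
         (auto simp: norm_mult)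
  qed
  have series: "(\<Sum>k. (a k * of_real r ^ k) * t ^ k) = f (of_real r * t)" if "0 \<le> r" "r < 1" "norm t = 1" for r t
    using s[of "of_real r * t"] that by (simp add: sums_iff norm_mult power_mult_distrib mult.assoc)
  have co: "(\<lambda>k. (a k * of_real r ^ k) * (LINT t|circ. t ^ k * u t)) sums (LINT t|circ. f (of_real r * t) * u t)"
    if "0 \<le> r" "r < 1" "integrable circ u" for r u
  proof -
    have "(LINT t|circ. (\<Sum>k. (a k * of_real r ^ k) * t ^ k) * u t) = (LINT t|circ. f (of_real r * t) * u t)"
      by (rule integral_circ_AE_cong) (use AE_circ_norm in eventually_elim, simp add: series that)
    then show ?thesis using integral_circ_series_mult[OF ab[OF that(1,2)] that(3)] by simp
  qed
  have coeff: "(LINT t|circ. f (of_real r * t) * cnj t ^ l) = a l * of_real r ^ l" if "0 \<le> r" "r < 1" for r l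
  proof -
    have "integrable circ (\<lambda>t. cnj t ^ l)"
      by (intro continuous_on_sphere_integrable_circ continuous_intros)
    from co[OF that this]
    have "(\<lambda>k. (a k * of_real r ^ k) * (if k = l then 1 else 0)) sums (LINT t|circ. f (of_real r * t) * cnj t ^ l)"
      by (simp only: integral_circ_power_cnj_power)
    moreover have "(\<lambda>k. (a k * of_real r ^ k) * (if k = l then 1 else 0)) = (\<lambda>k. if k = l then a k * of_real r ^ k else 0)" by auto
    ultimately have "(\<lambda>k. if k = l then a k * of_real r ^ k else 0) sums (LINT t|circ. f (of_real r * t) * cnj t ^ l)"
      by (simp only:)
    from sums_unique2[OF this sums_single] show ?thesis .
  qed
  show ?thesis
  proof (rule that[of a])
    fix r :: real assume r: "0 \<le> r" "r < 1"
    show "(LINT t|circ. f (of_real r * t)) = f 0"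
      using coeff[OF r, of 0] s[of 0] by (simp add: sums_iff)
    have "(\<lambda>k. (a k * of_real r ^ k) * (LINT t|circ. t ^ k * cnj (f (of_real r * t)))) sums (LINT t|circ. f (of_real r * t) * cnj (f (of_real r * t)))"
      by (rule co[OF r]) (use int[OF r] in simp)
    moreover have "(LINT t|circ. t ^ k * cnj (f (of_real r * t))) = cnj (a k * of_real r ^ k)" for k
      unfolding coeff[OF r, symmetric] Bochner_Integration.integral_cnj[symmetric] by (simp add: mult.commute)
    moreover have "(a k * of_real r ^ k) * cnj (a k * of_real r ^ k) = of_real ((norm (a k))\<^sup>2 * r ^ (2 * k))" for k
    proof -
      have "(norm (a k * of_real r ^ k))\<^sup>2 = (norm (a k))\<^sup>2 * r ^ (2 * k)"
        using r by (simp add: norm_mult norm_power power_mult_distrib power_mult[symmetric] mult.commute)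
      then show ?thesis by (simp only: complex_norm_square[symmetric])
    qed
    moreover have "(LINT t|circ. f (of_real r * t) * cnj (f (of_real r * t))) = of_real (LINT t|circ. (norm (f (of_real r * t)))\<^sup>2)"
      by (simp only: complex_norm_square[symmetric] integral_complex_of_real)
    ultimately have "(\<lambda>k. complex_of_real ((norm (a k))\<^sup>2 * r ^ (2 * k))) sums of_real (LINT t|circ. (norm (f (of_real r * t)))\<^sup>2)"
      by (simp only:)
    then show "(\<lambda>k. (norm (a k))\<^sup>2 * r ^ (2 * k)) sums (LINT t|circ. (norm (f (of_real r * t)))\<^sup>2)"
      by (simp only: sums_of_real_iff)
  qed (use s ab in auto)
qed

text \<open>Parseval's identity bounds every partial sum at radius r by 1; in a finite sum r may
  tend to 1.\<close>

lemma bounded_holomorphic_square_summable: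
  assumes f: "f holomorphic_on ball 0 1" "\<And>w. norm w < 1 \<Longrightarrow> norm (f w) \<le> 1"
    and a: "\<And>r. 0 \<le> r \<Longrightarrow> r < 1 \<Longrightarrow> (\<lambda>k. (norm (a k))\<^sup>2 * r ^ (2 * k)) sums (LINT t|circ. (norm (f (of_real r * t)))\<^sup>2)"
  shows "summable (\<lambda>k. (norm (a k :: complex))\<^sup>2)"
proof (rule bounded_imp_summable)
  fix n
  have le: "(\<Sum>k\<le>n. (norm (a k))\<^sup>2 * r ^ (2 * k)) \<le> 1" if r: "0 \<le> r" "r < 1" for r
  proof -
    have "(\<Sum>k\<le>n. (norm (a k))\<^sup>2 * r ^ (2 * k)) \<le> (\<Sum>k. (norm (a k))\<^sup>2 * r ^ (2 * k))"
      using a[OF r] r by (intro sum_le_suminf) (auto simp: sums_iff)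
    also have "\<dots> = (LINT t|circ. (norm (f (of_real r * t)))\<^sup>2)" using a[OF r] by (simp add: sums_iff)
    also have "\<dots> \<le> (LINT t|circ. 1)"
    proof (rule integral_mono_AE')
      show "AE t in circ. (norm (f (of_real r * t)))\<^sup>2 \<le> 1"
        using AE_circ_norm by eventually_elim (use r f(2) in \<open>auto intro!: power_le_one simp: norm_mult\<close>)
    qed auto
    also have "\<dots> = 1" using emeasure_circ_space by (simp add: measure_def)
    finally show ?thesis .
  qed
  have "((\<lambda>r. \<Sum>k\<le>n. (norm (a k))\<^sup>2 * r ^ (2 * k)) \<longlongrightarrow> (\<Sum>k\<le>n. (norm (a k))\<^sup>2 * 1 ^ (2 * k))) (at_left 1)"
    by (intro tendsto_intros)
  moreover have "\<forall>\<^sub>F r in at_left 1. (\<Sum>k\<le>n. (norm (a k))\<^sup>2 * r ^ (2 * k)) \<le> 1"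
    using eventually_at_left_1 by eventually_elim (simp add: le)
  ultimately have "(\<Sum>k\<le>n. (norm (a k))\<^sup>2 * 1 ^ (2 * k)) \<le> 1"
    by (rule tendsto_upperbound) simp
  then show "(\<Sum>k\<le>n. (norm (a k))\<^sup>2) \<le> 1" by simp
qed simp

section \<open>Boundary functions of bounded holomorphic functions\<close>

lemma integral_circ_norm_sum_square:
  assumes "finite A"
  shows "(LINT t|circ. (norm (\<Sum>k\<in>A. a k * t ^ k))\<^sup>2) = (\<Sum>k\<in>A. (norm (a k :: complex))\<^sup>2)"
proof -
  have i: "integrable circ (\<lambda>t. a k * cnj (a l) * (t ^ k * cnj t ^ l))" for k l
    by (intro continuous_on_sphere_integrable_circ continuous_intros)
  have "complex_of_real (LINT t|circ. (norm (\<Sum>k\<in>A. a k * t ^ k))\<^sup>2)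
     = (LINT t|circ. (\<Sum>k\<in>A. \<Sum>l\<in>A. a k * cnj (a l) * (t ^ k * cnj t ^ l)))"
    unfolding integral_complex_of_real[symmetric] complex_norm_square
    by (simp add: sum_product algebra_simps)
  also have "\<dots> = (\<Sum>k\<in>A. \<Sum>l\<in>A. a k * cnj (a l) * (LINT t|circ. t ^ k * cnj t ^ l))"
    using i by (subst Bochner_Integration.integral_sum, simp)+ simp
  also have "\<dots> = (\<Sum>k\<in>A. complex_of_real ((norm (a k))\<^sup>2))"
    using assms unfolding integral_circ_power_cnj_power complex_norm_square
    by (intro sum.cong refl) (simp add: if_distrib cong: if_cong)
  also have "\<dots> = complex_of_real (\<Sum>k\<in>A. (norm (a k))\<^sup>2)" by simp
  finally show ?thesis by (simp only: of_real_eq_iff)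
qed

text \<open>
  For a character \<open>\<phi>\<close> the integrals against the partial sums are eventually constant, so the
  conclusion determines all Fourier coefficients of \<open>g\<close>.
\<close>

lemma square_summable_circle_function:
  assumes a: "summable (\<lambda>k. (norm (a k :: complex))\<^sup>2)"
  obtains g where "integrable circ g"
    and "\<And>\<phi> e. continuous_on (sphere 0 1) \<phi> \<Longrightarrow> (\<And>t. norm t = 1 \<Longrightarrow> norm (\<phi> t) \<le> 1) \<Longrightarrow>
      (\<forall>\<^sub>F n in sequentially. (LINT t|circ. \<phi> t * (\<Sum>k<n. a k * t ^ k)) = e) \<Longrightarrow> (LINT t|circ. \<phi> t * g t) = e"
proof -
  have "\<exists>N. \<forall>m\<ge>N. \<forall>n. norm (\<Sum>k\<in>{m..<n}. (norm (a k))\<^sup>2) < (1/4) ^ j" for j :: nat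
    using a unfolding summable_Cauchy by simp
  \<comment> \<open>Blocks of squared norm below 4^(-j) have L1 norm at most 2^(-j), so that the
    series of blocks converges absolutely almost everywhere. The limit is thereby obtained from
    integrable series instead of completeness of L2.\<close>
  then obtain M where M: "\<And>j m n. m \<ge> M j \<Longrightarrow> norm (\<Sum>k\<in>{m..<n}. (norm (a k))\<^sup>2) < (1/4) ^ j" by metis
  \<comment> \<open>Summing the thresholds makes \<open>N\<close> increasing and unbounded while
    \<open>N j\<close> stays above \<open>M j\<close>.\<close>
  define N where "N = (\<lambda>j. \<Sum>i\<le>j. M i + 1)"
  have NM: "N j \<ge> M j" for j unfolding N_def by (rule order_trans[OF _ member_le_sum[of j]]) auto
  have Nmono: "N j \<le> N (Suc j)" for j by (simp add: N_def)
  have Ninf: "j \<le> N j" for j by (induction j) (simp_all add: N_def)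
  define f where "f = (\<lambda>j t. \<Sum>k\<in>{N j..<N (Suc j)}. a k * t ^ k)"
  define S where "S = (\<lambda>n t. \<Sum>k<n. a k * t ^ k)"
  have fS: "(\<Sum>j<J. f j t) = S (N J) t - S (N 0) t" for J t
  proof (induction J)
    case (Suc J)
    have "S (N (Suc J)) t = S (N J) t + f J t"
      unfolding S_def f_def using Nmono[of J] by (simp add: lessThan_atLeast0 sum.atLeastLessThan_concat)
    then show ?case using Suc by simp
  qed simp
  have cf: "continuous_on A (f j)" "continuous_on A (S n)" for A j n
    unfolding f_def S_def by (intro continuous_intros)+
  have fi: "integrable circ (f j)" for j by (intro continuous_on_sphere_integrable_circ cf)
  have fn: "(LINT t|circ. norm (f j t)) \<le> (1/2) ^ j" for j
  proof -
    have i2: "integrable circ (\<lambda>t. (norm (f j t))\<^sup>2)"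
    proof -
      have "integrable circ (\<lambda>t. f j t * cnj (f j t))"
        by (intro continuous_on_sphere_integrable_circ continuous_intros cf)
      then have "integrable circ (\<lambda>t. complex_of_real ((norm (f j t))\<^sup>2))" by (simp only: complex_norm_square)
      then show ?thesis by (simp only: complex_of_real_integrable_eq)
    qed
    have "(LINT t|circ. (norm (f j t))\<^sup>2) = (\<Sum>k\<in>{N j..<N (Suc j)}. (norm (a k))\<^sup>2)"
      unfolding f_def by (rule integral_circ_norm_sum_square) simp
    also have "\<dots> \<le> (1/4) ^ j" using M[OF NM[of j], of "N (Suc j)"] by (simp add: abs_of_nonneg sum_nonneg)
    finally have le: "(LINT t|circ. (norm (f j t))\<^sup>2) \<le> (1/4) ^ j" .
    \<comment> \<open>In place of the Cauchy-Schwarz inequality: x \<le> 2^j x^2 / 2 + 2^(-j) / 2,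
      integrated over a space of total mass 1.\<close>
    have "(LINT t|circ. norm (f j t)) \<le> (LINT t|circ. 2 ^ j / 2 * (norm (f j t))\<^sup>2 + (1/2) ^ j / 2)"
    proof (rule integral_mono)
      fix t
      have "0 \<le> (2 ^ j * norm (f j t) - 1)\<^sup>2" by simp
      then have "2 * 2 ^ j * norm (f j t) \<le> 2 ^ j * 2 ^ j * (norm (f j t))\<^sup>2 + 1"
        by (simp add: power2_eq_square algebra_simps)
      then show "norm (f j t) \<le> 2 ^ j / 2 * (norm (f j t))\<^sup>2 + (1/2) ^ j / 2"
        by (simp add: field_simps)
    qed (use fi i2 in auto)
    also have "\<dots> = 2 ^ j / 2 * (LINT t|circ. (norm (f j t))\<^sup>2) + (1/2) ^ j / 2"
      using i2 emeasure_circ_space by (simp add: measure_def)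
    also have "\<dots> \<le> 2 ^ j / 2 * (1/4) ^ j + (1/2) ^ j / 2" using le by (intro add_right_mono mult_left_mono) auto
    also have "2 ^ j / 2 * (1/4 :: real) ^ j = (1/2) ^ j / 2" by (simp flip: power_mult_distrib)
    finally show ?thesis by simp
  qed
  have sn: "summable (\<lambda>j. LINT t|circ. norm (f j t))"
    by (rule summable_comparison_test'[of "\<lambda>j. (1/2) ^ j" 0])
       (use fn in \<open>auto intro!: summable_geometric simp: abs_of_nonneg\<close>)
  have sAE: "AE t in circ. summable (\<lambda>j. norm (f j t))"
  proof -
    have "(\<integral>\<^sup>+ t. (\<Sum>j. ennreal (norm (f j t))) \<partial>circ) = (\<Sum>j. \<integral>\<^sup>+ t. ennreal (norm (f j t)) \<partial>circ)"
      using fi by (intro nn_integral_suminf) auto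
    also have "\<dots> = (\<Sum>j. ennreal (LINT t|circ. norm (f j t)))"
      using fi by (simp add: nn_integral_eq_integral)
    also have "\<dots> = ennreal (\<Sum>j. LINT t|circ. norm (f j t))"
      using sn by (intro suminf_ennreal2) auto
    finally have "(\<integral>\<^sup>+ t. (\<Sum>j. ennreal (norm (f j t))) \<partial>circ) \<noteq> \<infinity>" by simp
    then have "AE t in circ. (\<Sum>j. ennreal (norm (f j t))) \<noteq> \<infinity>"
      using fi by (intro nn_integral_PInf_AE) auto
    then show ?thesis by eventually_elim (auto intro: summable_suminf_not_top)
  qed
  define g where "g = (\<lambda>t. (\<Sum>j. f j t) + S (N 0) t)"
  have gi: "integrable circ (\<lambda>t. \<Sum>j. f j t)" by (rule integrable_suminf[OF fi sAE sn])
  have Si: "integrable circ (S n)" for n by (intro continuous_on_sphere_integrable_circ cf)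
  show ?thesis
  proof (rule that[of g])
    show "integrable circ g" unfolding g_def using gi Si by (intro Bochner_Integration.integrable_add)
    fix \<phi> e assume c: "continuous_on (sphere 0 1) \<phi>" "\<And>t. norm t = 1 \<Longrightarrow> norm (\<phi> t) \<le> 1"
      and ev: "\<forall>\<^sub>F n in sequentially. (LINT t|circ. \<phi> t * (\<Sum>k<n. a k * t ^ k)) = e"
    have ci: "integrable circ \<phi>" by (rule continuous_on_sphere_integrable_circ[OF c(1)])
    have bd: "norm (\<phi> t * x) \<le> norm x" if "norm t = 1" for t x
      using c(2)[OF that] by (simp add: norm_mult mult_left_le_one_le)
    have i: "integrable circ (\<lambda>t. \<phi> t * h t)" if "integrable circ h" for h
    proof (rule Bochner_Integration.integrable_bound[OF that])
      show "AE t in circ. norm (\<phi> t * h t) \<le> norm (h t)" using AE_circ_norm by eventually_elim (rule bd)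
      show "(\<lambda>t. \<phi> t * h t) \<in> borel_measurable circ" using ci that by auto
    qed
    have "(\<lambda>j. LINT t|circ. \<phi> t * f j t) sums (LINT t|circ. (\<Sum>j. \<phi> t * f j t))"
    proof (rule sums_integral)
      show "integrable circ (\<lambda>t. \<phi> t * f j t)" for j by (rule i[OF fi])
      show "AE t in circ. summable (\<lambda>j. norm (\<phi> t * f j t))"
        using AE_circ_norm sAE
        by eventually_elim (rule summable_comparison_test', assumption, use bd in auto)
      show "summable (\<lambda>j. LINT t|circ. norm (\<phi> t * f j t))"
      proof (rule summable_comparison_test'[OF sn])
        fix j
        have "(LINT t|circ. norm (\<phi> t * f j t)) \<le> (LINT t|circ. norm (f j t))"
          by (rule integral_mono_AE[OF integrable_norm[OF i[OF fi]] integrable_norm[OF fi]])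
             (use AE_circ_norm in eventually_elim, rule bd)
        then show "norm (LINT t|circ. norm (\<phi> t * f j t)) \<le> (LINT t|circ. norm (f j t))" by simp
      qed
    qed
    moreover have "(LINT t|circ. (\<Sum>j. \<phi> t * f j t)) = (LINT t|circ. \<phi> t * (\<Sum>j. f j t))"
    proof (rule integral_circ_AE_cong)
      show "AE t in circ. (\<Sum>j. \<phi> t * f j t) = \<phi> t * (\<Sum>j. f j t)"
        using sAE by eventually_elim (rule suminf_mult[OF summable_norm_cancel])
    qed
    ultimately have "(\<lambda>J. \<Sum>j<J. LINT t|circ. \<phi> t * f j t) \<longlonglongrightarrow> (LINT t|circ. \<phi> t * (\<Sum>j. f j t))"
      by (simp add: sums_def)
    moreover have "(\<Sum>j<J. LINT t|circ. \<phi> t * f j t) = (LINT t|circ. \<phi> t * S (N J) t) - (LINT t|circ. \<phi> t * S (N 0) t)" for J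
    proof -
      have "(\<Sum>j<J. LINT t|circ. \<phi> t * f j t) = (LINT t|circ. \<phi> t * (\<Sum>j<J. f j t))"
        unfolding sum_distrib_left using i[OF fi] by (intro Bochner_Integration.integral_sum[symmetric]) auto
      then show ?thesis using i[OF Si] by (simp add: fS right_diff_distrib)
    qed
    ultimately have l1: "(\<lambda>J. (LINT t|circ. \<phi> t * S (N J) t) - (LINT t|circ. \<phi> t * S (N 0) t)) \<longlonglongrightarrow> (LINT t|circ. \<phi> t * (\<Sum>j. f j t))"
      by simp
    have "filterlim N at_top sequentially" by (rule filterlim_at_top_mono[OF filterlim_ident]) (simp add: Ninf)
    from eventually_compose_filterlim[OF ev this]
    have "\<forall>\<^sub>F J in sequentially. (LINT t|circ. \<phi> t * S (N J) t) - (LINT t|circ. \<phi> t * S (N 0) t) = e - (LINT t|circ. \<phi> t * S (N 0) t)"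
      by eventually_elim (simp add: S_def)
    from LIMSEQ_unique[OF l1 tendsto_eventually[OF this]]
    have "(LINT t|circ. \<phi> t * (\<Sum>j. f j t)) = e - (LINT t|circ. \<phi> t * S (N 0) t)" .
    moreover have "(LINT t|circ. \<phi> t * g t) = (LINT t|circ. \<phi> t * (\<Sum>j. f j t)) + (LINT t|circ. \<phi> t * S (N 0) t)"
      unfolding g_def distrib_left using i[OF gi] i[OF Si] by (rule Bochner_Integration.integral_add)
    ultimately show "(LINT t|circ. \<phi> t * g t) = e" by simp
  qed
qed

text \<open>f is the Poisson integral of the function g whose Fourier coefficients are the Taylor
  coefficients of f for nonnegative index and 0 for negative index. Convergence of Poisson integrals
  then gives the limit.\<close>

theorem bounded_holomorphic_radial_limit:
  assumes f: "f holomorphic_on ball 0 1" "\<And>w. norm w < 1 \<Longrightarrow> norm (f w) \<le> 1"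
  obtains g where "AE t in circ. ((\<lambda>r. f (of_real r * t)) \<longlongrightarrow> g t) (at_left 1)"
proof -
  obtain a where a: "\<And>w. norm w < 1 \<Longrightarrow> (\<lambda>k. a k * w ^ k) sums f w"
    "\<And>r. 0 \<le> r \<Longrightarrow> r < 1 \<Longrightarrow> (\<lambda>k. (norm (a k))\<^sup>2 * r ^ (2 * k)) sums (LINT t|circ. (norm (f (of_real r * t)))\<^sup>2)"
    by (rule holomorphic_circle_coefficients[OF f(1)]) (rule that; assumption)
  have "summable (\<lambda>k. (norm (a k))\<^sup>2)" by (rule bounded_holomorphic_square_summable[OF f a(2)])
  then obtain g where g: "integrable circ g"
    and gc: "\<And>\<phi> e. continuous_on (sphere 0 1) \<phi> \<Longrightarrow> (\<And>t. norm t = 1 \<Longrightarrow> norm (\<phi> t) \<le> 1) \<Longrightarrow>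
      (\<forall>\<^sub>F n in sequentially. (LINT t|circ. \<phi> t * (\<Sum>k<n. a k * t ^ k)) = e) \<Longrightarrow> (LINT t|circ. \<phi> t * g t) = e"
    by (rule square_summable_circle_function) (rule that, assumption, blast)
  have int: "integrable circ (\<lambda>t. c * (t ^ k * cnj t ^ l))" for c k l
    by (intro continuous_on_sphere_integrable_circ continuous_intros)
  have c1: "(LINT t|circ. cnj t ^ l * g t) = a l" for l
  proof (rule gc)
    have fin: "(LINT t|circ. cnj t ^ l * (\<Sum>k<n. a k * t ^ k)) = a l" if "n > l" for n
    proof -
      have "(LINT t|circ. cnj t ^ l * (\<Sum>k<n. a k * t ^ k)) = (LINT t|circ. (\<Sum>k<n. a k * (t ^ k * cnj t ^ l)))"
        by (simp add: sum_distrib_left mult_ac)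
      also have "\<dots> = (\<Sum>k<n. a k * (LINT t|circ. t ^ k * cnj t ^ l))"
        using int by (subst Bochner_Integration.integral_sum) auto
      also have "\<dots> = a l" using that unfolding integral_circ_power_cnj_power by (simp add: if_distrib cong: if_cong)
      finally show ?thesis .
    qed
    show "\<forall>\<^sub>F n in sequentially. (LINT t|circ. cnj t ^ l * (\<Sum>k<n. a k * t ^ k)) = a l"
      using eventually_gt_at_top[of l] by eventually_elim (rule fin)
  qed (auto intro!: continuous_intros simp: norm_power)
  have c2: "(LINT t|circ. t ^ l * g t) = (if l = 0 then a 0 else 0)" for l
  proof (cases "l = 0")
    case True then show ?thesis using c1[of 0] by simp
  next
    case False
    have "(LINT t|circ. t ^ l * g t) = 0"
    proof (rule gc)
      have "(LINT t|circ. t ^ l * (\<Sum>k<n. a k * t ^ k)) = 0" for n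
      proof -
        have "(LINT t|circ. t ^ l * (\<Sum>k<n. a k * t ^ k)) = (LINT t|circ. (\<Sum>k<n. a k * (t ^ (k + l) * cnj t ^ 0)))"
          by (simp add: sum_distrib_left power_add mult_ac)
        also have "\<dots> = (\<Sum>k<n. a k * (LINT t|circ. t ^ (k + l) * cnj t ^ 0))"
          using int[of _ _ 0] by (subst Bochner_Integration.integral_sum) auto
        also have "\<dots> = 0" using False unfolding integral_circ_power_cnj_power by simp
        finally show ?thesis .
      qed
      then show "\<forall>\<^sub>F n in sequentially. (LINT t|circ. t ^ l * (\<Sum>k<n. a k * t ^ k)) = 0" by simp
    qed (auto intro!: continuous_intros simp: norm_power)
    then show ?thesis using False by simp
  qed
  \<comment> \<open>The Cauchy integral of g returns f z; that of cnj g is the constant cnj (a 0),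
    whose conjugate cancels the mean.\<close>
  have P: "(LINT s|circ. of_real (2 * Re (1 / (1 - z * cnj s)) - 1) * g s) = f z" if z: "norm z < 1" for z
  proof -
    have "(\<lambda>k. z ^ k * a k) sums f z" using a(1)[OF z] by (simp add: mult.commute)
    then have "(LINT s|circ. g s / (1 - z * cnj s)) = f z"
      using circ_cauchy_kernel_sums(1)[OF g z] unfolding c1 by (rule sums_unique2[symmetric])
    moreover have "(LINT s|circ. cnj (g s) / (1 - z * cnj s)) = cnj (a 0)"
    proof -
      have gcn: "integrable circ (\<lambda>s. cnj (g s))" using g by simp
      have "(LINT t|circ. cnj t ^ k * cnj (g t)) = (if k = 0 then cnj (a 0) else 0)" for k
      proof -
        have "(LINT t|circ. cnj t ^ k * cnj (g t)) = (LINT t|circ. cnj (t ^ k * g t))" by simp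
        also have "\<dots> = cnj (if k = 0 then a 0 else 0)" unfolding Bochner_Integration.integral_cnj c2 ..
        finally show ?thesis by simp
      qed
      then have "(\<lambda>k. z ^ k * (if k = 0 then cnj (a 0) else 0)) sums (LINT s|circ. cnj (g s) / (1 - z * cnj s))"
        using circ_cauchy_kernel_sums(1)[OF gcn z] by (simp only:)
      moreover have "(\<lambda>k. z ^ k * (if k = 0 then cnj (a 0) else 0)) = (\<lambda>k. if k = 0 then cnj (a 0) else 0)" by auto
      ultimately have "(\<lambda>k::nat. if k = 0 then cnj (a 0) else 0) sums (LINT s|circ. cnj (g s) / (1 - z * cnj s))" by (simp only:)
      from sums_unique2[OF this sums_single] show ?thesis .
    qed
    moreover have "(LINT s|circ. g s) = a 0" using c1[of 0] by simp
    ultimately show ?thesis unfolding poisson_integral_eq_cauchy[OF g z] by simp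
  qed
  have "AE t in circ. ((\<lambda>r. f (of_real r * t)) \<longlongrightarrow> g t) (at_left 1)"
    using poisson_integral_radial_limit[OF g] AE_circ_norm
  proof eventually_elim
    case (elim t)
    show ?case
      by (rule Lim_transform_eventually[OF elim(1)])
         (use eventually_at_left_1 in eventually_elim, rule P, use elim(2) in \<open>simp add: norm_mult\<close>)
  qed
  then show ?thesis by (rule that)
qed

section \<open>Cauchy transforms and functions with nonnegative real part\<close>

definition cauchy_transform :: "(complex \<Rightarrow> complex) \<Rightarrow> complex \<Rightarrow> complex" where
  "cauchy_transform u z = (LINT t|circ. u t / (1 - z * cnj t))"

lemma cauchy_transform_holomorphic:
  assumes "integrable circ u" shows "cauchy_transform u holomorphic_on ball 0 1"
proof (rule power_series_holomorphic)
  fix w :: complex assume "w \<in> ball 0 1"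
  then have "norm w < 1" by simp
  from circ_cauchy_kernel_sums(1)[OF assms this]
  show "(\<lambda>k. (LINT t|circ. cnj t ^ k * u t) * (w - 0) ^ k) sums cauchy_transform u w"
    by (simp add: cauchy_transform_def mult.commute)
qed

text \<open>If c^2 = w and Re w \<ge> 0, then |Im c| \<le> |Re c|, so |c|^2 \<le> 2 (Re c)^2; the
  constant 2 in place of its square root is chosen for convenience.\<close>

lemma csqrt_norm_le_Re: "Re w \<ge> 0 \<Longrightarrow> norm (csqrt w) \<le> 2 * Re (csqrt w)"
proof -
  assume w: "Re w \<ge> 0"
  define c where "c = csqrt w"
  have "c\<^sup>2 = w" by (simp add: c_def)
  then have "(Re c)\<^sup>2 - (Im c)\<^sup>2 \<ge> 0" using w by (auto simp: power2_eq_square)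
  then have "(norm c)\<^sup>2 \<le> 4 * (Re c)\<^sup>2"
    using zero_le_power2[of "Re c"] unfolding cmod_power2 by linarith
  then have sq: "(norm c)\<^sup>2 \<le> (2 * Re c)\<^sup>2" by (simp only: power_mult_distrib) simp
  have "Re c \<ge> 0" unfolding c_def by (rule Re_csqrt)
  then have "norm c \<le> 2 * Re c" by (intro power2_le_imp_le[OF sq]) simp
  then show ?thesis by (simp add: c_def)
qed

theorem nonneg_Re_holomorphic_radial_limit:
  assumes F: "F holomorphic_on ball 0 1" "\<And>w. norm w < 1 \<Longrightarrow> Re (F w) \<ge> 0"
  obtains G where "AE t in circ. ((\<lambda>r. F (of_real r * t)) \<longlongrightarrow> G t) (at_left 1)"
proof -
  have re: "Re (1 + F w) \<ge> 1" "1 + F w \<noteq> 0" "norm (1 + F w) \<ge> 1" if "norm w < 1" for w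
  proof -
    show *: "Re (1 + F w) \<ge> 1" using F(2)[OF that] by simp
    then show "1 + F w \<noteq> 0" by force
    show "norm (1 + F w) \<ge> 1" using * complex_Re_le_cmod[of "1 + F w"] by linarith
  qed
  obtain g where g: "AE t in circ. ((\<lambda>r. 1 / (1 + F (of_real r * t))) \<longlongrightarrow> g t) (at_left 1)"
  proof (rule bounded_holomorphic_radial_limit)
    show "(\<lambda>w. 1 / (1 + F w)) holomorphic_on ball 0 1"
      using re by (intro holomorphic_intros F) auto
    show "norm (1 / (1 + F w)) \<le> 1" if "norm w < 1" for w
      using re[OF that] by (simp add: norm_divide divide_le_eq_1)
  qed
  \<comment> \<open>The values of \<open>h\<close> lie in a sector around the positive axis, so \<open>Re h\<close> controls \<open>norm h\<close>, and
    its integral means are \<open>Re (h 0)\<close>. By Fatou's lemma \<open>h\<close> cannot tend to infinity on a set of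
    positive measure.\<close>
  define h where "h = (\<lambda>w. csqrt (1 + F w))"
  have h: "h holomorphic_on ball 0 1" unfolding h_def
  proof (intro holomorphic_intros F)
    fix z :: complex assume "z \<in> ball 0 1"
    then have "Re (1 + F z) \<ge> 1" using re(1)[of z] by simp
    then show "1 + F z \<notin> \<real>\<^sub>\<le>\<^sub>0" by (auto simp: complex_nonpos_Reals_iff)
  qed
  \<comment> \<open>Fatou's lemma needs a sequence of radii tending to 1; the shift by 2 makes it
    start at 1/2.\<close>
  define q :: "nat \<Rightarrow> real" where "q = (\<lambda>n. 1 - 1 / (real n + 2))"
  have q: "0 \<le> q n" "q n < 1" for n by (simp_all add: q_def field_simps)
  have qlim: "filterlim q (at_left 1) sequentially"
  proof -
    have "q \<longlonglongrightarrow> 1" unfolding q_def using LIMSEQ_Suc[OF LIMSEQ_inverse_real_of_nat_add_minus[of 1]] by (simp add: inverse_eq_divide add.commute)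
    moreover have "q n \<noteq> 1" for n using q(2)[of n] by simp
    ultimately show ?thesis using q(2) unfolding filterlim_at by (intro conjI always_eventually) auto
  qed
  have int: "integrable circ (\<lambda>t. h (of_real r * t))" if "0 \<le> r" "r < 1" for r
    using that
    by (intro continuous_on_sphere_integrable_circ continuous_on_compose2[OF holomorphic_on_imp_continuous_on[OF h]]
          continuous_intros) (auto simp: norm_mult)
  have bound: "(\<integral>\<^sup>+ t. ennreal (norm (h (of_real (q n) * t))) \<partial>circ) \<le> ennreal (2 * Re (h 0))" for n
  proof -
    have "(LINT t|circ. norm (h (of_real (q n) * t))) \<le> (LINT t|circ. 2 * Re (h (of_real (q n) * t)))"
    proof (rule integral_mono_AE)
      show "AE t in circ. norm (h (of_real (q n) * t)) \<le> 2 * Re (h (of_real (q n) * t))"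
        using AE_circ_norm
      proof eventually_elim
        case (elim t)
        then have "norm (of_real (q n) * t) < 1" using q by (simp add: norm_mult)
        from re(1)[OF this] show ?case unfolding h_def by (intro csqrt_norm_le_Re) simp
      qed
    qed (use int[OF q] in auto)
    also have "\<dots> = 2 * Re (LINT t|circ. h (of_real (q n) * t))" using int[OF q] by simp
    also have "(LINT t|circ. h (of_real (q n) * t)) = h 0"
      by (rule holomorphic_circle_coefficients[OF h]) (use q in blast)
    finally show ?thesis using int[OF q] by (subst nn_integral_eq_integral) (auto intro: ennreal_leI)
  qed
  have "(\<integral>\<^sup>+ t. liminf (\<lambda>n. ennreal (norm (h (of_real (q n) * t)))) \<partial>circ)
      \<le> liminf (\<lambda>n. \<integral>\<^sup>+ t. ennreal (norm (h (of_real (q n) * t))) \<partial>circ)"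
    using int[OF q] by (intro nn_integral_liminf) auto
  also have "\<dots> \<le> limsup (\<lambda>n. \<integral>\<^sup>+ t. ennreal (norm (h (of_real (q n) * t))) \<partial>circ)"
    by (intro Liminf_le_Limsup) auto
  also have "\<dots> \<le> ennreal (2 * Re (h 0))"
    using bound by (intro Limsup_bounded always_eventually) auto
  finally have "(\<integral>\<^sup>+ t. liminf (\<lambda>n. ennreal (norm (h (of_real (q n) * t)))) \<partial>circ) \<noteq> \<infinity>"
    by (metis ennreal_neq_top infinity_ennreal_def neq_top_trans)
  then have fin: "AE t in circ. liminf (\<lambda>n. ennreal (norm (h (of_real (q n) * t)))) \<noteq> \<infinity>"
    using int[OF q] by (intro nn_integral_PInf_AE borel_measurable_liminf) auto
  have "AE t in circ. ((\<lambda>r. F (of_real r * t)) \<longlongrightarrow> 1 / g t - 1) (at_left 1)"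
    using g fin AE_circ_norm
  proof eventually_elim
    case (elim t)
    have ne: "g t \<noteq> 0"
    proof
      assume "g t = 0"
      with elim have "((\<lambda>r. 1 / (1 + F (of_real r * t))) \<longlongrightarrow> 0) (at_left 1)" by simp
      from filterlim_compose[OF this qlim]
      have l: "(\<lambda>n. norm (1 / (1 + F (of_real (q n) * t)))) \<longlonglongrightarrow> 0" by (rule tendsto_norm_zero)
      have big: "\<forall>\<^sub>F n in sequentially. ennreal B \<le> ennreal (norm (h (of_real (q n) * t)))" if B: "B > 0" for B
      proof -
        have "\<forall>\<^sub>F n in sequentially. norm (1 / (1 + F (of_real (q n) * t))) < 1 / B\<^sup>2"
          using order_tendstoD(2)[OF l, of "1 / B\<^sup>2"] B by simp
        then show ?thesis
        proof eventually_elim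
          case (elim n)
          have "norm (of_real (q n) * t) < 1" using q \<open>norm t = 1\<close> by (simp add: norm_mult)
          then have "norm (1 + F (of_real (q n) * t)) > 0" using re(3)[of "of_real (q n) * t"] by linarith
          then have "B\<^sup>2 < norm (1 + F (of_real (q n) * t))" using elim B by (simp add: norm_divide field_simps)
          also have "\<dots> = (norm (h (of_real (q n) * t)))\<^sup>2" by (simp add: h_def flip: norm_power)
          finally have "B < norm (h (of_real (q n) * t))" by (rule power2_less_imp_less) simp
          then show ?case by (intro ennreal_leI) simp
        qed
      qed
      have "ennreal B \<le> liminf (\<lambda>n. ennreal (norm (h (of_real (q n) * t))))" if "B > 0" for B
        by (rule Liminf_bounded) (rule big[OF that])
      moreover obtain c where "liminf (\<lambda>n. ennreal (norm (h (of_real (q n) * t)))) = ennreal c" "c \<ge> 0"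
        using elim(2) by (cases "liminf (\<lambda>n. ennreal (norm (h (of_real (q n) * t))))") auto
      ultimately have "ennreal (c + 1) \<le> ennreal c" by (metis add_nonneg_pos zero_less_one)
      then show False using \<open>c \<ge> 0\<close> by simp
    qed
    have "((\<lambda>r. 1 / (1 / (1 + F (of_real r * t))) - 1) \<longlongrightarrow> 1 / g t - 1) (at_left 1)"
      by (intro tendsto_intros elim(1) ne)
    then show ?case by simp
  qed
  then show ?thesis by (rule that)
qed

text \<open>The Poisson kernel 2 Re k - 1 is nonnegative, so the Cauchy kernel k has real part at
  least 1/2. For the pointwise squared norm of a unit vector this keeps the Cauchy transform away
  from 0, in the disk and in the radial limit.\<close>

lemma cauchy_transform_nonneg_Re:
  assumes v: "integrable circ v" "AE t in circ. Re (v t) \<ge> 0 \<and> Im (v t) = 0" and z: "norm z < 1"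
  shows "Re (cauchy_transform v z) \<ge> 1 / 2 * Re (LINT t|circ. v t)"
proof -
  note i = circ_cauchy_kernel_sums(2)[OF v(1) z]
  have "(LINT t|circ. 1 / 2 * Re (v t)) \<le> (LINT t|circ. Re (v t / (1 - z * cnj t)))"
  proof (rule integral_mono_AE)
    show "AE t in circ. 1 / 2 * Re (v t) \<le> Re (v t / (1 - z * cnj t))"
      using v(2) AE_circ_norm
    proof eventually_elim
      case (elim t)
      have "2 * Re (1 / (1 - z * cnj t)) - 1 = (1 - (norm z)\<^sup>2) / (norm (1 - z * cnj t))\<^sup>2"
        by (rule poisson_kernel_eq_Re[OF z elim(2)])
      also have "\<dots> \<ge> 0" using z by (intro divide_nonneg_nonneg) (auto simp: power_le_one)
      finally have "Re (1 / (1 - z * cnj t)) \<ge> 1/2" by simp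
      then have "1 / 2 * Re (v t) \<le> Re (1 / (1 - z * cnj t)) * Re (v t)" using elim by (intro mult_right_mono) auto
      moreover have vt: "of_real (Re (v t)) = v t" using elim by (simp add: complex_eq_iff)
      have "Re (v t / (1 - z * cnj t)) = Re (of_real (Re (v t)) * (1 / (1 - z * cnj t)))"
        unfolding vt by simp
      then have "Re (v t / (1 - z * cnj t)) = Re (1 / (1 - z * cnj t)) * Re (v t)"
        by (metis scaleR_conv_of_real scaleR_complex.sel(1) mult.commute)
      ultimately show ?case by simp
    qed
  qed (use i v(1) in auto)
  then show ?thesis using v(1) i by (simp add: cauchy_transform_def)
qed

text \<open>This is convergence of the analytic part alone, which Poisson convergence does not give.
  The positive and negative parts of Re u and Im u have Cauchy transforms with nonnegative real
  part, and u is recovered from the four of them.\<close>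

theorem cauchy_transform_radial_limit:
  assumes u: "integrable circ u"
  obtains G where "AE t in circ. ((\<lambda>r. cauchy_transform u (of_real r * t)) \<longlongrightarrow> G t) (at_left 1)"
proof -
  have pos: "\<exists>G. AE t in circ. ((\<lambda>r. cauchy_transform (\<lambda>t. of_real (v t)) (of_real r * t)) \<longlongrightarrow> G t) (at_left 1)"
    if v: "integrable circ v" "\<And>t. v t \<ge> 0" for v :: "complex \<Rightarrow> real"
  proof -
    have i: "integrable circ (\<lambda>t. complex_of_real (v t))" using v by simp
    have "Re (cauchy_transform (\<lambda>t. of_real (v t)) w) \<ge> 0" if "norm w < 1" for w
    proof -
      have "0 \<le> (LINT t|circ. v t)" using v(2) by (rule Bochner_Integration.integral_nonneg)
      moreover have "Re (cauchy_transform (\<lambda>t. of_real (v t)) w) \<ge> 1 / 2 * Re (LINT t|circ. of_real (v t))"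
        by (rule cauchy_transform_nonneg_Re[OF i _ that]) (use v(2) in auto)
      moreover have "Re (LINT t|circ. complex_of_real (v t)) = (LINT t|circ. v t)" by simp
      ultimately show ?thesis by linarith
    qed
    from nonneg_Re_holomorphic_radial_limit[OF cauchy_transform_holomorphic[OF i] this] show ?thesis by metis
  qed
  define v where "v = (\<lambda>(k::nat) t. if k = 0 then max 0 (Re (u t)) else if k = 1 then max 0 (- Re (u t)) else
     if k = 2 then max 0 (Im (u t)) else max 0 (- Im (u t)))"
  have "integrable circ (\<lambda>t. Re (u t))" "integrable circ (\<lambda>t. Im (u t))" using u by auto
  then have vi: "integrable circ (v k)" "v k t \<ge> 0" for k t
    by (cases "k = 0"; cases "k = 1"; cases "k = 2"; simp add: v_def)+
  have "\<exists>G. AE t in circ. ((\<lambda>r. cauchy_transform (\<lambda>t. of_real (v k t)) (of_real r * t)) \<longlongrightarrow> G t) (at_left 1)" for k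
    by (rule pos) (rule vi)+
  then obtain G where G: "\<And>k. AE t in circ. ((\<lambda>r. cauchy_transform (\<lambda>t. of_real (v k t)) (of_real r * t)) \<longlongrightarrow> G k t) (at_left 1)"
    by metis
  have dec: "cauchy_transform u z = cauchy_transform (\<lambda>t. of_real (v 0 t)) z - cauchy_transform (\<lambda>t. of_real (v 1 t)) z
      + \<i> * (cauchy_transform (\<lambda>t. of_real (v 2 t)) z - cauchy_transform (\<lambda>t. of_real (v 3 t)) z)" if z: "norm z < 1" for z
  proof -
    have i: "integrable circ (\<lambda>t. of_real (v k t) / (1 - z * cnj t))" for k
      by (rule circ_cauchy_kernel_sums(2)) (use vi z in auto)
    have eq: "u t / (1 - z * cnj t) = of_real (v 0 t) / (1 - z * cnj t) - of_real (v 1 t) / (1 - z * cnj t)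
       + \<i> * (of_real (v 2 t) / (1 - z * cnj t) - of_real (v 3 t) / (1 - z * cnj t))" for t
    proof -
      have "u t = of_real (v 0 t) - of_real (v 1 t) + \<i> * (of_real (v 2 t) - of_real (v 3 t))"
        by (simp add: v_def complex_eq_iff max_def)
      then show ?thesis by (simp add: add_divide_distrib diff_divide_distrib right_diff_distrib)
    qed
    show ?thesis unfolding cauchy_transform_def eq using i by simp
  qed
  have "AE t in circ. ((\<lambda>r. cauchy_transform u (of_real r * t)) \<longlongrightarrow> G 0 t - G 1 t + \<i> * (G 2 t - G 3 t)) (at_left 1)"
    using G[of 0] G[of 1] G[of 2] G[of 3] AE_circ_norm
  proof eventually_elim
    case (elim t)
    have "((\<lambda>r. cauchy_transform (\<lambda>t. of_real (v 0 t)) (of_real r * t) - cauchy_transform (\<lambda>t. of_real (v 1 t)) (of_real r * t)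
      + \<i> * (cauchy_transform (\<lambda>t. of_real (v 2 t)) (of_real r * t) - cauchy_transform (\<lambda>t. of_real (v 3 t)) (of_real r * t)))
       \<longlongrightarrow> G 0 t - G 1 t + \<i> * (G 2 t - G 3 t)) (at_left 1)"
      using elim by (intro tendsto_intros)
    then show ?case
      by (rule Lim_transform_eventually)
         (use eventually_at_left_1 in eventually_elim, use elim(5) in \<open>simp add: dec norm_mult\<close>)
  qed
  then show ?thesis by (rule that)
qed

lemma cauchy_transform_poisson_limit:
  assumes u: "integrable circ u"
  shows "AE t in circ. ((\<lambda>r. cauchy_transform u (of_real r * t) + cnj (cauchy_transform (\<lambda>t. cnj (u t)) (of_real r * t))
     - (LINT t|circ. u t)) \<longlongrightarrow> u t) (at_left 1)"
  using poisson_integral_radial_limit[OF u] AE_circ_norm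
proof eventually_elim
  case (elim t)
  show ?case unfolding cauchy_transform_def
    by (rule Lim_transform_eventually[OF elim(1)])
       (use eventually_at_left_1 in eventually_elim, rule poisson_integral_eq_cauchy[OF u],
        use elim(2) in \<open>simp add: norm_mult\<close>)
qed

section \<open>The space $L^R$\<close>

lemma measurable_vfun_iff:
  fixes f :: "'a \<Rightarrow> complex ^ 2"
  shows "f \<in> borel_measurable M \<longleftrightarrow> (\<lambda>x. f x $ 1) \<in> borel_measurable M \<and> (\<lambda>x. f x $ 2) \<in> borel_measurable M"
proof
  assume f: "f \<in> borel_measurable M"
  have "(\<lambda>x. f x $ i) \<in> borel_measurable M" for i
    using measurable_compose[OF f borel_measurable_continuous_onI[of "\<lambda>v. v $ i"]] by (simp add: continuous_on_component)
  then show "(\<lambda>x. f x $ 1) \<in> borel_measurable M \<and> (\<lambda>x. f x $ 2) \<in> borel_measurable M" by simp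
next
  assume "(\<lambda>x. f x $ 1) \<in> borel_measurable M \<and> (\<lambda>x. f x $ 2) \<in> borel_measurable M"
  then have a: "(\<lambda>x. f x $ 1) \<in> borel_measurable M" "(\<lambda>x. f x $ 2) \<in> borel_measurable M" by auto
  have c: "(\<lambda>x. f x \<bullet> b) \<in> borel_measurable M" for b
  proof -
    have "(\<lambda>x. f x \<bullet> b) = (\<lambda>x. f x $ 1 \<bullet> b $ 1 + f x $ 2 \<bullet> b $ 2)" by (simp add: inner_vec_def sum_2)
    moreover have "(\<lambda>x. f x $ 1 \<bullet> b $ 1) \<in> borel_measurable M"
      by (rule borel_measurable_inner[OF a(1) borel_measurable_const])
    moreover have "(\<lambda>x. f x $ 2 \<bullet> b $ 2) \<in> borel_measurable M"
      by (rule borel_measurable_inner[OF a(2) borel_measurable_const])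
    ultimately show ?thesis by simp
  qed
  show "f \<in> borel_measurable M"
    by (rule iffD2[OF borel_measurable_euclidean_space]) (intro ballI c)
qed

text \<open>
  The integrand of the inner product, written through the triangular factorization of the inverse
  of \<^const>\<open>WR\<close>, which makes its positivity visible.
\<close>

definition gram :: "(complex \<Rightarrow> complex) \<Rightarrow> vfun \<Rightarrow> vfun \<Rightarrow> complex \<Rightarrow> complex" where
  "gram R f g t = f t $ 1 * cnj (g t $ 1) +
     (f t $ 2 - R t * f t $ 1) * cnj (g t $ 2 - R t * g t $ 1) / of_real (1 - (norm (R t))\<^sup>2)"

text \<open>\<open>matrix_inv\<close> is a choice; the explicit matrix identifies it because
  two-sided inverses are unique. The determinant 1 - |R|^2 is nonzero for |R| < 1.\<close>

lemma matrix_inv_WR: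
  assumes "norm (R t) < 1"
  shows "matrix_inv (WR R t) = vector [vector [1 / of_real (1 - (norm (R t))\<^sup>2), - cnj (R t) / of_real (1 - (norm (R t))\<^sup>2)],
     vector [- R t / of_real (1 - (norm (R t))\<^sup>2), 1 / of_real (1 - (norm (R t))\<^sup>2)]]" (is "_ = ?B")
proof -
  define d where "d = complex_of_real (1 - (norm (R t))\<^sup>2)"
  have "(norm (R t))\<^sup>2 < 1" using assms by (simp add: power_less_one_iff)
  then have d0: "d \<noteq> 0" unfolding d_def by (metis diff_gt_0_iff_gt less_irrefl of_real_eq_0_iff)
  have d: "R t * cnj (R t) = 1 - d" unfolding d_def of_real_diff complex_norm_square by simp
  have d': "cnj (R t) * R t = 1 - d" using d by (simp add: mult.commute)
  have AB: "WR R t ** ?B = mat 1" "?B ** WR R t = mat 1"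
    unfolding d_def[symmetric] WR_def
    by (simp_all add: vec_eq_iff forall_2 matrix_matrix_mult_def sum_2 mat_def d0 d d' flip: diff_divide_distrib add_divide_distrib)
  have "\<exists>B. WR R t ** B = mat 1 \<and> B ** WR R t = mat 1" using AB by blast
  from someI_ex[OF this] have "matrix_inv (WR R t) ** WR R t = mat 1" by (simp add: matrix_inv_def)
  then have "matrix_inv (WR R t) = matrix_inv (WR R t) ** (WR R t ** ?B)" using AB by simp
  also have "\<dots> = ?B" using \<open>matrix_inv (WR R t) ** WR R t = mat 1\<close> by (simp add: matrix_mul_assoc)
  finally show ?thesis .
qed

lemma ip_density_eq_gram:
  assumes "norm (R t) < 1" shows "ip_density R f g t = gram R f g t"
proof -
  define d where "d = complex_of_real (1 - (norm (R t))\<^sup>2)"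
  have "(norm (R t))\<^sup>2 < 1" using assms by (simp add: power_less_one_iff)
  then have d0: "d \<noteq> 0" unfolding d_def by (metis diff_gt_0_iff_gt less_irrefl of_real_eq_0_iff)
  have d: "d = 1 - R t * cnj (R t)" unfolding d_def of_real_diff complex_norm_square by simp
  define X where "X = cnj (g t $ 1) * f t $ 1 - cnj (R t) * cnj (g t $ 1) * f t $ 2
    - R t * cnj (g t $ 2) * f t $ 1 + cnj (g t $ 2) * f t $ 2"
  define Y where "Y = (f t $ 2 - R t * f t $ 1) * cnj (g t $ 2 - R t * g t $ 1)"
  have "ip_density R f g t = X / d"
    unfolding ip_density_def matrix_inv_WR[of R, OF assms] d_def[symmetric] X_def
    by (simp add: sum_2 matrix_vector_mult_def) (simp add: add_divide_distrib diff_divide_distrib distrib_left right_diff_distrib mult_ac)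
  \<comment> \<open>Completing the square: the mixed terms of X and Y agree, and the two differ by
    f_1 cnj g_1 (1 - |R|^2).\<close>
  also have "X = f t $ 1 * cnj (g t $ 1) * d + Y"
    unfolding X_def Y_def d by (simp add: algebra_simps)
  also have "(f t $ 1 * cnj (g t $ 1) * d + Y) / d = f t $ 1 * cnj (g t $ 1) + Y / d"
    using d0 by (simp add: add_divide_distrib)
  finally show ?thesis by (simp only: gram_def Y_def d_def)
qed

lemma gram_linear:
  "gram R (\<lambda>t. f t + g t) h t = gram R f h t + gram R g h t"
  "gram R (\<lambda>t. f t - g t) h t = gram R f h t - gram R g h t"
  "gram R (\<lambda>t. \<phi> t *s f t) h t = \<phi> t * gram R f h t"
  by (simp_all add: gram_def ring_distribs add_divide_distrib diff_divide_distrib mult_ac)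

lemma gram_cnj: "gram R g f t = cnj (gram R f g t)"
  by (simp add: gram_def mult_ac)

lemma gram_linear_right:
  "gram R h (\<lambda>t. f t + g t) t = gram R h f t + gram R h g t"
  "gram R h (\<lambda>t. f t - g t) t = gram R h f t - gram R h g t"
  "gram R h (\<lambda>t. \<phi> t *s f t) t = cnj (\<phi> t) * gram R h f t"
  by (simp_all add: gram_cnj[of R h] gram_linear)

lemma gram_self:
  "gram R f f t = of_real ((norm (f t $ 1))\<^sup>2 + (norm (f t $ 2 - R t * f t $ 1))\<^sup>2 / (1 - (norm (R t))\<^sup>2))"
  unfolding gram_def of_real_add of_real_divide complex_norm_square ..

lemma
  assumes "norm (R t) < 1"
  shows gram_self_nonneg: "Re (gram R f f t) \<ge> 0"
    and gram_self_eq_0: "gram R f f t = 0 \<Longrightarrow> f t = 0"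
proof -
  have d: "1 - (norm (R t))\<^sup>2 > 0" using assms by (simp add: power_less_one_iff)
  then have nn: "(norm (f t $ 2 - R t * f t $ 1))\<^sup>2 / (1 - (norm (R t))\<^sup>2) \<ge> 0" by simp
  then show "Re (gram R f f t) \<ge> 0" unfolding gram_self by simp
  assume "gram R f f t = 0"
  then have "(norm (f t $ 1))\<^sup>2 + (norm (f t $ 2 - R t * f t $ 1))\<^sup>2 / (1 - (norm (R t))\<^sup>2) = 0"
    unfolding gram_self by (simp only: of_real_eq_0_iff)
  then have "(norm (f t $ 1))\<^sup>2 = 0" "(norm (f t $ 2 - R t * f t $ 1))\<^sup>2 / (1 - (norm (R t))\<^sup>2) = 0"
    using add_nonneg_eq_0_iff[OF zero_le_power2 nn] by blast+
  then have "f t $ 1 = 0" "f t $ 2 - R t * f t $ 1 = 0"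
    using d unfolding divide_eq_0_iff power_eq_0_iff norm_eq_zero by linarith+
  then have "f t $ 1 = 0" "f t $ 2 = 0" by auto
  then show "f t = 0" by (simp add: vec_eq_iff forall_2)
qed

text \<open>Both summands of \<open>gram\<close> are estimated by |a b| \<le> |a|^2 + |b|^2. This
  crude pointwise bound is what makes mixed products of two vectors integrable.\<close>

lemma norm_gram_le:
  assumes "norm (R t) < 1"
  shows "norm (gram R f g t) \<le> Re (gram R f f t) + Re (gram R g g t)"
proof -
  have d: "1 - (norm (R t))\<^sup>2 > 0" using assms by (simp add: power_less_one_iff)
  have am: "norm (a * cnj b) \<le> (norm a)\<^sup>2 + (norm b)\<^sup>2" for a b :: complex
    using sum_squares_bound[of "norm a" "norm b"] mult_nonneg_nonneg[OF norm_ge_zero[of a] norm_ge_zero[of b]]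
    unfolding norm_mult complex_mod_cnj by linarith
  define x y where "x = f t $ 2 - R t * f t $ 1" and "y = g t $ 2 - R t * g t $ 1"
  have "norm (gram R f g t) \<le> norm (f t $ 1 * cnj (g t $ 1)) + norm (x * cnj y / of_real (1 - (norm (R t))\<^sup>2))"
    unfolding gram_def x_def y_def by (rule norm_triangle_ineq)
  also have "norm (x * cnj y / of_real (1 - (norm (R t))\<^sup>2)) = norm (x * cnj y) / (1 - (norm (R t))\<^sup>2)"
    using d by (simp only: norm_divide norm_of_real abs_of_pos)
  also have "norm (f t $ 1 * cnj (g t $ 1)) + norm (x * cnj y) / (1 - (norm (R t))\<^sup>2)
    \<le> ((norm (f t $ 1))\<^sup>2 + (norm (g t $ 1))\<^sup>2) + ((norm x)\<^sup>2 + (norm y)\<^sup>2) / (1 - (norm (R t))\<^sup>2)"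
    using d by (intro add_mono divide_right_mono am) auto
  finally show ?thesis unfolding gram_self x_def y_def by (simp add: add_divide_distrib)
qed

text \<open>Strict inequality almost everywhere makes the weight invertible; in the theorem it comes
  from the positivity clause of \<open>log_integrable\<close>.\<close>

locale reflection_coefficient =
  fixes R :: "complex \<Rightarrow> complex"
  assumes R_measurable [measurable]: "R \<in> borel_measurable circ"
    and R_less_1: "AE t in circ. norm (R t) < 1"
begin

section \<open>Inner product and norm of the weighted space\<close>

lemma AE_ip_density: "AE t in circ. ip_density R f g t = gram R f g t"
  using R_less_1 by eventually_elim (rule ip_density_eq_gram)

lemma ip_eq: "ip R f g = (LINT t|circ. gram R f g t)"
  unfolding ip_def by (rule integral_circ_AE_cong[OF AE_ip_density])

lemma measurable_gram [measurable]:
  assumes "f \<in> borel_measurable circ" "g \<in> borel_measurable circ"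
  shows "(\<lambda>t. gram R f g t) \<in> borel_measurable circ"
proof -
  have [measurable]: "(\<lambda>t. f t $ 1) \<in> borel_measurable circ" "(\<lambda>t. f t $ 2) \<in> borel_measurable circ"
    "(\<lambda>t. g t $ 1) \<in> borel_measurable circ" "(\<lambda>t. g t $ 2) \<in> borel_measurable circ"
    using assms by (simp_all add: measurable_vfun_iff)
  have [measurable]: "cnj \<in> borel_measurable borel"
    by (intro borel_measurable_continuous_onI continuous_intros)
  show ?thesis unfolding gram_def by measurable
qed

lemma LR_iff: "f \<in> LR R \<longleftrightarrow> f \<in> borel_measurable circ \<and> integrable circ (gram R f f)"
proof -
  have "integrable circ (ip_density R f f) \<longleftrightarrow> integrable circ (gram R f f)"
  proof
    show "integrable circ (gram R f f)" if "integrable circ (ip_density R f f)"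
      using that AE_ip_density by (rule integrable_circ_AE_cong)
    show "integrable circ (ip_density R f f)" if "integrable circ (gram R f f)"
      using that by (rule integrable_circ_AE_cong) (use AE_ip_density[of f f] in eventually_elim, simp)
  qed
  then show ?thesis by (simp add: LR_def)
qed

lemma LR_measurable: "f \<in> LR R \<Longrightarrow> f \<in> borel_measurable circ"
  by (simp add: LR_iff)

lemma integrable_gram:
  assumes "f \<in> LR R" "g \<in> LR R" shows "integrable circ (gram R f g)"
proof (rule Bochner_Integration.integrable_bound[of _ "\<lambda>t. Re (gram R f f t) + Re (gram R g g t)"])
  show "integrable circ (\<lambda>t. Re (gram R f f t) + Re (gram R g g t))" using assms by (auto simp: LR_iff)
  show "gram R f g \<in> borel_measurable circ" using measurable_gram[OF assms[THEN LR_measurable]] by simp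
  show "AE t in circ. norm (gram R f g t) \<le> norm (Re (gram R f f t) + Re (gram R g g t))"
    using R_less_1
  proof eventually_elim
    case (elim t)
    show ?case using norm_gram_le[of R t f g] elim by simp
  qed
qed

lemma LR_cong:
  assumes "f \<in> LR R" "AE t in circ. f t = g t" shows "g \<in> LR R"
proof -
  have "AE t in circ. gram R f f t = gram R g g t"
    using assms(2) by eventually_elim (simp add: gram_def)
  then have "integrable circ (gram R g g)"
    using integrable_gram[OF assms(1,1)] by (rule integrable_circ_AE_cong[rotated])
  moreover have "g \<in> borel_measurable circ"
    by (rule AE_circ_cong_measurable[OF LR_measurable[OF assms(1)] assms(2)])
  ultimately show ?thesis unfolding LR_iff by simp
qed

lemma LR_mult:
  assumes "f \<in> LR R" "\<phi> \<in> borel_measurable circ" "AE t in circ. norm (\<phi> t) \<le> B"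
  shows "(\<lambda>t. \<phi> t *s f t) \<in> LR R"
  unfolding LR_iff
proof
  show m: "(\<lambda>t. \<phi> t *s f t) \<in> borel_measurable circ"
    using LR_measurable[OF assms(1)] assms(2) unfolding measurable_vfun_iff by auto
  show "integrable circ (gram R (\<lambda>t. \<phi> t *s f t) (\<lambda>t. \<phi> t *s f t))"
  proof (rule Bochner_Integration.integrable_bound[of _ "\<lambda>t. of_real (B\<^sup>2) * gram R f f t"])
    show "integrable circ (\<lambda>t. of_real (B\<^sup>2) * gram R f f t)" using assms(1) by (simp add: LR_iff)
    show "gram R (\<lambda>t. \<phi> t *s f t) (\<lambda>t. \<phi> t *s f t) \<in> borel_measurable circ" using measurable_gram[OF m m] by simp
    show "AE t in circ. norm (gram R (\<lambda>t. \<phi> t *s f t) (\<lambda>t. \<phi> t *s f t) t) \<le> norm (of_real (B\<^sup>2) * gram R f f t)"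
      using assms(3)
    proof eventually_elim
      case (elim t)
      have "norm (\<phi> t) * norm (\<phi> t) \<le> B * B" using elim order_trans[OF norm_ge_zero elim] by (intro mult_mono) auto
      then have "norm (\<phi> t) * (norm (\<phi> t) * norm (gram R f f t)) \<le> B * B * norm (gram R f f t)"
        by (simp add: mult_right_mono flip: mult.assoc)
      then show ?case by (simp add: gram_linear gram_linear_right norm_mult power2_eq_square)
    qed
  qed
qed

lemma LR_scale: "f \<in> LR R \<Longrightarrow> (\<lambda>t. c *s f t) \<in> LR R"
  by (rule LR_mult[where B = "norm c"]) auto

lemma LR_add: assumes "f \<in> LR R" "g \<in> LR R" shows "(\<lambda>t. f t + g t) \<in> LR R"
proof -
  have "integrable circ (\<lambda>t. gram R f f t + gram R f g t + (gram R g f t + gram R g g t))"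
    by (intro Bochner_Integration.integrable_add integrable_gram assms)
  moreover have "gram R (\<lambda>t. f t + g t) (\<lambda>t. f t + g t) = (\<lambda>t. gram R f f t + gram R f g t + (gram R g f t + gram R g g t))"
    by (simp add: fun_eq_iff gram_linear gram_linear_right)
  moreover have "(\<lambda>t. f t + g t) \<in> borel_measurable circ"
    using assms[THEN LR_measurable] by (rule borel_measurable_add)
  ultimately show ?thesis unfolding LR_iff by simp
qed

lemma LR_diff: assumes "f \<in> LR R" "g \<in> LR R" shows "(\<lambda>t. f t - g t) \<in> LR R"
proof -
  have "(\<lambda>t. f t + (-1) *s g t) = (\<lambda>t. f t - g t)" by (simp add: vec_eq_iff fun_eq_iff)
  then show ?thesis using LR_add[OF assms(1) LR_scale[OF assms(2), of "-1"]] by simp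
qed

lemma ip_add: "f \<in> LR R \<Longrightarrow> g \<in> LR R \<Longrightarrow> h \<in> LR R \<Longrightarrow> ip R (\<lambda>t. f t + g t) h = ip R f h + ip R g h"
  unfolding ip_eq gram_linear by (intro Bochner_Integration.integral_add integrable_gram)

lemma ip_diff: "f \<in> LR R \<Longrightarrow> g \<in> LR R \<Longrightarrow> h \<in> LR R \<Longrightarrow> ip R (\<lambda>t. f t - g t) h = ip R f h - ip R g h"
  unfolding ip_eq gram_linear by (intro Bochner_Integration.integral_diff integrable_gram)

lemma ip_scale: "ip R (\<lambda>t. c *s f t) h = c * ip R f h"
  unfolding ip_eq gram_linear by simp

lemma ip_cnj: "ip R g f = cnj (ip R f g)"
  unfolding ip_eq Bochner_Integration.integral_cnj[symmetric] gram_cnj[of R g f] ..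

lemma ip_diff_right: "f \<in> LR R \<Longrightarrow> g \<in> LR R \<Longrightarrow> h \<in> LR R \<Longrightarrow> ip R h (\<lambda>t. f t - g t) = ip R h f - ip R h g"
  unfolding ip_cnj[of h] by (simp add: ip_diff)

lemma ip_scale_right: "ip R h (\<lambda>t. c *s f t) = cnj c * ip R h f"
  unfolding ip_cnj[of h] by (simp add: ip_scale)

lemma ip_cong: "AE t in circ. f t = f' t \<Longrightarrow> AE t in circ. g t = g' t \<Longrightarrow> ip R f g = ip R f' g'"
  unfolding ip_eq by (rule integral_circ_AE_cong) (auto simp: gram_def elim: eventually_elim2)

lemma ip_unitary:
  assumes "AE t in circ. norm (\<phi> t) = 1"
  shows "ip R (\<lambda>t. \<phi> t *s f t) (\<lambda>t. \<phi> t *s g t) = ip R f g"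
  unfolding ip_eq
proof (rule integral_circ_AE_cong)
  show "AE t in circ. gram R (\<lambda>t. \<phi> t *s f t) (\<lambda>t. \<phi> t *s g t) t = gram R f g t"
    using assms
    by eventually_elim (simp add: gram_linear gram_linear_right norm_1_mult_cnj flip: mult.assoc)
qed

lemma ip_self: "f \<in> LR R \<Longrightarrow> ip R f f = of_real ((normR R f)\<^sup>2)"
proof -
  assume f: "f \<in> LR R"
  have "Re (ip R f f) = (LINT t|circ. Re (gram R f f t))"
    unfolding ip_eq using integrable_gram[OF f f] by simp
  also have "\<dots> \<ge> 0"
    by (rule integral_nonneg_AE) (use R_less_1 in eventually_elim, rule gram_self_nonneg)
  finally have "Re (ip R f f) = (normR R f)\<^sup>2" by (simp add: normR_def)
  moreover have "Im (ip R f f) = 0" using ip_cnj[of f f] by (metis complex_cnj_cancel_iff complex_is_Real_iff Reals_cnj_iff)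
  ultimately show ?thesis by (simp add: complex_eq_iff)
qed

lemma normR_nonneg: "f \<in> LR R \<Longrightarrow> normR R f \<ge> 0"
  unfolding normR_def using ip_self[of f] by simp

lemma normR_cong: "AE t in circ. f t = g t \<Longrightarrow> normR R f = normR R g"
  unfolding normR_def using ip_cong[of f g f g] by simp

lemma normR_eq_0: 
  assumes f: "f \<in> LR R" and "normR R f = 0" shows "AE t in circ. f t = 0"
proof -
  have "(LINT t|circ. Re (gram R f f t)) = Re (ip R f f)"
    unfolding ip_eq using integrable_gram[OF f f] by simp
  also have "\<dots> = 0" using ip_self[OF f] assms(2) by simp
  finally have "AE t in circ. Re (gram R f f t) = 0"
    using integrable_gram[OF f f] R_less_1
    by (subst (asm) integral_nonneg_eq_0_iff_AE) (auto elim!: eventually_mono intro: gram_self_nonneg)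
  then show ?thesis using R_less_1
  proof eventually_elim
    case (elim t)
    then have "gram R f f t = 0" using gram_cnj[of R f f t] by (metis Reals_cnj_iff complex_is_Real_iff complex_eqI zero_complex.sel)
    then show ?case using elim(2) by (rule gram_self_eq_0[rotated])
  qed
qed

lemma normR_scale: "f \<in> LR R \<Longrightarrow> normR R (\<lambda>t. c *s f t) = norm c * normR R f"
proof -
  assume f: "f \<in> LR R"
  have "ip R (\<lambda>t. c *s f t) (\<lambda>t. c *s f t) = of_real ((norm c * normR R f)\<^sup>2)"
    by (simp only: ip_scale ip_scale_right ip_self[OF f] power_mult_distrib of_real_mult complex_norm_square mult.assoc)
  then show ?thesis using normR_nonneg[OF f] by (simp add: normR_def[of R "\<lambda>t. c *s f t"])
qed

lemma normR_diff_square: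
  assumes "f \<in> LR R" "g \<in> LR R"
  shows "(normR R (\<lambda>t. f t - g t))\<^sup>2 = (normR R f)\<^sup>2 + (normR R g)\<^sup>2 - 2 * Re (ip R f g)"
proof -
  have "complex_of_real ((normR R (\<lambda>t. f t - g t))\<^sup>2) = ip R (\<lambda>t. f t - g t) (\<lambda>t. f t - g t)"
    by (rule ip_self[OF LR_diff[OF assms], symmetric])
  also have "\<dots> = ip R f f + ip R g g - (ip R f g + cnj (ip R f g))"
    using assms by (simp add: ip_diff ip_diff_right LR_diff ip_cnj[of g f])
  also have "\<dots> = of_real ((normR R f)\<^sup>2 + (normR R g)\<^sup>2 - 2 * Re (ip R f g))"
    using ip_self assms by (simp add: complex_add_cnj)
  finally show ?thesis by (simp only: of_real_eq_iff)
qed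

lemma ip_cauchy_schwarz:
  assumes f: "f \<in> LR R" and g: "g \<in> LR R" shows "norm (ip R f g) \<le> normR R f * normR R g"
proof (cases "normR R g = 0")
  case True
  from normR_eq_0[OF g True] have "AE t in circ. g t = (\<lambda>t. 0) t" by simp
  then have "ip R f g = ip R f (\<lambda>t. 0)" by (intro ip_cong) auto
  also have "\<dots> = 0" unfolding ip_eq by (simp add: gram_def[abs_def])
  finally show ?thesis using True by simp
next
  case False
  define N where "N = normR R g"
  have N: "N > 0" using False normR_nonneg[OF g] by (simp add: N_def)
  define c where "c = ip R f g / of_real (N\<^sup>2)"
  have "0 \<le> (normR R (\<lambda>t. f t - c *s g t))\<^sup>2" by simp
  also have "\<dots> = (normR R f)\<^sup>2 + (norm c * N)\<^sup>2 - 2 * Re (cnj c * ip R f g)"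
    unfolding normR_diff_square[OF f LR_scale[OF g]] normR_scale[OF g] ip_scale_right N_def ..
  also have "cnj c * ip R f g = of_real ((norm (ip R f g))\<^sup>2 / N\<^sup>2)"
    unfolding of_real_divide complex_norm_square by (simp add: c_def mult.commute)
  also have "norm c * N = norm (ip R f g) / N"
  proof -
    have "norm (complex_of_real (N\<^sup>2)) = N\<^sup>2" by (simp only: norm_of_real) simp
    then show ?thesis using N unfolding c_def norm_divide by (simp only:) (simp add: power2_eq_square)
  qed
  finally have "0 \<le> (normR R f)\<^sup>2 + (norm (ip R f g) / N)\<^sup>2 - 2 * Re (of_real ((norm (ip R f g))\<^sup>2 / N\<^sup>2))" .
  then have "(norm (ip R f g))\<^sup>2 / N\<^sup>2 \<le> (normR R f)\<^sup>2" by (simp add: power_divide)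
  then have sq: "(norm (ip R f g))\<^sup>2 \<le> (normR R f * N)\<^sup>2" using N by (simp add: power_mult_distrib field_simps)
  have "norm (ip R f g) \<le> normR R f * N"
    by (rule power2_le_imp_le[OF sq]) (use N normR_nonneg[OF f] in simp)
  then show ?thesis by (simp only: N_def)
qed

lemma normR_triangle_diff:
  assumes f: "f \<in> LR R" and g: "g \<in> LR R" shows "normR R (\<lambda>t. f t - g t) \<le> normR R f + normR R g"
proof (rule power2_le_imp_le)
  have "- Re (ip R f g) \<le> normR R f * normR R g"
    using ip_cauchy_schwarz[OF f g] abs_Re_le_cmod[of "ip R f g"] by linarith
  then show "(normR R (\<lambda>t. f t - g t))\<^sup>2 \<le> (normR R f + normR R g)\<^sup>2"
    unfolding normR_diff_square[OF f g] power2_sum by simp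
  show "0 \<le> normR R f + normR R g" using normR_nonneg f g by simp
qed

lemma normR_triangle:
  assumes f: "f \<in> LR R" and g: "g \<in> LR R" shows "normR R (\<lambda>t. f t + g t) \<le> normR R f + normR R g"
proof -
  have "(\<lambda>t. f t - (-1) *s g t) = (\<lambda>t. f t + g t)" by (simp add: vec_eq_iff fun_eq_iff)
  then show ?thesis using normR_triangle_diff[OF f LR_scale[OF g, of "-1"]] normR_scale[OF g, of "-1"] by simp
qed

end

section \<open>Closed subspaces, projections and adjoints\<close>

context reflection_coefficient begin

text \<open>Closedness is expressed by approximation in \<open>normR\<close>, as in
  \<open>closure_LR\<close>, because functions equal almost everywhere are distinct objects at
  distance 0.\<close>

definition closed_subspace :: "vfun set \<Rightarrow> bool" where
  "closed_subspace S \<longleftrightarrow> S \<subseteq> LR R \<and> (\<forall>f\<in>S. \<forall>g\<in>S. (\<lambda>t. f t + g t) \<in> S) \<and> (\<forall>f\<in>S. \<forall>c. (\<lambda>t. c *s f t) \<in> S) \<and>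
     (\<forall>f\<in>LR R. (\<forall>e>0. \<exists>g\<in>S. normR R (\<lambda>t. f t - g t) < e) \<longrightarrow> f \<in> S)"

lemma
  assumes "closed_subspace S"
  shows closed_subspace_LR: "f \<in> S \<Longrightarrow> f \<in> LR R"
    and closed_subspace_add: "f \<in> S \<Longrightarrow> g \<in> S \<Longrightarrow> (\<lambda>t. f t + g t) \<in> S"
    and closed_subspace_scale: "f \<in> S \<Longrightarrow> (\<lambda>t. c *s f t) \<in> S"
    and closed_subspace_limit: "f \<in> LR R \<Longrightarrow> (\<And>e. e > 0 \<Longrightarrow> \<exists>g\<in>S. normR R (\<lambda>t. f t - g t) < e) \<Longrightarrow> f \<in> S"
  using assms unfolding closed_subspace_def by blast+

lemma closed_subspace_diff:
  assumes S: "closed_subspace S" and "f \<in> S" "g \<in> S" shows "(\<lambda>t. f t - g t) \<in> S"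
proof -
  have "(\<lambda>t. f t + (-1) *s g t) = (\<lambda>t. f t - g t)" by (simp add: vec_eq_iff fun_eq_iff)
  then show ?thesis
    using closed_subspace_add[OF S assms(2) closed_subspace_scale[OF S assms(3), of "-1"]] by simp
qed

lemma closed_subspace_0: 
  assumes S: "closed_subspace S" and "f \<in> S" shows "(\<lambda>t. 0) \<in> S"
  using closed_subspace_diff[OF S assms(2,2)] by simp

lemma normR_0: "normR R (\<lambda>t. 0) = 0"
  unfolding normR_def ip_eq by (simp add: gram_def[abs_def])

text \<open>A function that agrees almost everywhere with a member is at distance 0 from it, hence a
  limit of members.\<close>

lemma closed_subspace_cong:
  assumes S: "closed_subspace S" and f: "f \<in> S" and "AE t in circ. f t = g t" shows "g \<in> S"
proof (rule closed_subspace_limit[OF S])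
  show "g \<in> LR R" using closed_subspace_LR[OF S f] assms(3) by (rule LR_cong)
  have "AE t in circ. g t - f t = (\<lambda>t. 0) t" using assms(3) by eventually_elim simp
  then have "normR R (\<lambda>t. g t - f t) = normR R (\<lambda>t. 0)" by (rule normR_cong)
  then have "normR R (\<lambda>t. g t - f t) = 0" by (simp add: normR_0)
  then show "\<exists>h\<in>S. normR R (\<lambda>t. g t - h t) < e" if "e > 0" for e
    using that by (intro bexI[OF _ f]) simp
qed

lemma closure_LR_D: "f \<in> closure_LR R S \<Longrightarrow> e > 0 \<Longrightarrow> \<exists>g\<in>S. normR R (\<lambda>t. f t - g t) < e"
  by (simp add: closure_LR_def)

lemma closure_LR_superset: assumes "S \<subseteq> LR R" shows "S \<subseteq> closure_LR R S"
proof
  fix f assume f: "f \<in> S"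
  then have "\<exists>g\<in>S. normR R (\<lambda>t. f t - g t) < e" if "e > 0" for e
    using that by (intro bexI[OF _ f]) (simp add: normR_0)
  then show "f \<in> closure_LR R S" using f assms by (auto simp: closure_LR_def)
qed

lemma closed_subspace_closure:
  assumes S: "S \<subseteq> LR R" and add: "\<And>f g. f \<in> S \<Longrightarrow> g \<in> S \<Longrightarrow> (\<lambda>t. f t + g t) \<in> S"
    and scale: "\<And>f c. f \<in> S \<Longrightarrow> (\<lambda>t. c *s f t) \<in> S"
  shows "closed_subspace (closure_LR R S)"
  unfolding closed_subspace_def
proof (intro conjI ballI allI impI)
  show "closure_LR R S \<subseteq> LR R" by (auto simp: closure_LR_def)
next
  fix f g assume f: "f \<in> closure_LR R S" and g: "g \<in> closure_LR R S"
  then have L: "f \<in> LR R" "g \<in> LR R" by (auto simp: closure_LR_def)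
  have "\<exists>h\<in>S. normR R (\<lambda>t. f t + g t - h t) < e" if e: "e > 0" for e
  proof -
    have e2: "e/2 > 0" using e by simp
    obtain f' where f': "f' \<in> S" "normR R (\<lambda>t. f t - f' t) < e/2" using closure_LR_D[OF f e2] ..
    obtain g' where g': "g' \<in> S" "normR R (\<lambda>t. g t - g' t) < e/2" using closure_LR_D[OF g e2] ..
    have "normR R (\<lambda>t. (f t - f' t) + (g t - g' t)) \<le> normR R (\<lambda>t. f t - f' t) + normR R (\<lambda>t. g t - g' t)"
      using L f' g' S by (intro normR_triangle LR_diff) auto
    moreover have "(\<lambda>t. (f t - f' t) + (g t - g' t)) = (\<lambda>t. f t + g t - (f' t + g' t))" by (simp add: fun_eq_iff)
    ultimately have "normR R (\<lambda>t. f t + g t - (f' t + g' t)) < e" using f' g' by simp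
    then show ?thesis using add[OF f'(1) g'(1)] by (intro bexI[of _ "\<lambda>t. f' t + g' t"])
  qed
  then show "(\<lambda>t. f t + g t) \<in> closure_LR R S" using LR_add[OF L] by (simp add: closure_LR_def)
next
  fix f c assume f: "f \<in> closure_LR R S"
  then have L: "f \<in> LR R" by (auto simp: closure_LR_def)
  have "\<exists>h\<in>S. normR R (\<lambda>t. c *s f t - h t) < e" if e: "e > 0" for e
  proof -
    \<comment> \<open>The summand 1 takes care of c = 0.\<close>
    have "e / (norm c + 1) > 0" using e by (intro divide_pos_pos) (auto intro: add_nonneg_pos)
    from closure_LR_D[OF f this]
    obtain f' where f': "f' \<in> S" "normR R (\<lambda>t. f t - f' t) < e / (norm c + 1)" ..
    have "f' \<in> LR R" using f' S by auto
    have "normR R (\<lambda>t. c *s (f t - f' t)) = norm c * normR R (\<lambda>t. f t - f' t)"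
      by (rule normR_scale[OF LR_diff[OF L \<open>f' \<in> LR R\<close>]])
    also have "\<dots> \<le> (norm c + 1) * normR R (\<lambda>t. f t - f' t)"
      using normR_nonneg[OF LR_diff[OF L \<open>f' \<in> LR R\<close>]] by (intro mult_right_mono) auto
    also have "\<dots> < (norm c + 1) * (e / (norm c + 1))" using f'(2) by (intro mult_strict_left_mono) (auto intro: add_nonneg_pos)
    also have "\<dots> = e"
    proof -
      have "norm c + 1 \<noteq> 0" using norm_ge_zero[of c] by linarith
      then show ?thesis by simp
    qed
    finally have "normR R (\<lambda>t. c *s f t - c *s f' t) < e" by (simp add: vector_sub_rdistrib vector_ssub_ldistrib)
    then show ?thesis using scale[OF f'(1), of c] by (intro bexI[of _ "\<lambda>t. c *s f' t"])
  qed
  then show "(\<lambda>t. c *s f t) \<in> closure_LR R S" using LR_scale[OF L] by (simp add: closure_LR_def)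
next
  fix f assume f: "f \<in> LR R" "\<forall>e>0. \<exists>g\<in>closure_LR R S. normR R (\<lambda>t. f t - g t) < e"
  have "\<exists>h\<in>S. normR R (\<lambda>t. f t - h t) < e" if e: "e > 0" for e
  proof -
    have e2: "e/2 > 0" using e by simp
    then obtain g where g: "g \<in> closure_LR R S" "normR R (\<lambda>t. f t - g t) < e/2" using f(2) by blast
    from closure_LR_D[OF g(1) e2] obtain h where h: "h \<in> S" "normR R (\<lambda>t. g t - h t) < e/2" ..
    have gL: "g \<in> LR R" using g(1) by (simp add: closure_LR_def)
    have "normR R (\<lambda>t. (f t - g t) + (g t - h t)) \<le> normR R (\<lambda>t. f t - g t) + normR R (\<lambda>t. g t - h t)"
      using f(1) h S gL by (intro normR_triangle LR_diff) auto
    then have "normR R (\<lambda>t. f t - h t) < e" using g h by simp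
    then show ?thesis using h by blast
  qed
  then show "f \<in> closure_LR R S" using f(1) by (simp add: closure_LR_def)
qed

lemma closed_subspace_orth:
  assumes S: "S \<subseteq> LR R" shows "closed_subspace (orth R S)"
  unfolding closed_subspace_def
proof (intro conjI ballI allI impI)
  show "orth R S \<subseteq> LR R" by (auto simp: orth_def)
next
  fix f g assume "f \<in> orth R S" "g \<in> orth R S"
  then show "(\<lambda>t. f t + g t) \<in> orth R S" using S by (auto simp: orth_def LR_add ip_add subset_eq)
next
  fix f c assume "f \<in> orth R S"
  then show "(\<lambda>t. c *s f t) \<in> orth R S" by (auto simp: orth_def LR_scale ip_scale)
next
  fix f assume f: "f \<in> LR R" and lim: "\<forall>e>0. \<exists>g\<in>orth R S. normR R (\<lambda>t. f t - g t) < e"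
  have "ip R f h = 0" if h: "h \<in> S" for h
  proof -
    have hL: "h \<in> LR R" using h S by auto
    have "norm (ip R f h) \<le> e" if e: "e > 0" for e
    proof -
      have "e / (normR R h + 1) > 0" using e normR_nonneg[OF hL] by simp
      then obtain g where g: "g \<in> orth R S" "normR R (\<lambda>t. f t - g t) < e / (normR R h + 1)" using lim by blast
      then have gL: "g \<in> LR R" and gh: "ip R g h = 0" using h by (auto simp: orth_def)
      have "ip R f h = ip R (\<lambda>t. f t - g t) h" using f gL hL gh by (simp add: ip_diff)
      then have "norm (ip R f h) \<le> normR R (\<lambda>t. f t - g t) * normR R h"
        using ip_cauchy_schwarz[OF LR_diff[OF f gL] hL] by simp
      also have "\<dots> \<le> e / (normR R h + 1) * (normR R h + 1)"
        using g(2) normR_nonneg[OF hL] normR_nonneg[OF LR_diff[OF f gL]] by (intro mult_mono) auto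
      also have "\<dots> = e" using normR_nonneg[OF hL] by simp
      finally show ?thesis .
    qed
    then have "norm (ip R f h) \<le> 0" by (rule field_le_epsilon[of _ 0, simplified])
    then show ?thesis by simp
  qed
  then show "f \<in> orth R S" using f by (simp add: orth_def)
qed

lemma ip_0_of_orth: "(\<And>h. h \<in> S \<Longrightarrow> ip R K h = 0) \<Longrightarrow> h \<in> S \<Longrightarrow> ip R h K = 0"
  by (subst ip_cnj) simp

text \<open>The candidate p shows that the description in \<open>proj\<close> can be met, so the
  chosen function meets it as well. Their difference lies in S and is orthogonal to S, hence to
  itself. Existence of projections in general is thus never invoked.\<close>

lemma proj_eqI:
  assumes S: "closed_subspace S" and f: "f \<in> LR R" and p: "p \<in> S" "\<And>h. h \<in> S \<Longrightarrow> ip R (\<lambda>t. f t - p t) h = 0"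
  shows "proj R S f \<in> S \<and> (AE t in circ. proj R S f t = p t)"
proof -
  define q where "q = proj R S f"
  have "\<exists>g. g \<in> S \<and> (\<forall>h\<in>S. ip R (\<lambda>t. f t - g t) h = 0)" using p by blast
  from someI_ex[OF this] have q: "q \<in> S" "\<And>h. h \<in> S \<Longrightarrow> ip R (\<lambda>t. f t - q t) h = 0"
    by (auto simp: q_def proj_def)
  have L: "p \<in> LR R" "q \<in> LR R" using p q closed_subspace_LR[OF S] by auto
  define d where "d = (\<lambda>t. p t - q t)"
  have d: "d \<in> S" unfolding d_def by (rule closed_subspace_diff[OF S p(1) q(1)])
  then have dL: "d \<in> LR R" by (rule closed_subspace_LR[OF S])
  have "(\<lambda>t. f t - q t - (f t - p t)) = d" by (simp add: d_def fun_eq_iff)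
  then have "ip R d d = ip R (\<lambda>t. f t - q t) d - ip R (\<lambda>t. f t - p t) d"
    using ip_diff[OF LR_diff[OF f L(2)] LR_diff[OF f L(1)] dL] by simp
  then have "ip R d d = 0" using p(2)[OF d] q(2)[OF d] by simp
  then have "normR R d = 0" by (simp add: normR_def)
  from normR_eq_0[OF dL this] have "AE t in circ. q t = p t" by eventually_elim (simp add: d_def)
  then show ?thesis using q by (simp add: q_def)
qed

text \<open>The same scheme as for projections: the candidate k shows that the choice succeeds, and
  the difference of the two representing vectors is orthogonal to itself.\<close>

lemma adj_on_eqI:
  assumes S: "closed_subspace S" and k: "k \<in> S" "\<And>h. h \<in> S \<Longrightarrow> ip R (A h) g = ip R h k"
  shows "adj_on R S A g \<in> S \<and> (AE t in circ. adj_on R S A g t = k t)"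
proof -
  define q where "q = adj_on R S A g"
  have "\<exists>k. k \<in> S \<and> (\<forall>h\<in>S. ip R (A h) g = ip R h k)" using k by blast
  from someI_ex[OF this] have q: "q \<in> S" "\<And>h. h \<in> S \<Longrightarrow> ip R (A h) g = ip R h q"
    by (auto simp: q_def adj_on_def)
  define d where "d = (\<lambda>t. q t - k t)"
  have d: "d \<in> S" unfolding d_def by (rule closed_subspace_diff[OF S q(1) k(1)])
  then have dL: "d \<in> LR R" by (rule closed_subspace_LR[OF S])
  have "ip R d d = ip R d q - ip R d k"
    unfolding d_def using q(1) k(1) closed_subspace_LR[OF S] by (intro ip_diff_right LR_diff) auto
  also have "\<dots> = 0" using k(2)[OF d] q(2)[OF d] by simp
  finally have "normR R d = 0" by (simp add: normR_def)
  from normR_eq_0[OF dL this] have "AE t in circ. q t = k t" by eventually_elim (simp add: d_def)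
  then show ?thesis using q by (simp add: q_def)
qed

lemma closed_subspace_whole: "closed_subspace (LR R)"
  unfolding closed_subspace_def by (auto intro: LR_add LR_scale)

section \<open>Multiplication by the variable, Neumann iteration and codimension one\<close>

lemma measurable_circ_simps [measurable]:
  "(\<lambda>t. t) \<in> borel_measurable circ" "(\<lambda>t. cnj t) \<in> borel_measurable circ"
  by (intro measurable_circ_borel borel_measurable_continuous_onI continuous_intros)+

lemma LR_cnj_shift: "f \<in> LR R \<Longrightarrow> (\<lambda>t. cnj t *s f t) \<in> LR R"
  using AE_circ_norm by (auto intro!: LR_mult[where B = 1] elim!: eventually_mono)

lemma ip_shift: "ip R (U f) g = ip R f (\<lambda>t. cnj t *s g t)"
proof -
  have "AE t in circ. g t = t *s (cnj t *s g t)"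
    using AE_circ_norm by eventually_elim (simp add: vector_smult_assoc norm_1_mult_cnj)
  then have "ip R (U f) g = ip R (\<lambda>t. t *s f t) (\<lambda>t. t *s (cnj t *s g t))"
    unfolding U_def by (intro ip_cong) auto
  also have "\<dots> = ip R f (\<lambda>t. cnj t *s g t)" by (rule ip_unitary[OF AE_circ_norm])
  finally show ?thesis .
qed

lemma normR_cnj_shift: "normR R (\<lambda>t. cnj t *s f t) = normR R f"
  unfolding normR_def by (subst ip_unitary) (use AE_circ_norm in auto)

lemma U_adj_eq: "f \<in> LR R \<Longrightarrow> U_adj R f \<in> LR R \<and> (AE t in circ. U_adj R f t = cnj t *s f t)"
  unfolding U_adj_def by (rule adj_on_eqI[OF closed_subspace_whole LR_cnj_shift]) (simp_all add: ip_shift)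

text \<open>
  The partial sums of the Neumann series lie in \<open>S\<close> and converge to the given solution.
\<close>

lemma fixed_point_in_closed_subspace:
  assumes S: "closed_subspace S" and x: "x \<in> LR R" and g: "g \<in> S" and z: "norm z < 1"
    and B: "\<And>f. f \<in> LR R \<Longrightarrow> B f \<in> LR R" "\<And>f. f \<in> S \<Longrightarrow> B f \<in> S"
    and contr: "\<And>f g. f \<in> LR R \<Longrightarrow> g \<in> LR R \<Longrightarrow> normR R (\<lambda>t. B f t - B g t) \<le> normR R (\<lambda>t. f t - g t)"
    and eq: "AE t in circ. x t = g t + z *s B x t"
  shows "x \<in> S"
proof -
  define s where "s = (\<lambda>k::nat. ((\<lambda>f t. g t + z *s B f t) ^^ k) (\<lambda>t. 0))"
  have s_Suc: "s (Suc k) = (\<lambda>t. g t + z *s B (s k) t)" for k by (simp add: s_def)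
  have sS: "s k \<in> S" for k
  proof (induction k)
    case 0 show ?case using closed_subspace_0[OF S g] by (simp add: s_def)
  next
    case (Suc k) then show ?case unfolding s_Suc
      by (intro closed_subspace_add[OF S g] closed_subspace_scale[OF S] B)
  qed
  have sL: "s k \<in> LR R" for k using sS by (rule closed_subspace_LR[OF S])
  have bound: "normR R (\<lambda>t. x t - s k t) \<le> norm z ^ k * normR R x" for k
  proof (induction k)
    case 0 show ?case by (simp add: s_def)
  next
    case (Suc k)
    have "normR R (\<lambda>t. x t - s (Suc k) t) = normR R (\<lambda>t. z *s (B x t - B (s k) t))"
      by (rule normR_cong) (use eq in eventually_elim, simp add: s_Suc vector_ssub_ldistrib)
    also have "\<dots> = norm z * normR R (\<lambda>t. B x t - B (s k) t)"
      by (intro normR_scale LR_diff B x sL)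
    also have "\<dots> \<le> norm z * normR R (\<lambda>t. x t - s k t)"
      by (intro mult_left_mono contr x sL) simp
    also have "\<dots> \<le> norm z * (norm z ^ k * normR R x)" using Suc by (intro mult_left_mono) auto
    finally show ?case by (simp add: mult.assoc)
  qed
  show ?thesis
  proof (rule closed_subspace_limit[OF S x])
    fix e :: real assume e: "e > 0"
    have "(\<lambda>k. norm z ^ k * normR R x) \<longlonglongrightarrow> 0 * normR R x"
      using z by (intro tendsto_mult_right LIMSEQ_power_zero) simp
    then have "\<forall>\<^sub>F k in sequentially. norm z ^ k * normR R x < e" using e by (intro order_tendstoD(2)) auto
    then obtain k where "norm z ^ k * normR R x < e" by (auto simp: eventually_sequentially)
    then show "\<exists>h\<in>S. normR R (\<lambda>t. x t - h t) < e" using bound[of k] sS[of k] by force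
  qed
qed

text \<open>Pythagoras: the squared norm drops by the squared modulus of the pairing with the unit
  vector \<open>K\<close>.\<close>

lemma normR_remove_component_le:
  assumes f: "f \<in> LR R" and K: "K \<in> LR R" "normR R K = 1"
  shows "normR R (\<lambda>t. f t - ip R f K *s K t) \<le> normR R f"
proof (rule power2_le_imp_le)
  have "(normR R (\<lambda>t. f t - ip R f K *s K t))\<^sup>2
      = (normR R f)\<^sup>2 + (norm (ip R f K))\<^sup>2 - 2 * Re (cnj (ip R f K) * ip R f K)"
    unfolding normR_diff_square[OF f LR_scale[OF K(1)]] normR_scale[OF K(1)] ip_scale_right K(2) by simp
  also have "cnj (ip R f K) * ip R f K = of_real ((norm (ip R f K))\<^sup>2)"
    by (simp only: complex_norm_square mult.commute)
  finally show "(normR R (\<lambda>t. f t - ip R f K *s K t))\<^sup>2 \<le> (normR R f)\<^sup>2" by simp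
qed (rule normR_nonneg[OF f])

text \<open>Modulo H' every s in S is a multiple of the single vector e, and pairing with K, which
  is orthogonal to H', determines the multiple as \<langle>s,K\<rangle> / \<langle>e,K\<rangle>. By
  approximation K is congruent to e / \<langle>e,K\<rangle>, so s - \<langle>s,K\<rangle> K lies in
  H' for s in S, and then also for s in the closure.\<close>

lemma codimension_one:
  assumes SL: "S \<subseteq> LR R" and H': "closed_subspace H'" and e: "e \<in> LR R"
    and split: "\<And>s. s \<in> S \<Longrightarrow> \<exists>c. (\<lambda>t. s t - c *s e t) \<in> H'"
    and K: "K \<in> closure_LR R S" "\<And>h. h \<in> H' \<Longrightarrow> ip R K h = 0" "normR R K = 1" and nz: "ip R e K \<noteq> 0"
    and h: "h \<in> closure_LR R S"
  shows "(\<lambda>t. h t - ip R h K *s K t) \<in> H'"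
proof -
  define \<kappa> where "\<kappa> = ip R e K"
  have KL: "K \<in> LR R" and hL: "h \<in> LR R" using K(1) h by (auto simp: closure_LR_def)
  have IK: "norm (ip R f K) \<le> normR R f" if "f \<in> LR R" for f
    using ip_cauchy_schwarz[OF that KL] K(3) by simp
  obtain c where c: "\<And>s. s \<in> S \<Longrightarrow> (\<lambda>t. s t - c s *s e t) \<in> H'" using split by metis
  have sL: "s \<in> LR R" if "s \<in> S" for s using SL that by auto
  have cs: "ip R s K = c s * \<kappa>" if s: "s \<in> S" for s
  proof -
    have "ip R (\<lambda>t. s t - c s *s e t) K = 0" using ip_0_of_orth[OF K(2) c[OF s]] .
    then show ?thesis using sL[OF s] e KL by (simp add: ip_diff ip_scale LR_scale \<kappa>_def)
  qed
  have IKK: "ip R K K = 1" using ip_self[OF KL] K(3) by simp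
  have Ke: "(\<lambda>t. K t - (1 / \<kappa>) *s e t) \<in> H'"
  proof (rule closed_subspace_limit[OF H' LR_diff[OF KL LR_scale[OF e]]])
    fix \<epsilon> :: real assume eps: "\<epsilon> > 0"
    \<comment> \<open>If K is approximated by s up to \<delta>, the coefficient of e is off by at
      most \<delta> / |\<kappa>|, so the total error is at most \<delta> M.\<close>
    define M where "M = 1 + normR R e / norm \<kappa>"
    have M: "M > 0" unfolding M_def using normR_nonneg[OF e] by (intro add_pos_nonneg) auto
    obtain s where s: "s \<in> S" "normR R (\<lambda>t. K t - s t) < \<epsilon> / M"
      using closure_LR_D[OF K(1) divide_pos_pos[OF eps M]] ..
    define \<delta> where "\<delta> = normR R (\<lambda>t. K t - s t)"
    have "ip R (\<lambda>t. K t - s t) K = 1 - c s * \<kappa>" using KL sL[OF s(1)] cs[OF s(1)] IKK by (simp add: ip_diff)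
    then have "norm (1 - c s * \<kappa>) \<le> \<delta>" using IK[OF LR_diff[OF KL sL[OF s(1)]]] by (simp add: \<delta>_def)
    moreover have "1 / \<kappa> - c s = (1 - c s * \<kappa>) / \<kappa>" using nz by (simp add: \<kappa>_def diff_divide_distrib)
    ultimately have cd: "norm (1 / \<kappa> - c s) \<le> \<delta> / norm \<kappa>" by (simp add: norm_divide divide_right_mono)
    have eqf: "(\<lambda>t. K t - (1 / \<kappa>) *s e t - (s t - c s *s e t)) = (\<lambda>t. (K t - s t) - (1 / \<kappa> - c s) *s e t)"
      by (simp add: fun_eq_iff vector_sub_rdistrib)
    have "normR R (\<lambda>t. K t - (1 / \<kappa>) *s e t - (s t - c s *s e t)) \<le> \<delta> + norm (1 / \<kappa> - c s) * normR R e"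
      unfolding eqf \<delta>_def normR_scale[OF e, symmetric]
      using KL sL[OF s(1)] e by (intro normR_triangle_diff LR_diff LR_scale)
    also have "\<dots> \<le> \<delta> + \<delta> / norm \<kappa> * normR R e"
      using cd normR_nonneg[OF e] by (intro add_left_mono mult_right_mono)
    also have "\<dots> = \<delta> * M" by (simp add: M_def ring_distribs)
    also have "\<dots> < \<epsilon>" using s(2) M by (simp add: \<delta>_def field_simps)
    finally show "\<exists>g\<in>H'. normR R (\<lambda>t. K t - (1 / \<kappa>) *s e t - g t) < \<epsilon>"
      by (intro bexI[OF _ c[OF s(1)]])
  qed
  show ?thesis
  proof (rule closed_subspace_limit[OF H' LR_diff[OF hL LR_scale[OF KL]]])
    fix \<epsilon> :: real assume eps: "\<epsilon> > 0"
    then obtain s where s: "s \<in> S" "normR R (\<lambda>t. h t - s t) < \<epsilon> / 2"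
      using closure_LR_D[OF h half_gt_zero] by blast
    note sL = sL[OF s(1)]
    have hs: "(\<lambda>t. h t - s t) \<in> LR R" by (rule LR_diff[OF hL sL])
    have "(\<lambda>t. (s t - c s *s e t) - ip R s K *s (K t - (1 / \<kappa>) *s e t)) \<in> H'"
      by (intro closed_subspace_diff[OF H' c[OF s(1)]] closed_subspace_scale[OF H'] Ke)
    moreover have "(\<lambda>t. (s t - c s *s e t) - ip R s K *s (K t - (1 / \<kappa>) *s e t)) = (\<lambda>t. s t - ip R s K *s K t)"
      using nz cs[OF s(1)] by (simp add: fun_eq_iff vec_eq_iff \<kappa>_def algebra_simps)
    ultimately have inH: "(\<lambda>t. s t - ip R s K *s K t) \<in> H'" by simp
    \<comment> \<open>Removing the K-component is linear and contractive, so the approximation of h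
      by s is inherited.\<close>
    have eqf: "(\<lambda>t. h t - ip R h K *s K t - (s t - ip R s K *s K t)) = (\<lambda>t. (h t - s t) - ip R (\<lambda>t. h t - s t) K *s K t)"
      using hL sL KL by (simp add: fun_eq_iff vec_eq_iff ip_diff algebra_simps)
    have "normR R (\<lambda>t. h t - ip R h K *s K t - (s t - ip R s K *s K t)) \<le> normR R (\<lambda>t. h t - s t)"
      unfolding eqf by (rule normR_remove_component_le[OF hs KL K(3)])
    also have "\<dots> < \<epsilon>" using s(2) eps by simp
    finally show "\<exists>g\<in>H'. normR R (\<lambda>t. h t - ip R h K *s K t - g t) < \<epsilon>"
      by (intro bexI[OF _ inH])
  qed
qed

end

section \<open>Hardy spaces and the subspaces generated by them\<close>

lemma circ_cnj_powi: "norm t = 1 \<Longrightarrow> cnj (t powi k) = t powi (- k)"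
  and circ_cnj_powi': "norm t = 1 \<Longrightarrow> cnj t powi k = t powi (- k)"
proof -
  assume t: "norm t = 1"
  then have "cnj t = inverse t" using norm_1_mult_cnj inverse_unique by metis
  then show *: "cnj t powi k = t powi (- k)" by (simp add: power_int_inverse power_int_minus)
  show "cnj (t powi k) = t powi (- k)" unfolding * [symmetric] by (cases k rule: int_cases2) (simp_all add: power_int_minus)
qed

lemma circ_powi_add: "norm t = 1 \<Longrightarrow> t powi (j + k) = (t :: complex) powi j * t powi k"
  by (rule power_int_add) auto

lemma circ_cnj_eq_powi: "norm t = 1 \<Longrightarrow> cnj t = t powi (-1)"
  using circ_cnj_powi'[of t 1] by simp

lemma circ_powi_mult: "norm t = 1 \<Longrightarrow> i = j + 1 \<Longrightarrow> (t :: complex) powi i = t * t powi j"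
  using circ_powi_add[of t j 1] by (simp only: power_int_1_right mult.commute)

lemma circ_powi_cnj: "norm t = 1 \<Longrightarrow> i = j - 1 \<Longrightarrow> t powi i = cnj t * t powi j"
  using circ_powi_add[of t j "-1"] circ_cnj_eq_powi[of t] by (simp only: mult.commute uminus_add_conv_diff add_uminus_conv_diff)

lemma measurable_circ_powi [measurable]: "(\<lambda>t. t powi k) \<in> borel_measurable circ"
  by (intro measurable_circ_borel) (cases k rule: int_cases2; simp add: power_int_minus)

section \<open>Square integrable functions on the circle\<close>

lemma L2_add: assumes "f \<in> L2" "g \<in> L2" shows "(\<lambda>t. f t + g t) \<in> L2"
proof -
  have m [measurable]: "f \<in> borel_measurable circ" "g \<in> borel_measurable circ" using assms by (auto simp: L2_def)
  have "integrable circ (\<lambda>t. (norm (f t + g t))\<^sup>2)"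
  proof (rule Bochner_Integration.integrable_bound[of _ "\<lambda>t. 2 * (norm (f t))\<^sup>2 + 2 * (norm (g t))\<^sup>2"])
    show "integrable circ (\<lambda>t. 2 * (norm (f t))\<^sup>2 + 2 * (norm (g t))\<^sup>2)" using assms by (simp add: L2_def)
    have "(norm (f t + g t))\<^sup>2 \<le> 2 * (norm (f t))\<^sup>2 + 2 * (norm (g t))\<^sup>2" for t
    proof -
      have "(norm (f t + g t))\<^sup>2 \<le> (norm (f t) + norm (g t))\<^sup>2" by (intro power_mono norm_triangle_ineq) simp
      also have "\<dots> \<le> 2 * (norm (f t))\<^sup>2 + 2 * (norm (g t))\<^sup>2"
        using sum_squares_bound[of "norm (f t)" "norm (g t)"] by (simp add: power2_sum)
      finally show ?thesis .
    qed
    then show "AE t in circ. norm ((norm (f t + g t))\<^sup>2) \<le> norm (2 * (norm (f t))\<^sup>2 + 2 * (norm (g t))\<^sup>2)" by simp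
  qed measurable
  then show ?thesis by (simp add: L2_def)
qed

lemma L2_mult:
  assumes "f \<in> L2" "\<phi> \<in> borel_measurable circ" "AE t in circ. norm (\<phi> t) \<le> B"
  shows "(\<lambda>t. \<phi> t * f t) \<in> L2"
proof -
  have m [measurable]: "f \<in> borel_measurable circ" "\<phi> \<in> borel_measurable circ" using assms by (auto simp: L2_def)
  have "integrable circ (\<lambda>t. (norm (\<phi> t * f t))\<^sup>2)"
  proof (rule Bochner_Integration.integrable_bound[of _ "\<lambda>t. B\<^sup>2 * (norm (f t))\<^sup>2"])
    show "AE t in circ. norm ((norm (\<phi> t * f t))\<^sup>2) \<le> norm (B\<^sup>2 * (norm (f t))\<^sup>2)"
      using assms(3)
    proof eventually_elim
      case (elim t)
      then have "(norm (\<phi> t))\<^sup>2 \<le> B\<^sup>2" by (intro power_mono) auto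
      then show ?case by (simp add: norm_mult power_mult_distrib mult_right_mono)
    qed
  qed (use assms in \<open>auto simp: L2_def\<close>)
  then show ?thesis by (simp add: L2_def)
qed

lemma L2_scale: "f \<in> L2 \<Longrightarrow> (\<lambda>t. c * f t) \<in> L2"
  by (rule L2_mult[where B = "norm c"]) auto

lemma L2_const: "(\<lambda>t. c) \<in> L2" by (simp add: L2_def)

lemma L2_diff: assumes "f \<in> L2" "g \<in> L2" shows "(\<lambda>t. f t - g t) \<in> L2"
  using L2_add[OF assms(1) L2_scale[OF assms(2), of "-1"]] by simp

lemma L2_powi: "f \<in> L2 \<Longrightarrow> (\<lambda>t. t powi k * f t) \<in> L2"
  by (rule L2_mult[where B = 1]) (use AE_circ_norm in \<open>auto elim!: eventually_mono simp: norm_power_int\<close>)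

lemma L2_shift: "f \<in> L2 \<Longrightarrow> (\<lambda>t. t * f t) \<in> L2"
  and L2_cnj_shift: "f \<in> L2 \<Longrightarrow> (\<lambda>t. cnj t * f t) \<in> L2"
  by (rule L2_mult[where B = 1]; use AE_circ_norm in \<open>auto elim!: eventually_mono intro!: measurable_circ_borel borel_measurable_continuous_onI continuous_intros\<close>)+

lemma L2_integrable_mult:
  assumes "f \<in> L2" "g \<in> L2" shows "integrable circ (\<lambda>t. cnj (f t) * g t)"
proof (rule Bochner_Integration.integrable_bound[of _ "\<lambda>t. (norm (f t))\<^sup>2 + (norm (g t))\<^sup>2"])
  have m [measurable]: "f \<in> borel_measurable circ" "g \<in> borel_measurable circ" using assms by (auto simp: L2_def)
  have [measurable]: "cnj \<in> borel_measurable borel"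
    by (intro borel_measurable_continuous_onI continuous_intros)
  show "(\<lambda>t. cnj (f t) * g t) \<in> borel_measurable circ" by measurable
  have "norm (f t) * norm (g t) \<le> (norm (f t))\<^sup>2 + (norm (g t))\<^sup>2" for t
    using sum_squares_bound[of "norm (f t)" "norm (g t)"] mult_nonneg_nonneg[OF norm_ge_zero[of "f t"] norm_ge_zero[of "g t"]]
    by linarith
  then show "AE t in circ. norm (cnj (f t) * g t) \<le> norm ((norm (f t))\<^sup>2 + (norm (g t))\<^sup>2)"
    by (simp add: norm_mult)
qed (use assms in \<open>simp add: L2_def\<close>)

lemma L2_integrable: "f \<in> L2 \<Longrightarrow> integrable circ f"
  using L2_integrable_mult[OF L2_const[of 1], of f] by simp

lemma L2_integrable_cnj_powi: "f \<in> L2 \<Longrightarrow> integrable circ (\<lambda>t. cnj (t powi k) * f t)"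
  using L2_integrable_mult[OF L2_powi[OF L2_const[of 1], of k], of f] by simp

lemma integral_cnj_powi: "(LINT t|circ. cnj (t powi k)) = (if k = 0 then 1 else 0)"
  unfolding Bochner_Integration.integral_cnj integral_circ_powi by simp

section \<open>Shifts on the two Hardy spaces\<close>

lemma H2_plus_L2: "h \<in> H2_plus \<Longrightarrow> h \<in> L2" and H2_minus_L2: "h \<in> H2_minus \<Longrightarrow> h \<in> L2"
  by (auto simp: H2_plus_def H2_minus_def)

lemma H2_plus_add: "f \<in> H2_plus \<Longrightarrow> g \<in> H2_plus \<Longrightarrow> (\<lambda>t. f t + g t) \<in> H2_plus"
  unfolding H2_plus_def using L2_integrable_cnj_powi by (auto simp: L2_add distrib_left)

lemma H2_plus_scale: "f \<in> H2_plus \<Longrightarrow> (\<lambda>t. c * f t) \<in> H2_plus"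
  unfolding H2_plus_def by (auto simp: L2_scale mult.left_commute[of _ c])

lemma H2_plus_const: "(\<lambda>t. c) \<in> H2_plus"
  unfolding H2_plus_def using integral_cnj_powi by (auto simp: L2_const)

lemma H2_plus_shift:
  assumes h: "h \<in> H2_plus" shows "(\<lambda>t. t * h t) \<in> H2_plus"
proof -
  have "(LINT t|circ. cnj (t powi k) * (t * h t)) = 0" if "k < 0" for k
  proof -
    have "(LINT t|circ. cnj (t powi k) * (t * h t)) = (LINT t|circ. cnj (t powi (k - 1)) * h t)"
    proof (rule integral_circ_AE_cong, use AE_circ_norm in eventually_elim)
      fix t :: complex assume t: "norm t = 1"
      have e: "t powi (- (k - 1)) = t * t powi (- k)" by (rule circ_powi_mult[OF t]) simp
      show "cnj (t powi k) * (t * h t) = cnj (t powi (k - 1)) * h t"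
        unfolding circ_cnj_powi[OF t] e by (simp only: mult_ac)
    qed
    then show ?thesis using h that by (simp add: H2_plus_def)
  qed
  then show ?thesis using L2_shift[OF H2_plus_L2[OF h]] by (simp add: H2_plus_def)
qed

text \<open>The backward shift: the only coefficient that would move to a negative index is the one
  of index 0, and it is removed beforehand. Accordingly the constant matters only for k =
  -1.\<close>

lemma H2_plus_unshift:
  assumes h: "h \<in> H2_plus" shows "(\<lambda>t. cnj t * (h t - (LINT t|circ. h t))) \<in> H2_plus"
proof -
  define c where "c = (LINT t|circ. h t)"
  have "(LINT t|circ. cnj (t powi k) * (cnj t * (h t - c))) = 0" if "k < 0" for k
  proof -
    have "(LINT t|circ. cnj (t powi k) * (cnj t * (h t - c))) = (LINT t|circ. cnj (t powi (k + 1)) * h t - c * cnj (t powi (k + 1)))"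
    proof (rule integral_circ_AE_cong, use AE_circ_norm in eventually_elim)
      fix t :: complex assume t: "norm t = 1"
      have e: "t powi (- (k + 1)) = cnj t * t powi (- k)" by (rule circ_powi_cnj[OF t]) simp
      show "cnj (t powi k) * (cnj t * (h t - c)) = cnj (t powi (k + 1)) * h t - c * cnj (t powi (k + 1))"
        unfolding circ_cnj_powi[OF t] e by (simp add: right_diff_distrib mult_ac)
    qed
    also have "\<dots> = (LINT t|circ. cnj (t powi (k + 1)) * h t) - (LINT t|circ. c * cnj (t powi (k + 1)))"
      using L2_integrable_cnj_powi[OF H2_plus_L2[OF h]] L2_integrable_cnj_powi[OF L2_const[of c]]
      by (intro Bochner_Integration.integral_diff) (simp_all add: mult.commute)
    also have "\<dots> = (LINT t|circ. cnj (t powi (k + 1)) * h t) - c * (if k + 1 = 0 then 1 else 0)"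
      by (simp only: integral_mult_right_zero integral_cnj_powi)
    also have "\<dots> = 0"
    proof (cases "k + 1 = 0")
      case True then show ?thesis by (simp add: c_def)
    next
      case False
      then have "(LINT t|circ. cnj (t powi (k + 1)) * h t) = 0" using h that by (simp add: H2_plus_def)
      then show ?thesis using False by simp
    qed
    finally show ?thesis .
  qed
  then show ?thesis
    using L2_cnj_shift[OF L2_diff[OF H2_plus_L2[OF h] L2_const]] by (simp add: H2_plus_def c_def)
qed

lemma H2_minusI: "f \<in> L2 \<Longrightarrow> (\<And>h. h \<in> H2_plus \<Longrightarrow> (LINT t|circ. cnj (h t) * f t) = 0) \<Longrightarrow> f \<in> H2_minus"
  by (simp add: H2_minus_def)

lemma H2_minus_add: "f \<in> H2_minus \<Longrightarrow> g \<in> H2_minus \<Longrightarrow> (\<lambda>t. f t + g t) \<in> H2_minus"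
  unfolding H2_minus_def using L2_integrable_mult[OF H2_plus_L2] by (auto simp: L2_add distrib_left)

lemma H2_minus_scale: "f \<in> H2_minus \<Longrightarrow> (\<lambda>t. c * f t) \<in> H2_minus"
  unfolding H2_minus_def by (auto simp: L2_scale mult.left_commute[of _ c])

lemma H2_minus_shift:
  assumes h: "h \<in> H2_minus" shows "(\<lambda>t. cnj t * h t) \<in> H2_minus"
proof (rule H2_minusI)
  show "(\<lambda>t. cnj t * h t) \<in> L2" by (rule L2_cnj_shift[OF H2_minus_L2[OF h]])
  fix g assume "g \<in> H2_plus"
  then have "(\<lambda>t. t * g t) \<in> H2_plus" by (rule H2_plus_shift)
  moreover have "\<forall>k\<in>H2_plus. (LINT t|circ. cnj (k t) * h t) = 0" using h by (simp add: H2_minus_def)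
  ultimately have "(LINT t|circ. cnj (t * g t) * h t) = 0" by (rule bspec[rotated])
  then show "(LINT t|circ. cnj (g t) * (cnj t * h t)) = 0" by (simp add: mult_ac)
qed

lemma H2_minus_cnj: "(\<lambda>t. cnj t) \<in> H2_minus"
proof (rule H2_minusI)
  show "(\<lambda>t. cnj t) \<in> L2" using L2_cnj_shift[OF L2_const[of 1]] by simp
  fix g assume g: "g \<in> H2_plus"
  have "(LINT t|circ. cnj (g t) * cnj t) = cnj (LINT t|circ. t * g t)"
    by (simp add: mult.commute flip: Bochner_Integration.integral_cnj)
  also have "(LINT t|circ. t * g t) = (LINT t|circ. cnj (t powi (-1)) * g t)"
  proof (rule integral_circ_AE_cong, use AE_circ_norm in eventually_elim)
    fix t :: complex assume t: "norm t = 1"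
    show "t * g t = cnj (t powi (-1)) * g t" unfolding circ_cnj_powi[OF t] by simp
  qed
  also have "\<dots> = 0" using g by (simp add: H2_plus_def del: power_int_minus1_right)
  finally show "(LINT t|circ. cnj (g t) * cnj t) = 0" by simp
qed

text \<open>\<open>H2_minus\<close> is given by orthogonality to all of \<open>H2_plus\<close>, so
  the test function is split instead of comparing coefficients: g = d + t g1 with d its mean and g1
  its backward shift. The g1 part pairs to 0 with h, and the two terms containing d cancel.\<close>

lemma H2_minus_unshift:
  assumes h: "h \<in> H2_minus" shows "(\<lambda>t. t * h t - (LINT t|circ. t * h t)) \<in> H2_minus"
proof (rule H2_minusI)
  define c where "c = (LINT t|circ. t * h t)"
  have L: "(\<lambda>t. t * h t) \<in> L2" by (rule L2_shift[OF H2_minus_L2[OF h]])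
  show "(\<lambda>t. t * h t - (LINT t|circ. t * h t)) \<in> L2" by (rule L2_diff[OF L L2_const])
  fix g assume g: "g \<in> H2_plus"
  define d where "d = (LINT t|circ. g t)"
  define g1 where "g1 = (\<lambda>t. cnj t * (g t - d))"
  have g1: "g1 \<in> H2_plus" unfolding g1_def d_def by (rule H2_plus_unshift[OF g])
  have "(LINT t|circ. cnj (g t) * (t * h t - c)) = (LINT t|circ. cnj (g1 t) * h t + (cnj d * (t * h t) - c * cnj (g t)))"
  proof (rule integral_circ_AE_cong, use AE_circ_norm in eventually_elim)
    fix t :: complex assume "norm t = 1"
    then have "cnj t * t = 1" by (simp add: norm_1_mult_cnj mult.commute)
    then show "cnj (g t) * (t * h t - c) = cnj (g1 t) * h t + (cnj d * (t * h t) - c * cnj (g t))"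
      by (simp add: g1_def algebra_simps)
  qed
  also have "\<dots> = (LINT t|circ. cnj (g1 t) * h t) + ((LINT t|circ. cnj d * (t * h t)) - (LINT t|circ. c * cnj (g t)))"
    using L2_integrable_mult[OF H2_plus_L2[OF g1] H2_minus_L2[OF h]] L2_integrable[OF L] L2_integrable[OF H2_plus_L2[OF g]]
    by (subst Bochner_Integration.integral_add Bochner_Integration.integral_diff; simp)+
  also have "(LINT t|circ. cnj (g1 t) * h t) = 0" using h g1 by (simp add: H2_minus_def)
  also have "(LINT t|circ. cnj d * (t * h t)) = cnj d * c" by (simp add: c_def)
  also have "(LINT t|circ. c * cnj (g t)) = c * cnj d" by (simp add: d_def)
  finally show "(LINT t|circ. cnj (g t) * (t * h t - (LINT t|circ. t * h t))) = 0" by (simp add: c_def)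
qed

section \<open>The subspaces generated by weighted pairs of Hardy functions\<close>

context reflection_coefficient begin

definition generators :: "int \<Rightarrow> int \<Rightarrow> vfun set" where
  "generators n m = {(\<lambda>t. WR R t *v vector [t powi n * hp t, cnj t powi m * hm t]) | hp hm.
        hp \<in> H2_plus \<and> hm \<in> H2_minus}"

lemma generatorsI:
  "hp \<in> H2_plus \<Longrightarrow> hm \<in> H2_minus \<Longrightarrow> (\<lambda>t. WR R t *v vector [t powi n * hp t, cnj t powi m * hm t]) \<in> generators n m"
  unfolding generators_def by blast

lemma Hc_closure: "Hc R n m = closure_LR R (generators n m)"
  by (simp add: Hc_def generators_def)

lemma WR_mult: "WR R t *v vector [a, b] = vector [a + cnj (R t) * b, R t * a + b]"
  by (simp add: vec_eq_iff forall_2 WR_def matrix_vector_mult_def sum_2)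

text \<open>For f = W (a,b) the second coordinate of the triangular form is f_2 - R f_1 = b (1 -
  |R|^2), which cancels the singular denominator; the rest is bounded by |a| + |b|.\<close>

lemma LR_WR_mult:
  assumes "a \<in> L2" "b \<in> L2" shows "(\<lambda>t. WR R t *v vector [a t, b t]) \<in> LR R"
proof -
  define f where "f = (\<lambda>t. WR R t *v vector [a t, b t])"
  have m [measurable]: "a \<in> borel_measurable circ" "b \<in> borel_measurable circ" using assms by (auto simp: L2_def)
  have [measurable]: "cnj \<in> borel_measurable borel"
    by (intro borel_measurable_continuous_onI continuous_intros)
  have fm: "f \<in> borel_measurable circ" unfolding measurable_vfun_iff f_def WR_mult by simp
  have "integrable circ (gram R f f)"
  proof (rule Bochner_Integration.integrable_bound[of _ "\<lambda>t. 2 * (norm (a t))\<^sup>2 + 3 * (norm (b t))\<^sup>2"])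
    show "integrable circ (\<lambda>t. 2 * (norm (a t))\<^sup>2 + 3 * (norm (b t))\<^sup>2)" using assms by (simp add: L2_def)
    show "gram R f f \<in> borel_measurable circ" using measurable_gram[OF fm fm] by simp
    show "AE t in circ. norm (gram R f f t) \<le> norm (2 * (norm (a t))\<^sup>2 + 3 * (norm (b t))\<^sup>2)"
      using R_less_1
    proof eventually_elim
      case (elim t)
      define d where "d = 1 - (norm (R t))\<^sup>2"
      have d: "d > 0" "d \<le> 1" using elim by (simp_all add: d_def power_less_one_iff)
      have "f t $ 2 - R t * f t $ 1 = b t * of_real d"
        unfolding f_def WR_mult d_def of_real_diff complex_norm_square by (simp add: algebra_simps)
      then have n2: "(norm (f t $ 2 - R t * f t $ 1))\<^sup>2 / d = (norm (b t))\<^sup>2 * d"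
        using d by (simp add: norm_mult power_mult_distrib power2_eq_square)
      have "norm (f t $ 1) \<le> norm (a t) + norm (R t) * norm (b t)"
        unfolding f_def WR_mult using norm_triangle_ineq[of "a t" "cnj (R t) * b t"] by (simp add: norm_mult)
      also have "\<dots> \<le> norm (a t) + norm (b t)" using elim by (intro add_left_mono mult_left_le_one_le) auto
      finally have "(norm (f t $ 1))\<^sup>2 \<le> (norm (a t) + norm (b t))\<^sup>2" by (intro power_mono) auto
      also have "\<dots> \<le> 2 * (norm (a t))\<^sup>2 + 2 * (norm (b t))\<^sup>2"
        using sum_squares_bound[of "norm (a t)" "norm (b t)"] by (simp add: power2_sum)
      finally have n1: "(norm (f t $ 1))\<^sup>2 \<le> 2 * (norm (a t))\<^sup>2 + 2 * (norm (b t))\<^sup>2" .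
      have "(norm (b t))\<^sup>2 * d \<le> (norm (b t))\<^sup>2 * 1" using d by (intro mult_left_mono) auto
      moreover have "0 \<le> (norm (b t))\<^sup>2 * d" using d by simp
      ultimately show ?case
        unfolding gram_self norm_of_real d_def[symmetric] n2 using n1 by simp
    qed
  qed
  then show ?thesis using fm by (simp add: LR_iff f_def)
qed

lemma generators_LR: "generators n m \<subseteq> LR R"
proof
  fix f assume "f \<in> generators n m"
  then obtain hp hm where f: "f = (\<lambda>t. WR R t *v vector [t powi n * hp t, cnj t powi m * hm t])"
    and h: "hp \<in> H2_plus" "hm \<in> H2_minus" by (auto simp: generators_def)
  have "(\<lambda>t. WR R t *v vector [t powi n * hp t, t powi (- m) * hm t]) \<in> LR R"
    by (intro LR_WR_mult L2_powi H2_plus_L2[OF h(1)] H2_minus_L2[OF h(2)])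
  then show "f \<in> LR R"
    by (rule LR_cong) (use AE_circ_norm in eventually_elim, simp add: f circ_cnj_powi')
qed

lemma closed_subspace_Hc: "closed_subspace (Hc R n m)"
  unfolding Hc_closure
proof (rule closed_subspace_closure[OF generators_LR])
  fix f g assume "f \<in> generators n m" "g \<in> generators n m"
  then obtain hp hm gp gm where f: "f = (\<lambda>t. WR R t *v vector [t powi n * hp t, cnj t powi m * hm t])"
      "hp \<in> H2_plus" "hm \<in> H2_minus"
    and g: "g = (\<lambda>t. WR R t *v vector [t powi n * gp t, cnj t powi m * gm t])"
      "gp \<in> H2_plus" "gm \<in> H2_minus" unfolding generators_def by blast
  have "(\<lambda>t. f t + g t) = (\<lambda>t. WR R t *v vector [t powi n * (hp t + gp t), cnj t powi m * (hm t + gm t)])"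
    by (simp add: f g fun_eq_iff WR_mult vec_eq_iff forall_2 algebra_simps)
  then show "(\<lambda>t. f t + g t) \<in> generators n m"
    using generatorsI[OF H2_plus_add[OF f(2) g(2)] H2_minus_add[OF f(3) g(3)]] by simp
next
  fix f c assume "f \<in> generators n m"
  then obtain hp hm where f: "f = (\<lambda>t. WR R t *v vector [t powi n * hp t, cnj t powi m * hm t])"
      "hp \<in> H2_plus" "hm \<in> H2_minus" unfolding generators_def by blast
  have "(\<lambda>t. c *s f t) = (\<lambda>t. WR R t *v vector [t powi n * (c * hp t), cnj t powi m * (c * hm t)])"
    by (simp add: f fun_eq_iff WR_mult vec_eq_iff forall_2 algebra_simps)
  then show "(\<lambda>t. c *s f t) \<in> generators n m"
    using generatorsI[OF H2_plus_scale[OF f(2), of c] H2_minus_scale[OF f(3), of c]] by simp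
qed

lemma Hc_LR: "f \<in> Hc R n m \<Longrightarrow> f \<in> LR R"
  by (rule closed_subspace_LR[OF closed_subspace_Hc])

lemma HcI:
  assumes "hp \<in> H2_plus" "hm \<in> H2_minus"
    and "\<And>t. norm t = 1 \<Longrightarrow> f t = WR R t *v vector [t powi n * hp t, t powi (- m) * hm t]"
  shows "f \<in> Hc R n m"
proof (rule closed_subspace_cong[OF closed_subspace_Hc])
  have "(\<lambda>t. WR R t *v vector [t powi n * hp t, cnj t powi m * hm t]) \<in> generators n m"
    by (rule generatorsI[OF assms(1,2)])
  then show "(\<lambda>t. WR R t *v vector [t powi n * hp t, cnj t powi m * hm t]) \<in> Hc R n m"
    using closure_LR_superset[OF generators_LR] unfolding Hc_closure by blast
  show "AE t in circ. WR R t *v vector [t powi n * hp t, cnj t powi m * hm t] = f t"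
    using AE_circ_norm by eventually_elim (simp add: assms(3) circ_cnj_powi')
qed

text \<open>Multiplication by a unimodular function is isometric, so an inclusion checked on
  generators extends to their closure. With \<phi> = 1 this yields plain inclusions between the
  subspaces.\<close>

lemma Hc_mult_closed:
  assumes H': "closed_subspace H'" and \<phi>: "\<phi> \<in> borel_measurable circ" "AE t in circ. norm (\<phi> t) = 1"
    and gen: "\<And>s. s \<in> generators n m \<Longrightarrow> (\<lambda>t. \<phi> t *s s t) \<in> H'" and f: "f \<in> Hc R n m"
  shows "(\<lambda>t. \<phi> t *s f t) \<in> H'"
proof (rule closed_subspace_limit[OF H'])
  have fL: "f \<in> LR R" by (rule Hc_LR[OF f])
  show "(\<lambda>t. \<phi> t *s f t) \<in> LR R"
    by (rule LR_mult[OF fL \<phi>(1), of 1]) (use \<phi>(2) in eventually_elim, simp)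
  fix e :: real assume "e > 0"
  then obtain s where s: "s \<in> generators n m" "normR R (\<lambda>t. f t - s t) < e"
    using closure_LR_D f unfolding Hc_closure by blast
  have e: "(\<lambda>t. \<phi> t *s f t - \<phi> t *s s t) = (\<lambda>t. \<phi> t *s (f t - s t))" by (simp add: vector_ssub_ldistrib)
  have "normR R (\<lambda>t. \<phi> t *s f t - \<phi> t *s s t) = normR R (\<lambda>t. f t - s t)"
    unfolding e normR_def ip_unitary[OF \<phi>(2)] ..
  then show "\<exists>g\<in>H'. normR R (\<lambda>t. \<phi> t *s f t - g t) < e"
    using s(2) by (intro bexI[OF _ gen[OF s(1)]]) simp
qed

lemma U_Hc: "f \<in> Hc R n (m + 1) \<Longrightarrow> U f \<in> Hc R (n + 1) m"
  unfolding U_def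
proof (erule Hc_mult_closed[OF closed_subspace_Hc _ AE_circ_norm, rotated -1])
  fix s assume "s \<in> generators n (m + 1)"
  then obtain hp hm where f: "s = (\<lambda>t. WR R t *v vector [t powi n * hp t, cnj t powi (m + 1) * hm t])"
      "hp \<in> H2_plus" "hm \<in> H2_minus" unfolding generators_def by blast
  show "(\<lambda>t. t *s s t) \<in> Hc R (n + 1) m"
  proof (rule HcI[OF f(2,3)])
    fix t :: complex assume t: "norm t = 1"
    have e: "t powi (n + 1) = t * t powi n" "t powi (- m) = t * t powi (- (m + 1))"
      by (rule circ_powi_mult[OF t]; simp)+
    show "t *s s t = WR R t *v vector [t powi (n + 1) * hp t, t powi - m * hm t]"
      unfolding f(1) circ_cnj_powi'[OF t] e by (simp add: WR_mult vec_eq_iff forall_2 distrib_left mult_ac)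
  qed
qed measurable

lemma Hc_cnj_shift: "f \<in> Hc R (n + 1) m \<Longrightarrow> (\<lambda>t. cnj t *s f t) \<in> Hc R n (m + 1)"
proof (erule Hc_mult_closed[OF closed_subspace_Hc, rotated -1])
  show "AE t in circ. norm (cnj t) = 1" using AE_circ_norm by simp
  fix s assume "s \<in> generators (n + 1) m"
  then obtain hp hm where f: "s = (\<lambda>t. WR R t *v vector [t powi (n + 1) * hp t, cnj t powi m * hm t])"
      "hp \<in> H2_plus" "hm \<in> H2_minus" unfolding generators_def by blast
  show "(\<lambda>t. cnj t *s s t) \<in> Hc R n (m + 1)"
  proof (rule HcI[OF f(2,3)])
    fix t :: complex assume t: "norm t = 1"
    have e: "t powi n = cnj t * t powi (n + 1)" "t powi (- (m + 1)) = cnj t * t powi (- m)"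
      by (rule circ_powi_cnj[OF t]; simp)+
    show "cnj t *s s t = WR R t *v vector [t powi n * hp t, t powi - (m + 1) * hm t]"
      unfolding f(1) circ_cnj_powi'[OF t] e by (simp add: WR_mult vec_eq_iff forall_2 distrib_left mult_ac)
  qed
qed measurable

lemma Hc_mono:
  assumes "\<And>s. s \<in> generators n' m' \<Longrightarrow> s \<in> Hc R n m" and f: "f \<in> Hc R n' m'"
  shows "f \<in> Hc R n m"
  using Hc_mult_closed[OF closed_subspace_Hc, of "\<lambda>_. 1" n' m' n m f] assms by simp

lemma Hc_Suc_left: "f \<in> Hc R (n + 1) m \<Longrightarrow> f \<in> Hc R n m"
proof (erule Hc_mono[rotated])
  fix s assume "s \<in> generators (n + 1) m"
  then obtain hp hm where f: "s = (\<lambda>t. WR R t *v vector [t powi (n + 1) * hp t, cnj t powi m * hm t])"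
      "hp \<in> H2_plus" "hm \<in> H2_minus" unfolding generators_def by blast
  show "s \<in> Hc R n m"
  proof (rule HcI[OF H2_plus_shift[OF f(2)] f(3)])
    fix t :: complex assume t: "norm t = 1"
    have e: "t powi (n + 1) = t * t powi n" by (rule circ_powi_mult[OF t]) simp
    show "s t = WR R t *v vector [t powi n * (t * hp t), t powi - m * hm t]"
      unfolding f(1) circ_cnj_powi'[OF t] e by (simp only: mult_ac)
  qed
qed

lemma Hc_Suc_right: "f \<in> Hc R n (m + 1) \<Longrightarrow> f \<in> Hc R n m"
proof (erule Hc_mono[rotated])
  fix s assume "s \<in> generators n (m + 1)"
  then obtain hp hm where f: "s = (\<lambda>t. WR R t *v vector [t powi n * hp t, cnj t powi (m + 1) * hm t])"
      "hp \<in> H2_plus" "hm \<in> H2_minus" unfolding generators_def by blast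
  show "s \<in> Hc R n m"
  proof (rule HcI[OF f(2) H2_minus_shift[OF f(3)]])
    fix t :: complex assume t: "norm t = 1"
    have e: "t powi (- (m + 1)) = cnj t * t powi (- m)" by (rule circ_powi_cnj[OF t]) simp
    show "s t = WR R t *v vector [t powi n * hp t, t powi - m * (cnj t * hm t)]"
      unfolding f(1) circ_cnj_powi'[OF t] e by (simp only: mult_ac)
  qed
qed

lemma left_generator_Hc: "(\<lambda>t. t powi n *s vector [1, R t]) \<in> Hc R n m"
  by (rule HcI[OF H2_plus_const[of 1] H2_minus_scale[OF H2_minus_cnj, of 0]])
     (simp add: WR_mult vec_eq_iff forall_2)

text \<open>The exponent is m + 1 because the leading element of \<open>H2_minus\<close> is cnj t
  and not 1.\<close>

lemma right_generator_Hc: "(\<lambda>t. cnj t powi (m + 1) *s vector [cnj (R t), 1]) \<in> Hc R n m"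
proof (rule HcI[OF H2_plus_const[of 0] H2_minus_cnj])
  fix t :: complex assume t: "norm t = 1"
  have e: "t powi (- (m + 1)) = cnj t * t powi (- m)" by (rule circ_powi_cnj[OF t]) simp
  show "cnj t powi (m + 1) *s vector [cnj (R t), 1] = WR R t *v vector [t powi n * 0, t powi - m * cnj t]"
    unfolding circ_cnj_powi'[OF t] e by (simp add: WR_mult vec_eq_iff forall_2)
qed

text \<open>On generators, hp minus its mean is t times an element of \<open>H2_plus\<close>, so
  \<open>t powi n *s vector [1, R t]\<close> spans the generators modulo the smaller subspace. Its
  pairing with \<open>K\<close> is nonzero by the normalization in \<open>is_K\<close>.\<close>

lemma is_K_remove_component:
  assumes K: "is_K R n m K" and h: "h \<in> Hc R n m"
  shows "(\<lambda>t. h t - ip R h K *s K t) \<in> Hc R (n + 1) m"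
proof (rule codimension_one[OF generators_LR closed_subspace_Hc Hc_LR[OF left_generator_Hc]])
  fix s assume "s \<in> generators n m"
  then obtain hp hm where s: "s = (\<lambda>t. WR R t *v vector [t powi n * hp t, cnj t powi m * hm t])"
      "hp \<in> H2_plus" "hm \<in> H2_minus" unfolding generators_def by blast
  define c where "c = (LINT t|circ. hp t)"
  have "(\<lambda>t. s t - c *s (t powi n *s vector [1, R t])) \<in> Hc R (n + 1) m"
  proof (rule HcI[OF H2_plus_unshift[OF s(2)] s(3)], fold c_def)
    fix t :: complex assume t: "norm t = 1"
    have e: "t powi (n + 1) * (cnj t * (hp t - c)) = t powi n * (hp t - c)"
      unfolding circ_powi_cnj[OF t, of n "n + 1", simplified] by (simp only: mult_ac)
    show "s t - c *s (t powi n *s vector [1, R t]) = WR R t *v vector [t powi (n + 1) * (cnj t * (hp t - c)), t powi - m * hm t]"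
      unfolding s(1) circ_cnj_powi'[OF t] e by (simp add: WR_mult vec_eq_iff forall_2 algebra_simps)
  qed
  then show "\<exists>c. (\<lambda>t. s t - c *s (t powi n *s vector [1, R t])) \<in> Hc R (n + 1) m" by blast
qed (use K h in \<open>auto simp: is_K_def Hc_closure Let_def\<close>)

lemma is_Kt_remove_component:
  assumes K: "is_Kt R n m K" and h: "h \<in> Hc R n m"
  shows "(\<lambda>t. h t - ip R h K *s K t) \<in> Hc R n (m + 1)"
proof (rule codimension_one[OF generators_LR closed_subspace_Hc Hc_LR[OF right_generator_Hc[of m n]]])
  fix s assume "s \<in> generators n m"
  then obtain hp hm where s: "s = (\<lambda>t. WR R t *v vector [t powi n * hp t, cnj t powi m * hm t])"
      "hp \<in> H2_plus" "hm \<in> H2_minus" unfolding generators_def by blast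
  \<comment> \<open>This is the coefficient of cnj t in hm; once it is removed, multiplication by t
    stays in \<open>H2_minus\<close>.\<close>
  define c where "c = (LINT t|circ. t * hm t)"
  have "(\<lambda>t. s t - c *s (cnj t powi (m + 1) *s vector [cnj (R t), 1])) \<in> Hc R n (m + 1)"
  proof (rule HcI[OF s(2) H2_minus_unshift[OF s(3)]], fold c_def)
    fix t :: complex assume t: "norm t = 1"
    have m: "t powi (- m) = t * t powi (- (m + 1))" by (rule circ_powi_mult[OF t]) simp
    have e: "t powi (- (m + 1)) * (t * hm t - c) = t powi (- m) * hm t - c * t powi (- (m + 1))"
      unfolding m by (simp only: left_diff_distrib right_diff_distrib mult_ac)
    show "s t - c *s (cnj t powi (m + 1) *s vector [cnj (R t), 1]) = WR R t *v vector [t powi n * hp t, t powi - (m + 1) * (t * hm t - c)]"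
      unfolding circ_cnj_powi'[OF t] s(1) e by (simp add: WR_mult vec_eq_iff forall_2 algebra_simps)
  qed
  then show "\<exists>c. (\<lambda>t. s t - c *s (cnj t powi (m + 1) *s vector [cnj (R t), 1])) \<in> Hc R n (m + 1)" by blast
next
  \<comment> \<open>The normalization of \<open>Kt\<close> pairs in the opposite order; nonvanishing
    passes to the conjugate.\<close>
  have "ip R K (\<lambda>t. cnj t powi (m + 1) *s vector [cnj (R t), 1]) \<noteq> 0"
    using K by (auto simp: is_Kt_def Let_def)
  then show "ip R (\<lambda>t. cnj t powi (m + 1) *s vector [cnj (R t), 1]) K \<noteq> 0"
    unfolding ip_cnj[of _ K] by simp
qed (use K h in \<open>auto simp: is_Kt_def Hc_closure Let_def\<close>)

end

section \<open>The characteristic functions\<close>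

context reflection_coefficient begin

lemma AE_cauchy_kernel_bounded:
  assumes "norm z < 1"
  shows "AE t in circ. norm (1 / (1 - z * cnj t)) \<le> 1 / (1 - norm z) \<and> 1 - z * cnj t \<noteq> 0"
  using AE_circ_norm
proof eventually_elim
  case (elim t)
  have "1 - norm z \<le> norm (1 - z * cnj t)"
    using norm_triangle_ineq2[of 1 "z * cnj t"] elim by (simp add: norm_mult)
  then show ?case using assms by (auto simp: norm_divide intro!: divide_left_mono mult_pos_pos)
qed

lemma measurable_cauchy_kernel: "(\<lambda>t. 1 / (1 - z * cnj t)) \<in> borel_measurable circ"
  by measurable

lemma LR_cauchy_kernel:
  assumes "f \<in> LR R" "norm z < 1" shows "(\<lambda>t. (1 / (1 - z * cnj t)) *s f t) \<in> LR R"
  by (rule LR_mult[OF assms(1) measurable_cauchy_kernel, of _ "1 / (1 - norm z)"]) (use AE_cauchy_kernel_bounded[OF assms(2)] in eventually_elim, simp)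

text \<open>Vectors obtained by dividing by 1 - z cnj t are thus paired through scalar Cauchy
  transforms of pointwise inner products; this turns the resolvent equations into scalar
  identities.\<close>

lemma ip_cauchy_kernel:
  "ip R (\<lambda>t. (1 / (1 - z * cnj t)) *s f t) g = cauchy_transform (gram R f g) z"
  unfolding ip_eq cauchy_transform_def gram_linear by simp

lemma cauchy_transform_diff:
  assumes "integrable circ u" "integrable circ v" "norm z < 1"
  shows "cauchy_transform (\<lambda>t. u t - c * v t) z = cauchy_transform u z - c * cauchy_transform v z"
proof -
  have "(u t - c * v t) / (1 - z * cnj t) = u t / (1 - z * cnj t) - c * (v t / (1 - z * cnj t))" for t
    by (simp add: diff_divide_distrib)
  then show ?thesis unfolding cauchy_transform_def
    using circ_cauchy_kernel_sums(2)[OF assms(1,3)] circ_cauchy_kernel_sums(2)[OF assms(2,3)]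
    by (simp only: Bochner_Integration.integral_diff integrable_mult_right integral_mult_right_zero)
qed

lemma integrable_circ_cnj_mult: "integrable circ u \<Longrightarrow> integrable circ (\<lambda>t. cnj t * u t)"
proof (rule Bochner_Integration.integrable_bound[of _ u])
  assume u: "integrable circ u"
  then show "(\<lambda>t. cnj t * u t) \<in> borel_measurable circ" by measurable
  show "AE t in circ. norm (cnj t * u t) \<le> norm (u t)" using AE_circ_norm by eventually_elim (simp add: norm_mult)
qed

text \<open>z cnj t / (1 - z cnj t) = 1 / (1 - z cnj t) - 1.\<close>

lemma cauchy_transform_cnj_mult:
  assumes u: "integrable circ u" and z: "norm z < 1"
  shows "z * cauchy_transform (\<lambda>t. cnj t * u t) z = cauchy_transform u z - (LINT t|circ. u t)"
proof -
  have "z * cauchy_transform (\<lambda>t. cnj t * u t) z = (LINT t|circ. z * (cnj t * u t / (1 - z * cnj t)))"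
    unfolding cauchy_transform_def by (rule integral_mult_right_zero[symmetric])
  also have "\<dots> = (LINT t|circ. u t / (1 - z * cnj t) - u t)"
  proof (rule integral_circ_AE_cong)
    show "AE t in circ. z * (cnj t * u t / (1 - z * cnj t)) = u t / (1 - z * cnj t) - u t"
      using AE_cauchy_kernel_bounded[OF z] by eventually_elim (simp add: field_simps)
  qed
  also have "\<dots> = cauchy_transform u z - (LINT t|circ. u t)"
    unfolding cauchy_transform_def using circ_cauchy_kernel_sums(2)[OF u z] u by (rule Bochner_Integration.integral_diff)
  finally show ?thesis .
qed

lemma gram_self_real:
  shows "AE t in circ. Re (gram R f f t) \<ge> 0 \<and> Im (gram R f f t) = 0"
  using R_less_1
proof eventually_elim
  case (elim t)
  have "Im (gram R f f t) = 0" unfolding gram_self by simp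
  then show ?case using gram_self_nonneg[of R t f] elim by simp
qed

lemma cauchy_transform_gram_self:
  assumes f: "f \<in> LR R" "normR R f = 1" and z: "norm z < 1"
  shows "Re (cauchy_transform (gram R f f) z) \<ge> 1 / 2"
proof -
  have "(LINT t|circ. gram R f f t) = 1" using ip_self[OF f(1)] f(2) by (simp add: ip_eq)
  then show ?thesis
    using cauchy_transform_nonneg_Re[OF integrable_gram[OF f(1,1)] gram_self_real z] by simp
qed

end

section \<open>The two colligations and their resolvents\<close>

locale defect_vectors = reflection_coefficient +
  fixes n m :: int and K Kt :: vfun
  assumes K: "is_K R n m K" and Kt: "is_Kt R n m Kt"
begin

lemma K_Hc: "K \<in> Hc R n m" and K_orth: "h \<in> Hc R (n + 1) m \<Longrightarrow> ip R K h = 0" and K_norm: "normR R K = 1"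
  and Kt_Hc: "Kt \<in> Hc R n m" and Kt_orth: "h \<in> Hc R n (m + 1) \<Longrightarrow> ip R Kt h = 0" and Kt_norm: "normR R Kt = 1"
  using K Kt by (auto simp: is_K_def is_Kt_def)

lemma K_LR: "K \<in> LR R" and Kt_LR: "Kt \<in> LR R"
  using K_Hc Kt_Hc by (auto intro: Hc_LR)

lemma K_orth': "h \<in> Hc R (n + 1) m \<Longrightarrow> ip R h K = 0" and Kt_orth': "h \<in> Hc R n (m + 1) \<Longrightarrow> ip R h Kt = 0"
  using ip_cnj[of h K] ip_cnj[of h Kt] K_orth Kt_orth by simp_all

lemma ip_K_K: "ip R K K = 1" and ip_Kt_Kt: "ip R Kt Kt = 1"
  using ip_self[OF K_LR] ip_self[OF Kt_LR] K_norm Kt_norm by simp_all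

lemma A0_eq:
  assumes h: "h \<in> Hc R n m"
  shows "AE t in circ. A0 R n m h t = U (\<lambda>t. h t - ip R h Kt *s Kt t) t"
proof -
  have "ip R (\<lambda>t. h t - (h t - ip R h Kt *s Kt t)) g = 0" if "g \<in> Hc R n (m + 1)" for g
    using Kt_orth[OF that] by (simp add: ip_scale)
  then have "AE t in circ. proj R (Hc R n (m + 1)) h t = h t - ip R h Kt *s Kt t"
    using proj_eqI[OF closed_subspace_Hc Hc_LR[OF h] is_Kt_remove_component[OF Kt h]] by blast
  then show ?thesis by eventually_elim (simp add: A0_def U_def)
qed

text \<open>A0 h equals U h' with h' in H_{n,m+1}, and U h' lies in H_{n+1,m}, to which
  \<open>K\<close> is orthogonal; so g may lose its \<open>K\<close>-component before U is moved
  across the pairing. The result lies in H_{n,m+1}, to which \<open>Kt\<close> is orthogonal, so h'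
  may be replaced by h again.\<close>

lemma A0_adjoint:
  assumes g: "g \<in> Hc R n m"
  shows "AE t in circ. adj_on R (Hc R n m) (A0 R n m) g t = cnj t *s (g t - ip R g K *s K t)"
proof -
  define k where "k = (\<lambda>t. cnj t *s (g t - ip R g K *s K t))"
  have g': "(\<lambda>t. g t - ip R g K *s K t) \<in> Hc R (n + 1) m" by (rule is_K_remove_component[OF K g])
  then have k': "k \<in> Hc R n (m + 1)" unfolding k_def by (rule Hc_cnj_shift)
  have "ip R (A0 R n m h) g = ip R h k" if h: "h \<in> Hc R n m" for h
  proof -
    define h' where "h' = (\<lambda>t. h t - ip R h Kt *s Kt t)"
    have h': "h' \<in> Hc R n (m + 1)" unfolding h'_def by (rule is_Kt_remove_component[OF Kt h])
    have Uh': "U h' \<in> Hc R (n + 1) m" by (rule U_Hc[OF h'])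
    have "ip R (A0 R n m h) g = ip R (U h') g"
      by (rule ip_cong) (use A0_eq[OF h] in \<open>auto simp: h'_def\<close>)
    also have "\<dots> = ip R (U h') (\<lambda>t. g t - ip R g K *s K t)"
      using Hc_LR[OF g] K_LR Hc_LR[OF Uh'] K_orth'[OF Uh'] by (simp add: ip_diff_right LR_scale ip_scale_right)
    also have "\<dots> = ip R h' k" unfolding k_def by (rule ip_shift)
    also have "\<dots> = ip R h k - ip R h Kt * ip R Kt k"
      unfolding h'_def using Hc_LR[OF h] Kt_LR Hc_LR[OF k'] by (simp add: ip_diff LR_scale ip_scale)
    also have "\<dots> = ip R h k" using Kt_orth[OF k'] by simp
    finally show ?thesis .
  qed
  then show ?thesis using adj_on_eqI[OF closed_subspace_Hc Hc_Suc_right[OF k']] unfolding k_def by blast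
qed

lemma orth_Hc: "closed_subspace (orth R (Hc R n m))"
  by (rule closed_subspace_orth) (auto intro: Hc_LR)

lemma orth_HcD: "f \<in> orth R (Hc R n m) \<Longrightarrow> f \<in> LR R" "f \<in> orth R (Hc R n m) \<Longrightarrow> h \<in> Hc R n m \<Longrightarrow> ip R f h = 0"
  by (auto simp: orth_def)

text \<open>U maps H_{n,m+1} into H_{n+1,m}, so cnj t f is orthogonal to H_{n,m+1}, and only its
  \<open>Kt\<close>-component in H remains to be removed. Orthogonality of f to the smaller space
  H_{n+1,m} is assumed so that f = K is covered along with the vectors orthogonal to H.\<close>

lemma cnj_shift_remove_component:
  assumes f: "f \<in> LR R" "\<And>h. h \<in> Hc R (n + 1) m \<Longrightarrow> ip R f h = 0"
  defines "g \<equiv> (\<lambda>t. cnj t *s f t)"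
  shows "(\<lambda>t. g t - ip R g Kt *s Kt t) \<in> orth R (Hc R n m)"
    and "AE t in circ. proj R (orth R (Hc R n m)) (U_adj R f) t = g t - ip R g Kt *s Kt t"
proof -
  have g: "g \<in> LR R" unfolding g_def by (rule LR_cnj_shift[OF f(1)])
  have "ip R (\<lambda>t. g t - ip R g Kt *s Kt t) h = 0" if h: "h \<in> Hc R n m" for h
  proof -
    define h' where "h' = (\<lambda>t. h t - ip R h Kt *s Kt t)"
    have h': "h' \<in> Hc R n (m + 1)" unfolding h'_def by (rule is_Kt_remove_component[OF Kt h])
    have "ip R g h' = cnj (ip R (U h') f)" unfolding g_def ip_shift by (rule ip_cnj)
    also have "\<dots> = ip R f (U h')" by (rule ip_cnj[symmetric])
    also have "\<dots> = 0" by (rule f(2)[OF U_Hc[OF h']])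
    finally have "ip R g h' = 0" .
    then have "ip R g h = cnj (ip R h Kt) * ip R g Kt"
      unfolding h'_def using g Hc_LR[OF h] Kt_LR by (simp add: ip_diff_right LR_scale ip_scale_right)
    also have "cnj (ip R h Kt) = ip R Kt h" by (rule ip_cnj[symmetric])
    finally show ?thesis using g Hc_LR[OF h] Kt_LR by (simp add: ip_diff LR_scale ip_scale)
  qed
  then show o: "(\<lambda>t. g t - ip R g Kt *s Kt t) \<in> orth R (Hc R n m)"
    using LR_diff[OF g LR_scale[OF Kt_LR]] by (simp add: orth_def)
  have ae: "AE t in circ. U_adj R f t = g t" and Uf: "U_adj R f \<in> LR R"
    using U_adj_eq[OF f(1)] by (simp_all add: g_def)
  have "ip R (\<lambda>t. U_adj R f t - (g t - ip R g Kt *s Kt t)) h = 0" if h: "h \<in> orth R (Hc R n m)" for h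
  proof -
    have "ip R (\<lambda>t. U_adj R f t - (g t - ip R g Kt *s Kt t)) h = ip R (\<lambda>t. ip R g Kt *s Kt t) h"
      by (rule ip_cong) (use ae in eventually_elim, simp, simp)
    also have "\<dots> = ip R g Kt * cnj (ip R h Kt)" by (simp only: ip_scale ip_cnj[of Kt h])
    also have "\<dots> = 0" using orth_HcD(2)[OF h Kt_Hc] by simp
    finally show ?thesis .
  qed
  then show "AE t in circ. proj R (orth R (Hc R n m)) (U_adj R f) t = g t - ip R g Kt *s Kt t"
    using proj_eqI[OF orth_Hc Uf o] by blast
qed

lemma A_perp_eq:
  assumes "f \<in> orth R (Hc R n m)"
  shows "AE t in circ. A_perp R n m f t = cnj t *s f t - ip R (\<lambda>t. cnj t *s f t) Kt *s Kt t"
  unfolding A_perp_def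
  by (rule cnj_shift_remove_component(2)) (use orth_HcD[OF assms] Hc_Suc_left in blast)+

text \<open>\<open>CK\<close>, \<open>CKt\<close>, \<open>CS\<close> and \<open>CT\<close> are C_p,
  C_q, C_s and C_r of the overview.\<close>

abbreviation "CK z \<equiv> cauchy_transform (gram R K K) z"
abbreviation "CKt z \<equiv> cauchy_transform (gram R Kt Kt) z"
abbreviation "CS z \<equiv> cauchy_transform (gram R Kt K) z"
abbreviation "CT z \<equiv> cauchy_transform (\<lambda>t. cnj t * gram R K Kt t) z"

lemma integrable_grams:
  "integrable circ (gram R K K)" "integrable circ (gram R Kt Kt)" "integrable circ (gram R Kt K)" "integrable circ (gram R K Kt)"
  by (intro integrable_gram K_LR Kt_LR)+

lemma CK_CKt_nonzero: assumes "norm z < 1" shows "CK z \<noteq> 0" "CKt z \<noteq> 0"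
  using cauchy_transform_gram_self[OF K_LR K_norm assms] cauchy_transform_gram_self[OF Kt_LR Kt_norm assms] by auto

lemma cauchy_transform_cnj_gram_K: "norm z < 1 \<Longrightarrow> z * cauchy_transform (\<lambda>t. cnj t * gram R K K t) z = CK z - 1"
  using cauchy_transform_cnj_mult[OF integrable_grams(1)] ip_K_K by (simp add: ip_eq)

text \<open>The form of the equation for \<open>A_perp\<close>, where cnj t multiplies the known
  vector and the removed component is bare.\<close>

lemma ip_resolvent_form:
  assumes "f \<in> LR R" "g \<in> LR R" "h \<in> LR R" and z: "norm z < 1"
    and x: "AE t in circ. (1 - z * cnj t) *s x t = cnj t *s f t - c *s g t"
  shows "ip R x h = cauchy_transform (\<lambda>t. cnj t * gram R f h t) z - c * cauchy_transform (gram R g h) z"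
proof -
  have "AE t in circ. x t = (1 / (1 - z * cnj t)) *s (cnj t *s f t - c *s g t)"
    using x AE_cauchy_kernel_bounded[OF z]
  proof eventually_elim
    case (elim t)
    have "1 - z * cnj t \<noteq> 0" using elim(2) by blast
    then have "(1 / (1 - z * cnj t)) *s ((1 - z * cnj t) *s x t) = x t"
      by (simp only: vector_smult_assoc) simp
    then show ?case by (simp only: elim(1))
  qed
  then have "ip R x h = ip R (\<lambda>t. (1 / (1 - z * cnj t)) *s (cnj t *s f t - c *s g t)) h"
    by (rule ip_cong) simp
  also have "\<dots> = cauchy_transform (gram R (\<lambda>t. cnj t *s f t - c *s g t) h) z" by (rule ip_cauchy_kernel)
  also have "gram R (\<lambda>t. cnj t *s f t - c *s g t) h = (\<lambda>t. cnj t * gram R f h t - c * gram R g h t)"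
    by (simp add: fun_eq_iff gram_linear)
  also have "cauchy_transform \<dots> z = cauchy_transform (\<lambda>t. cnj t * gram R f h t) z - c * cauchy_transform (gram R g h) z"
    by (rule cauchy_transform_diff[OF integrable_circ_cnj_mult[OF integrable_gram[OF assms(1,3)]] integrable_gram[OF assms(2,3)] z])
  finally show ?thesis .
qed

text \<open>The form of the equation for the adjoint of \<open>A0\<close>, where the removed
  component carries the factor cnj t.\<close>

lemma ip_resolvent_form':
  assumes "f \<in> LR R" "g \<in> LR R" "h \<in> LR R" and z: "norm z < 1"
    and x: "AE t in circ. (1 - z * cnj t) *s x t = f t - (c * cnj t) *s g t"
  shows "ip R x h = cauchy_transform (gram R f h) z - c * cauchy_transform (\<lambda>t. cnj t * gram R g h t) z"
proof -
  have "AE t in circ. x t = (1 / (1 - z * cnj t)) *s (f t - (c * cnj t) *s g t)"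
    using x AE_cauchy_kernel_bounded[OF z]
  proof eventually_elim
    case (elim t)
    have "1 - z * cnj t \<noteq> 0" using elim(2) by blast
    then have "(1 / (1 - z * cnj t)) *s ((1 - z * cnj t) *s x t) = x t"
      by (simp only: vector_smult_assoc) simp
    then show ?case by (simp only: elim(1))
  qed
  then have "ip R x h = ip R (\<lambda>t. (1 / (1 - z * cnj t)) *s (f t - (c * cnj t) *s g t)) h"
    by (rule ip_cong) simp
  also have "\<dots> = cauchy_transform (gram R (\<lambda>t. f t - (c * cnj t) *s g t) h) z" by (rule ip_cauchy_kernel)
  also have "gram R (\<lambda>t. f t - (c * cnj t) *s g t) h = (\<lambda>t. gram R f h t - c * (cnj t * gram R g h t))"
    by (simp add: fun_eq_iff gram_linear mult.assoc)
  also have "cauchy_transform \<dots> z = cauchy_transform (gram R f h) z - c * cauchy_transform (\<lambda>t. cnj t * gram R g h t) z"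
    by (rule cauchy_transform_diff[OF integrable_gram[OF assms(1,3)] integrable_circ_cnj_mult[OF integrable_gram[OF assms(2,3)]] z])
  finally show ?thesis .
qed

lemma LR_linear_cnj_shift: "f \<in> LR R \<Longrightarrow> g \<in> LR R \<Longrightarrow> (\<lambda>t. f t - (c * cnj t) *s g t) \<in> LR R"
  using LR_diff[OF _ LR_scale[OF LR_cnj_shift[of g], of c]] by (simp add: vector_smult_assoc)

text \<open>A solution x of the resolvent equation satisfies (1 - z cnj t) x = Kt - z d cnj t K with
  d = \<langle>x,K\<rangle>, and b = z d. Pairing with \<open>K\<close> determines d; pairing with
  \<open>Kt\<close> gives the second equation because x - Kt lies in H_{n,m+1}.\<close>

lemma b_check_equations:
  assumes z: "norm z < 1"
  shows "b_check R n m K Kt z * CK z = z * CS z"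
    and "CKt z - b_check R n m K Kt z * CT z = 1"
proof -
  let ?H = "Hc R n m"
  define A where "A = adj_on R ?H (A0 R n m)"
  define B where "B = (\<lambda>f t. cnj t *s (f t - ip R f K *s K t))"
  have AB: "AE t in circ. A f t = B f t" if "f \<in> ?H" for f
    unfolding A_def B_def by (rule A0_adjoint[OF that])
  have B_LR: "B f \<in> LR R" if "f \<in> LR R" for f
    unfolding B_def by (intro LR_cnj_shift LR_diff that LR_scale K_LR)
  have B_Hc: "B f \<in> Hc R n (m + 1)" if "f \<in> ?H" for f
    unfolding B_def by (rule Hc_cnj_shift[OF is_K_remove_component[OF K that]])
  have contr: "normR R (\<lambda>t. B f t - B g t) \<le> normR R (\<lambda>t. f t - g t)" if f: "f \<in> LR R" and g: "g \<in> LR R" for f g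
  proof -
    have "(\<lambda>t. B f t - B g t) = (\<lambda>t. cnj t *s ((f t - g t) - ip R (\<lambda>t. f t - g t) K *s K t))"
      using f g K_LR by (simp add: B_def fun_eq_iff vec_eq_iff ip_diff algebra_simps)
    then have "normR R (\<lambda>t. B f t - B g t) = normR R (\<lambda>t. (f t - g t) - ip R (\<lambda>t. f t - g t) K *s K t)"
      by (simp only: normR_cnj_shift)
    also have "\<dots> \<le> normR R (\<lambda>t. f t - g t)" by (rule normR_remove_component_le[OF LR_diff[OF f g] K_LR K_norm])
    finally show ?thesis .
  qed
  \<comment> \<open>The value forced by self-consistency: exactly for this c does the explicit
    vector satisfy \<langle>x0,K\<rangle> = c.\<close>
  define c where "c = CS z / CK z"
  define x0 where "x0 = (\<lambda>t. (1 / (1 - z * cnj t)) *s (Kt t - (z * c * cnj t) *s K t))"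
  have x0_LR: "x0 \<in> LR R" unfolding x0_def
    by (intro LR_cauchy_kernel z LR_linear_cnj_shift Kt_LR K_LR)
  have x0_eq: "AE t in circ. (1 - z * cnj t) *s x0 t = Kt t - (z * c * cnj t) *s K t"
    using AE_cauchy_kernel_bounded[OF z] by eventually_elim (simp add: x0_def vector_smult_assoc)
  have "ip R x0 K = CS z - z * c * cauchy_transform (\<lambda>t. cnj t * gram R K K t) z"
    by (rule ip_resolvent_form'[OF Kt_LR K_LR K_LR z x0_eq])
  also have "\<dots> = CS z - c * (CK z - 1)" unfolding cauchy_transform_cnj_gram_K[OF z, symmetric] by (simp add: mult_ac)
  also have "\<dots> = c" using CK_CKt_nonzero[OF z] by (simp add: c_def field_simps)
  finally have x0_K: "ip R x0 K = c" .
  have x0_fix: "AE t in circ. x0 t = Kt t + z *s B x0 t"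
    using x0_eq
  proof eventually_elim
    case (elim t)
    have "x0 t = (1 - z * cnj t) *s x0 t + (z * cnj t) *s x0 t" by (simp add: vec_eq_iff algebra_simps)
    also have "\<dots> = Kt t + z *s B x0 t" unfolding elim B_def x0_K by (simp add: vec_eq_iff algebra_simps)
    finally show ?case .
  qed
  have x0_Hc: "x0 \<in> ?H"
    by (rule fixed_point_in_closed_subspace[OF closed_subspace_Hc x0_LR Kt_Hc z B_LR Hc_Suc_right[OF B_Hc] contr x0_fix])
  define x where "x = resolvent_on ?H A z Kt"
  \<comment> \<open>The explicit x0 only guarantees that the choice succeeds; the equations are then
    derived for the chosen solution itself.\<close>
  have "\<exists>x. x \<in> ?H \<and> (AE t in circ. x t - z *s A x t = Kt t)"
    using x0_Hc AB[OF x0_Hc] x0_fix by (intro exI[of _ x0]) (auto elim: eventually_elim2)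
  from someI_ex[OF this] have x: "x \<in> ?H" "AE t in circ. x t - z *s A x t = Kt t"
    by (simp_all add: x_def resolvent_on_def)
  have xL: "x \<in> LR R" by (rule Hc_LR[OF x(1)])
  have x_fix: "AE t in circ. x t = Kt t + z *s B x t"
    using x(2) AB[OF x(1)] by eventually_elim (simp add: diff_eq_eq)
  define d where "d = ip R x K"
  have b: "b_check R n m K Kt z = z * d" by (simp add: b_check_def d_def x_def A_def)
  have x_eq: "AE t in circ. (1 - z * cnj t) *s x t = Kt t - (z * d * cnj t) *s K t"
    using x_fix
  proof eventually_elim
    case (elim t)
    have "(1 - z * cnj t) *s x t = x t - (z * cnj t) *s x t" by (simp add: vec_eq_iff algebra_simps)
    also have "\<dots> = Kt t + z *s B x t - (z * cnj t) *s x t" using elim by simp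
    also have "\<dots> = Kt t - (z * d * cnj t) *s K t" by (simp add: B_def d_def vec_eq_iff algebra_simps)
    finally show ?case .
  qed
  have "ip R x K = CS z - z * d * cauchy_transform (\<lambda>t. cnj t * gram R K K t) z"
    by (rule ip_resolvent_form'[OF Kt_LR K_LR K_LR z x_eq])
  also have "\<dots> = CS z - d * (CK z - 1)" unfolding cauchy_transform_cnj_gram_K[OF z, symmetric] by (simp add: mult_ac)
  finally have "d = CS z - d * (CK z - 1)" unfolding d_def[symmetric] .
  then have "d * CK z = CS z" by (simp add: algebra_simps)
  then show "b_check R n m K Kt z * CK z = z * CS z" unfolding b by (simp add: mult.assoc)
  \<comment> \<open>The second evaluation of this pairing: B x lies in H_{n,m+1}, so only Kt paired
    with itself contributes.\<close>
  have "ip R x Kt = ip R (\<lambda>t. Kt t + z *s B x t) Kt" by (rule ip_cong[OF x_fix]) simp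
  also have "\<dots> = 1 + z * ip R (B x) Kt"
    using Kt_LR B_LR[OF xL] by (simp add: ip_add LR_scale ip_scale ip_Kt_Kt)
  also have "\<dots> = 1" using Kt_orth'[OF B_Hc[OF x(1)]] by simp
  finally have "ip R x Kt = 1" .
  moreover have "ip R x Kt = CKt z - z * d * CT z"
    by (rule ip_resolvent_form'[OF Kt_LR K_LR Kt_LR z x_eq])
  ultimately show "CKt z - b_check R n m K Kt z * CT z = 1" by (simp add: b)
qed

text \<open>The two terms of \<omega> add up to the total \<open>Kt\<close>-component removed, so
  that (1 - z cnj t) y = cnj t K - \<omega> Kt. The solution y is orthogonal to H, hence its
  pairings with \<open>Kt\<close> and \<open>K\<close> both vanish, and these are the two
  equations.\<close>

lemma omega_check_equations:
  assumes z: "norm z < 1"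
  shows "CT z = omega_check R n m K Kt z * CKt z"
    and "CK z - 1 = omega_check R n m K Kt z * (z * CS z)"
proof -
  let ?S = "orth R (Hc R n m)"
  define A where "A = A_perp R n m"
  define B where "B = (\<lambda>f t. cnj t *s f t - ip R (\<lambda>t. cnj t *s f t) Kt *s Kt t)"
  define g0 where "g0 = proj R ?S (U_adj R K)"
  define KK where "KK = (\<lambda>t. cnj t *s K t)"
  have KK: "KK \<in> LR R" unfolding KK_def by (rule LR_cnj_shift[OF K_LR])
  have AB: "AE t in circ. A f t = B f t" if "f \<in> ?S" for f
    unfolding A_def B_def by (rule A_perp_eq[OF that])
  have BK: "B K \<in> ?S" unfolding B_def by (rule cnj_shift_remove_component(1)[OF K_LR K_orth])
  have g0: "AE t in circ. g0 t = B K t"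
    unfolding g0_def B_def by (rule cnj_shift_remove_component(2)[OF K_LR K_orth])
  have B_LR: "B f \<in> LR R" if "f \<in> LR R" for f
    unfolding B_def by (intro LR_cnj_shift LR_diff that LR_scale Kt_LR)
  have B_S: "B f \<in> ?S" if "f \<in> ?S" for f
    unfolding B_def by (rule cnj_shift_remove_component(1)) (use orth_HcD[OF that] Hc_Suc_left in blast)+
  have contr: "normR R (\<lambda>t. B f t - B g t) \<le> normR R (\<lambda>t. f t - g t)" if f: "f \<in> LR R" and g: "g \<in> LR R" for f g
  proof -
    define h where "h = (\<lambda>t. cnj t *s (f t - g t))"
    have h: "h \<in> LR R" unfolding h_def by (intro LR_cnj_shift LR_diff f g)
    have "h = (\<lambda>t. cnj t *s f t - cnj t *s g t)" by (simp add: h_def vector_ssub_ldistrib)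
    then have iph: "ip R h Kt = ip R (\<lambda>t. cnj t *s f t) Kt - ip R (\<lambda>t. cnj t *s g t) Kt"
      using LR_cnj_shift[OF f] LR_cnj_shift[OF g] Kt_LR by (simp add: ip_diff)
    have "(\<lambda>t. B f t - B g t) = (\<lambda>t. h t - ip R h Kt *s Kt t)"
      unfolding iph B_def by (simp add: h_def fun_eq_iff vec_eq_iff algebra_simps)
    then have "normR R (\<lambda>t. B f t - B g t) \<le> normR R h"
      using normR_remove_component_le[OF h Kt_LR Kt_norm] by simp
    also have "normR R h = normR R (\<lambda>t. f t - g t)" unfolding h_def by (rule normR_cnj_shift)
    finally show ?thesis .
  qed
  \<comment> \<open>Chosen so that y0 is orthogonal to \<open>Kt\<close>.\<close>
  define c where "c = CT z / CKt z"
  define y0 where "y0 = (\<lambda>t. (1 / (1 - z * cnj t)) *s (KK t - c *s Kt t))"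
  have y0_LR: "y0 \<in> LR R" unfolding y0_def
    by (intro LR_cauchy_kernel z LR_diff KK LR_scale Kt_LR)
  have y0_eq: "AE t in circ. (1 - z * cnj t) *s y0 t = cnj t *s K t - c *s Kt t"
    using AE_cauchy_kernel_bounded[OF z] by eventually_elim (simp add: y0_def KK_def vector_smult_assoc)
  have rewrite: "AE t in circ. y t = KK t - d *s Kt t + z *s (cnj t *s y t)"
    if "AE t in circ. (1 - z * cnj t) *s y t = cnj t *s K t - d *s Kt t" for y d
    using that
  proof eventually_elim
    case (elim t)
    have "y t = (1 - z * cnj t) *s y t + z *s (cnj t *s y t)" by (simp add: vec_eq_iff algebra_simps)
    then show ?case unfolding elim KK_def .
  qed
  have "ip R y0 Kt = CT z - c * CKt z" by (rule ip_resolvent_form[OF K_LR Kt_LR Kt_LR z y0_eq])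
  also have "\<dots> = 0" using CK_CKt_nonzero[OF z] by (simp add: c_def)
  finally have y0_Kt: "ip R y0 Kt = 0" .
  define YY where "YY = (\<lambda>t. cnj t *s y0 t)"
  have YY: "YY \<in> LR R" unfolding YY_def by (rule LR_cnj_shift[OF y0_LR])
  have "ip R y0 Kt = ip R (\<lambda>t. KK t - c *s Kt t + z *s YY t) Kt"
    unfolding YY_def by (rule ip_cong[OF rewrite[OF y0_eq]]) simp
  also have "\<dots> = ip R KK Kt - c + z * ip R YY Kt"
    using KK Kt_LR YY by (simp add: ip_add ip_diff LR_diff LR_scale ip_scale ip_Kt_Kt)
  finally have "0 = ip R KK Kt - c + z * ip R YY Kt" unfolding y0_Kt .
  \<comment> \<open>Orthogonality to \<open>Kt\<close> shows that the subtracted multiple c is the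
    one demanded by the fixed point equation.\<close>
  then have c: "c = ip R KK Kt + z * ip R (\<lambda>t. cnj t *s y0 t) Kt"
    unfolding YY_def by (simp add: algebra_simps)
  have y0_fix: "AE t in circ. y0 t = B K t + z *s B y0 t"
    using rewrite[OF y0_eq]
  proof eventually_elim
    case (elim t)
    have "KK t - c *s Kt t + z *s (cnj t *s y0 t) = B K t + z *s B y0 t"
      unfolding c B_def KK_def by (simp add: vec_eq_iff algebra_simps)
    then show ?case using elim by simp
  qed
  have y0_S: "y0 \<in> ?S"
    by (rule fixed_point_in_closed_subspace[OF orth_Hc y0_LR BK z B_LR B_S contr y0_fix])
  define y where "y = resolvent_on ?S A z g0"
  have "\<exists>y. y \<in> ?S \<and> (AE t in circ. y t - z *s A y t = g0 t)"
  proof (intro exI[of _ y0] conjI y0_S)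
    show "AE t in circ. y0 t - z *s A y0 t = g0 t"
      using AB[OF y0_S] y0_fix g0 by eventually_elim simp
  qed
  from someI_ex[OF this] have y: "y \<in> ?S" "AE t in circ. y t - z *s A y t = g0 t"
    by (simp_all add: y_def resolvent_on_def)
  have yL: "y \<in> LR R" by (rule orth_HcD(1)[OF y(1)])
  define w where "w = omega_check R n m K Kt z"
  have w: "w = ip R KK Kt + z * ip R (\<lambda>t. cnj t *s y t) Kt"
  proof -
    have "ip R (U_adj R K) Kt = ip R KK Kt"
      by (rule ip_cong) (use U_adj_eq[OF K_LR] in \<open>auto simp: KK_def\<close>)
    moreover have "ip R (U_adj R y) Kt = ip R (\<lambda>t. cnj t *s y t) Kt"
      by (rule ip_cong) (use U_adj_eq[OF yL] in auto)
    ultimately show ?thesis by (simp add: w_def omega_check_def y_def A_def g0_def)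
  qed
  have y_eq: "AE t in circ. (1 - z * cnj t) *s y t = cnj t *s K t - w *s Kt t"
    using y(2) AB[OF y(1)] g0
  proof eventually_elim
    case (elim t)
    have "(1 - z * cnj t) *s y t = (y t - z *s A y t) + z *s A y t - z *s (cnj t *s y t)"
      by (simp add: vec_eq_iff algebra_simps)
    also have "\<dots> = B K t + z *s B y t - z *s (cnj t *s y t)" using elim by simp
    also have "\<dots> = cnj t *s K t - w *s Kt t"
      unfolding w B_def KK_def by (simp add: vec_eq_iff algebra_simps)
    finally show ?case .
  qed
  have "CT z - w * CKt z = ip R y Kt" by (rule ip_resolvent_form[OF K_LR Kt_LR Kt_LR z y_eq, symmetric])
  also have "\<dots> = 0" by (rule orth_HcD(2)[OF y(1) Kt_Hc])
  finally show "CT z = omega_check R n m K Kt z * CKt z" by (simp add: w_def)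
  have "cauchy_transform (\<lambda>t. cnj t * gram R K K t) z - w * CS z = ip R y K"
    by (rule ip_resolvent_form[OF K_LR Kt_LR K_LR z y_eq, symmetric])
  also have "\<dots> = 0" by (rule orth_HcD(2)[OF y(1) K_Hc])
  finally have "cauchy_transform (\<lambda>t. cnj t * gram R K K t) z = w * CS z" by simp
  then show "CK z - 1 = omega_check R n m K Kt z * (z * CS z)"
    using cauchy_transform_cnj_gram_K[OF z] by (simp add: w_def mult_ac)
qed

end

section \<open>Boundary values and the spectral density\<close>

lemma tendsto_radial_point: "((\<lambda>r. of_real r * t) \<longlongrightarrow> (t :: complex)) (at_left 1)"
  by (auto intro!: tendsto_eq_intros)

context defect_vectors begin

lemma CK_eq_CKt:
  assumes z: "norm z < 1"
  shows "CK z * (1 - b_check R n m K Kt z * omega_check R n m K Kt z) = 1" and "CK z = CKt z"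
proof -
  define b w where "b = b_check R n m K Kt z" and "w = omega_check R n m K Kt z"
  have e: "b * CK z = z * CS z" "CKt z - b * CT z = 1" "CT z = w * CKt z" "CK z - 1 = w * (z * CS z)"
    using b_check_equations[OF z] omega_check_equations[OF z] by (simp_all add: b_def w_def)
  have 1: "CK z * (1 - b * w) = 1" using e(4) unfolding e(1)[symmetric] by (simp add: algebra_simps)
  have 2: "CKt z * (1 - b * w) = 1" using e(2) unfolding e(3) by (simp add: algebra_simps)
  show "CK z * (1 - b_check R n m K Kt z * omega_check R n m K Kt z) = 1" using 1 by (simp add: b_def w_def)
  have "1 - b * w \<noteq> 0" using 1 by auto
  then show "CK z = CKt z" using 1 2 by (metis mult_right_cancel)
qed

text \<open>With P, S, T the radial limits of C_p, C_s, C_r, the boundary values are t S / P for b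
  and T / P for \<omega>, the latter because C_q = C_p. Uniqueness of limits then matches each
  combination with the Poisson limit of a pointwise inner product.\<close>

lemma boundary_Sigma11:
  "AE t in circ. Sigma11 (bdry (b_check R n m K Kt) t) (bdry (omega_check R n m K Kt) t) =
     vector [vector [gram R K K t, t * gram R Kt K t], vector [cnj (t * gram R Kt K t), gram R Kt Kt t]]"
proof -
  obtain P where P: "AE t in circ. ((\<lambda>r. CK (of_real r * t)) \<longlongrightarrow> P t) (at_left 1)"
    by (rule cauchy_transform_radial_limit[OF integrable_grams(1)])
  obtain S where S: "AE t in circ. ((\<lambda>r. CS (of_real r * t)) \<longlongrightarrow> S t) (at_left 1)"
    by (rule cauchy_transform_radial_limit[OF integrable_grams(3)])
  obtain T where T: "AE t in circ. ((\<lambda>r. CT (of_real r * t)) \<longlongrightarrow> T t) (at_left 1)"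
    by (rule cauchy_transform_radial_limit[OF integrable_circ_cnj_mult[OF integrable_grams(4)]])
  have self: "(\<lambda>t. cnj (gram R f f t)) = gram R f f" for f
    using gram_cnj[of R f f] by (simp add: fun_eq_iff)
  have pK: "AE t in circ. ((\<lambda>r. CK (of_real r * t) + cnj (CK (of_real r * t)) - 1) \<longlongrightarrow> gram R K K t) (at_left 1)"
    using cauchy_transform_poisson_limit[OF integrable_grams(1)] unfolding self
    by (simp only: ip_eq[symmetric] ip_K_K)
  have pKt: "AE t in circ. ((\<lambda>r. CKt (of_real r * t) + cnj (CKt (of_real r * t)) - 1) \<longlongrightarrow> gram R Kt Kt t) (at_left 1)"
    using cauchy_transform_poisson_limit[OF integrable_grams(2)] unfolding self
    by (simp only: ip_eq[symmetric] ip_Kt_Kt)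
  define u where "u = (\<lambda>t. t * gram R Kt K t)"
  have ui: "integrable circ u"
    using integrable_cnj[OF integrable_circ_cnj_mult[OF integrable_grams(4)]]
    by (simp add: u_def gram_cnj[of R K Kt])
  have "(\<lambda>t. cnj (u t)) = (\<lambda>t. cnj t * gram R K Kt t)"
    by (simp add: u_def gram_cnj[of R K Kt])
  then have pu: "AE t in circ. ((\<lambda>r. cauchy_transform u (of_real r * t) + cnj (CT (of_real r * t)) - (LINT t|circ. u t)) \<longlongrightarrow> u t) (at_left 1)"
    using cauchy_transform_poisson_limit[OF ui] by simp
  \<comment> \<open>z C_s is the Cauchy transform of u = t s without its mean, and C_r is the Cauchy
    transform of cnj u. Their combination is therefore the Poisson integral of u.\<close>
  have CSu: "cauchy_transform u z - (LINT t|circ. u t) = z * CS z" if z: "norm z < 1" for z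
  proof -
    have "cauchy_transform (\<lambda>t. cnj t * u t) z = CS z"
      unfolding cauchy_transform_def
    proof (rule integral_circ_AE_cong)
      show "AE t in circ. cnj t * u t / (1 - z * cnj t) = gram R Kt K t / (1 - z * cnj t)"
        using AE_circ_norm
      proof eventually_elim
        case (elim t)
        then have "cnj t * t = 1" by (simp add: norm_1_mult_cnj mult.commute)
        then show ?case by (simp add: u_def flip: mult.assoc)
      qed
    qed
    then show ?thesis using cauchy_transform_cnj_mult[OF ui z] by simp
  qed
  show ?thesis using P S T pK pKt pu AE_circ_norm
  proof eventually_elim
    case (elim t)
    have ev: "\<forall>\<^sub>F r in at_left 1. norm (of_real r * t) < 1"
      using eventually_at_left_1 by eventually_elim (use elim(7) in \<open>simp add: norm_mult\<close>)
    \<comment> \<open>The lower bound in the disk passes to the limit and permits division by P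
      t.\<close>
    have Ppos: "Re (P t) \<ge> 1 / 2"
    proof (rule tendsto_lowerbound[OF tendsto_Re[OF elim(1)]])
      show "\<forall>\<^sub>F r in at_left 1. 1 / 2 \<le> Re (CK (of_real r * t))"
        using ev by eventually_elim (rule cauchy_transform_gram_self[OF K_LR K_norm])
    qed simp
    then have P0: "P t \<noteq> 0" by auto
    have "((\<lambda>r. of_real r * t * CS (of_real r * t) / CK (of_real r * t)) \<longlongrightarrow> t * S t / P t) (at_left 1)"
      by (intro tendsto_intros tendsto_radial_point elim(1,2) P0)
    then have bl: "((\<lambda>r. b_check R n m K Kt (of_real r * t)) \<longlongrightarrow> t * S t / P t) (at_left 1)"
    proof (rule Lim_transform_eventually)
      show "\<forall>\<^sub>F r in at_left 1. of_real r * t * CS (of_real r * t) / CK (of_real r * t) = b_check R n m K Kt (of_real r * t)"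
        using ev
      proof eventually_elim
        case (elim r)
        show ?case using b_check_equations(1)[OF elim] CK_CKt_nonzero(1)[OF elim] by (simp add: field_simps)
      qed
    qed
    then have b: "bdry (b_check R n m K Kt) t = t * S t / P t"
      unfolding bdry_def by (intro tendsto_Lim) auto
    have "((\<lambda>r. CT (of_real r * t) / CK (of_real r * t)) \<longlongrightarrow> T t / P t) (at_left 1)"
      by (intro tendsto_intros elim(1,3) P0)
    then have wl: "((\<lambda>r. omega_check R n m K Kt (of_real r * t)) \<longlongrightarrow> T t / P t) (at_left 1)"
    proof (rule Lim_transform_eventually)
      show "\<forall>\<^sub>F r in at_left 1. CT (of_real r * t) / CK (of_real r * t) = omega_check R n m K Kt (of_real r * t)"
        using ev
      proof eventually_elim
        case (elim r)
        show ?case using omega_check_equations(1)[OF elim] CK_CKt_nonzero(1)[OF elim] CK_eq_CKt(2)[OF elim]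
          by (simp add: field_simps)
      qed
    qed
    then have w: "bdry (omega_check R n m K Kt) t = T t / P t"
      unfolding bdry_def by (intro tendsto_Lim) auto
    \<comment> \<open>In the limit this identity keeps 1 - b \<omega> away from 0 on the boundary,
      so no division in \<open>Sigma11\<close> takes its default value.\<close>
    have "((\<lambda>r. CK (of_real r * t) * (1 - b_check R n m K Kt (of_real r * t) * omega_check R n m K Kt (of_real r * t)))
        \<longlongrightarrow> P t * (1 - (t * S t / P t) * (T t / P t))) (at_left 1)"
      by (intro tendsto_intros elim(1) bl wl)
    moreover have "((\<lambda>r. CK (of_real r * t) * (1 - b_check R n m K Kt (of_real r * t) * omega_check R n m K Kt (of_real r * t)))
        \<longlongrightarrow> 1) (at_left 1)"
      by (rule tendsto_eventually) (use ev in eventually_elim, rule CK_eq_CKt(1))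
    ultimately have P1: "P t * (1 - (t * S t / P t) * (T t / P t)) = 1"
      by (rule tendsto_unique[rotated]) simp
    have KK: "P t + cnj (P t) - 1 = gram R K K t"
      by (rule tendsto_unique[OF _ _ elim(4)]) (auto intro!: tendsto_intros elim(1))
    have "((\<lambda>r. CK (of_real r * t) + cnj (CK (of_real r * t)) - 1) \<longlongrightarrow> gram R Kt Kt t) (at_left 1)"
      by (rule Lim_transform_eventually[OF elim(5)]) (use ev in eventually_elim, simp add: CK_eq_CKt(2))
    then have KtKt: "gram R K K t = gram R Kt Kt t"
      by (rule tendsto_unique[rotated 2]) (simp, rule elim(4))
    have l1: "((\<lambda>r. of_real r * t * CS (of_real r * t) + cnj (CT (of_real r * t))) \<longlongrightarrow> u t) (at_left 1)"
      by (rule Lim_transform_eventually[OF elim(6)])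
         (use ev in eventually_elim, simp add: CSu[symmetric])
    have l2: "((\<lambda>r. of_real r * t * CS (of_real r * t) + cnj (CT (of_real r * t))) \<longlongrightarrow> t * S t + cnj (T t)) (at_left 1)"
      by (intro tendsto_intros tendsto_radial_point elim(2,3))
    have ST: "t * S t + cnj (T t) = u t"
      using l2 l1 by (rule tendsto_unique[rotated]) simp
    define \<beta> \<omega> where "\<beta> = t * S t / P t" and "\<omega> = T t / P t"
    have \<beta>P: "\<beta> * P t = t * S t" and \<omega>P: "\<omega> * P t = T t" using P0 by (simp_all add: \<beta>_def \<omega>_def)
    have P1': "P t * (1 - \<beta> * \<omega>) = 1" using P1 by (simp only: \<beta>_def \<omega>_def)
    then have nz: "1 - \<beta> * \<omega> \<noteq> 0" by (intro notI) simp
    have inv: "1 / (1 - \<beta> * \<omega>) = P t"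
      using P1' nz by (metis nonzero_mult_div_cancel_right)
    have f1: "x / (1 - \<beta> * \<omega>) = x * P t" for x unfolding inv[symmetric] by simp
    have f2: "x / (1 - cnj \<beta> * cnj \<omega>) = x * cnj (P t)" for x unfolding inv[symmetric] by simp
    \<comment> \<open>Each diagonal summand is P - 1/2 or its conjugate; the two halves add up to
      the -1 of the Poisson kernel.\<close>
    have half: "1 / 2 * ((1 + \<beta> * \<omega>) * P t) = P t - 1 / 2"
    proof -
      have "(1 + \<beta> * \<omega>) * P t = 2 * P t - P t * (1 - \<beta> * \<omega>)" by (simp add: algebra_simps)
      then show ?thesis unfolding P1' by (simp add: right_diff_distrib)
    qed
    have half': "1 / 2 * ((1 + cnj \<beta> * cnj \<omega>) * cnj (P t)) = cnj (P t) - 1 / 2"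
      using arg_cong[OF half, of cnj] by simp
    have Sig: "Sigma11 \<beta> \<omega> = vector [vector [P t + cnj (P t) - 1, \<beta> * P t + cnj (\<omega> * P t)],
        vector [\<omega> * P t + cnj (\<beta> * P t), P t + cnj (P t) - 1]]"
      unfolding Sigma11_def mult.commute[of \<omega> \<beta>] mult.commute[of "cnj \<omega>" "cnj \<beta>"] f1 f2 half half'
      by (simp add: vec_eq_iff forall_2)
    have "\<omega> * P t + cnj (\<beta> * P t) = cnj (u t)"
      unfolding \<beta>P \<omega>P ST[symmetric] by simp
    moreover have "\<beta> * P t + cnj (\<omega> * P t) = u t" unfolding \<beta>P \<omega>P by (rule ST)
    ultimately show ?case
      unfolding b w \<beta>_def[symmetric] \<omega>_def[symmetric] Sig KK KtKt by (simp only: u_def)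
  qed
qed

text \<open>u = Kt - cnj \<alpha> K lies in H_{n+1,m}, is orthogonal to H_{n+1,m+1} and has squared
  norm 1 - |\<alpha>|^2. So it is a multiple of the next defect vector, and the sign normalizations
  make the factor positive.\<close>

lemma alpha_less_1_and_next_Kt:
  assumes v: "is_Kt R (n + 1) m v"
  defines "\<alpha> \<equiv> alpha_check R K Kt"
  shows "rho_of \<alpha> > 0" and "AE t in circ. v t = (1 / of_real (rho_of \<alpha>)) *s (Kt t - cnj \<alpha> *s K t)"
proof -
  define e where "e = (\<lambda>t. cnj t powi (m + 1) *s vector [cnj (R t), 1] :: complex ^ 2)"
  \<comment> \<open>The normalizing vector does not involve n, so the same e serves for
    \<open>Kt\<close> and for v. Being in H_{n+1,m} it is orthogonal to \<open>K\<close>, whence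
    \<langle>u,e\<rangle> = \<langle>Kt,e\<rangle> \<noteq> 0, and u is not null.\<close>
  have e: "e \<in> Hc R (n + 1) m" unfolding e_def by (rule right_generator_Hc)
  have eL: "e \<in> LR R" by (rule Hc_LR[OF e])
  have \<alpha>: "\<alpha> = ip R K Kt" "cnj \<alpha> = ip R Kt K"
    by (simp add: \<alpha>_def alpha_check_def) (simp add: \<alpha>_def alpha_check_def ip_cnj[of Kt K])
  define u where "u = (\<lambda>t. Kt t - cnj \<alpha> *s K t)"
  have u: "u \<in> Hc R (n + 1) m" unfolding u_def \<alpha>(2) by (rule is_K_remove_component[OF K Kt_Hc])
  have uL: "u \<in> LR R" by (rule Hc_LR[OF u])
  have ue: "ip R u e = ip R Kt e"
    unfolding u_def using K_LR Kt_LR eL K_orth[OF e] by (simp add: ip_diff LR_scale ip_scale)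
  have Kte: "Im (ip R Kt e) = 0" "Re (ip R Kt e) > 0"
    using Kt unfolding is_Kt_def Let_def e_def by auto
  have ve: "Im (ip R v e) = 0" "Re (ip R v e) > 0" and vH: "v \<in> Hc R (n + 1) m" and vn: "normR R v = 1"
    and vo: "\<And>h. h \<in> Hc R (n + 1) (m + 1) \<Longrightarrow> ip R v h = 0"
    using v unfolding is_Kt_def Let_def e_def by auto
  have vL: "v \<in> LR R" by (rule Hc_LR[OF vH])
  have "(normR R u)\<^sup>2 = 1 + (norm \<alpha>)\<^sup>2 - 2 * Re (\<alpha> * cnj \<alpha>)"
    unfolding u_def normR_diff_square[OF Kt_LR LR_scale[OF K_LR]] normR_scale[OF K_LR] ip_scale_right K_norm Kt_norm \<alpha>(2)[symmetric]
    by simp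
  also have "Re (\<alpha> * cnj \<alpha>) = (norm \<alpha>)\<^sup>2"
    by (simp only: complex_norm_square[symmetric] Re_complex_of_real)
  also have "1 + (norm \<alpha>)\<^sup>2 - 2 * (norm \<alpha>)\<^sup>2 = 1 - (norm \<alpha>)\<^sup>2" by simp
  finally have un: "normR R u = rho_of \<alpha>" using normR_nonneg[OF uL] by (simp add: rho_of_def real_sqrt_unique)
  have "normR R u \<noteq> 0"
  proof
    assume "normR R u = 0"
    then have "norm (ip R u e) \<le> 0" using ip_cauchy_schwarz[OF uL eL] by simp
    then show False using ue Kte by auto
  qed
  then show rho: "rho_of \<alpha> > 0" using un normR_nonneg[OF uL] by simp
  define \<mu> where "\<mu> = ip R u v"
  define d where "d = (\<lambda>t. u t - \<mu> *s v t)"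
  have d: "d \<in> Hc R (n + 1) (m + 1)" unfolding d_def \<mu>_def by (rule is_Kt_remove_component[OF v u])
  have dL: "d \<in> LR R" by (rule Hc_LR[OF d])
  \<comment> \<open>d lies in H_{n+1,m+1}, to which both u and v are orthogonal; as a combination of
    the two it is null.\<close>
  have "ip R u d = 0"
    unfolding u_def using Kt_LR K_LR dL Kt_orth[OF Hc_Suc_left[OF d]] K_orth[OF Hc_Suc_right[OF d]]
    by (simp add: ip_diff LR_scale ip_scale)
  then have "ip R d d = 0"
    using uL vL vo[OF d] dL ip_diff[OF uL LR_scale[OF vL] dL, of \<mu>] by (simp add: d_def ip_scale)
  then have "normR R d = 0" by (simp add: normR_def)
  from normR_eq_0[OF dL this] have uv: "AE t in circ. u t = \<mu> *s v t"
    by eventually_elim (simp add: d_def)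
  have "normR R u = norm \<mu>"
    using normR_cong[OF uv] normR_scale[OF vL, of \<mu>] vn by simp
  moreover have "ip R u e = \<mu> * ip R v e" using ip_cong[OF uv, of e e] by (simp add: ip_scale)
  then have "\<mu> = of_real (Re (ip R Kt e) / Re (ip R v e))"
    using ue Kte ve by (simp add: complex_eq_iff field_simps)
  moreover have "Re (ip R Kt e) / Re (ip R v e) > 0" using Kte ve by simp
  \<comment> \<open>A positive number of modulus \<rho>.\<close>
  ultimately have \<mu>: "\<mu> = of_real (rho_of \<alpha>)" unfolding un by (metis abs_of_pos norm_of_real)
  show "AE t in circ. v t = (1 / of_real (rho_of \<alpha>)) *s (Kt t - cnj \<alpha> *s K t)"
    using uv
  proof eventually_elim
    case (elim t)
    then have "Kt t - cnj \<alpha> *s K t = of_real (rho_of \<alpha>) *s v t" by (simp add: u_def \<mu>)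
    then show ?case using rho by (simp add: vector_smult_assoc)
  qed
qed

end

text \<open>For a multiplication operator the spectral density is the pointwise inner product. The
  order of indices matters: entry (i,j) pairs \<psi>_j with \<psi>_i, so entry (1,2) is
  \<open>gram R g f\<close>.\<close>

lemma (in reflection_coefficient) has_spectral_densityI:
  assumes f: "f \<in> LR R" "g \<in> LR R"
    and S: "AE t in circ. S t = vector [vector [gram R f f t, gram R g f t], vector [gram R f g t, gram R g g t]]"
  shows "has_spectral_density R f g S"
proof -
  define \<psi> where "\<psi> = (\<lambda>i::2. if i = 1 then f else g)"
  have \<psi>: "\<psi> i \<in> LR R" for i using f by (simp add: \<psi>_def)
  have ae: "AE t in circ. gram R (\<psi> j) (\<psi> i) t = S t $ i $ j" for i j
    using S
  proof eventually_elim
    case (elim t)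
    have "i = 1 \<or> i = 2" "j = 1 \<or> j = 2" by (rule exhaust_2)+
    then show ?case unfolding elim by (auto simp: \<psi>_def)
  qed
  have "integrable circ (\<lambda>t. S t $ i $ j)" for i j
    using integrable_gram[OF \<psi> \<psi>] ae by (rule integrable_circ_AE_cong)
  moreover have "ip R (E_U D (\<psi> j)) (\<psi> i) = (LINT t:D|circ. S t $ i $ j)" for D i j
    unfolding ip_eq E_U_def gram_linear set_lebesgue_integral_def
  proof (rule integral_circ_AE_cong)
    show "AE t in circ. indicator D t * gram R (\<psi> j) (\<psi> i) t = indicator D t *\<^sub>R (S t $ i $ j)"
      using ae[of j i] by eventually_elim (simp add: indicator_def)
  qed
  moreover have "ip R (U_pow k (\<psi> j)) (\<psi> i) = (LINT t|circ. t powi k * S t $ i $ j)" for k i j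
    unfolding ip_eq U_pow_def gram_linear
    by (rule integral_circ_AE_cong) (use ae[of j i] in eventually_elim, simp)
  ultimately show ?thesis
    unfolding has_spectral_density_def Let_def \<psi>_def[symmetric] by blast
qed

theorem mainTheorem6:
  fixes R :: "complex \<Rightarrow> complex"
    and K Kt :: "int \<Rightarrow> int \<Rightarrow> complex \<Rightarrow> complex ^ 2"
    and n :: int
  assumes "R \<in> borel_measurable circ"
    and "AE t in circ. norm (R t) \<le> 1"
    and "log_integrable (\<lambda>t. 1 - norm (R t))"
    and "\<And>p q. is_K R p q (K p q)"
    and "\<And>p q. is_Kt R p q (Kt p q)"
  defines "b \<equiv> bdry (b_check R n n (K n n) (Kt n n))"
    and "w \<equiv> bdry (omega_check R n n (K n n) (Kt n n))"
    and "\<alpha> \<equiv> alpha_check R (K n n) (Kt n n)"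
    and "\<rho> \<equiv> complex_of_real (rho_of (alpha_check R (K n n) (Kt n n)))"
  shows "has_spectral_density R (K n n) (Kt (n + 1) n)
    (\<lambda>t. vector [vector [1, 0], vector [- \<alpha> / \<rho>, t / \<rho>]]
          ** Sigma11 (b t) (w t)
          ** vector [vector [1, - cnj \<alpha> / \<rho>], vector [0, cnj t / \<rho>]])"
proof -
  have "AE t in circ. norm (R t) < 1" using assms(3) by (simp add: log_integrable_def)
  then interpret defect_vectors R n n "K n n" "Kt n n"
    using assms(1,4,5) by unfold_locales
  have rho0: "\<rho> \<noteq> 0" and cr: "cnj \<rho> = \<rho>"
    and v: "AE t in circ. Kt (n + 1) n t = (1 / \<rho>) *s (Kt n n t - cnj \<alpha> *s K n n t)"
    using alpha_less_1_and_next_Kt[OF assms(5)[of "n + 1" n]] by (auto simp: \<rho>_def \<alpha>_def)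
  have vL: "Kt (n + 1) n \<in> LR R" using assms(5)[of "n + 1" n] by (auto simp: is_Kt_def intro: Hc_LR)
  show ?thesis
  proof (rule has_spectral_densityI[OF K_LR vL])
    show "AE t in circ. vector [vector [1, 0], vector [- \<alpha> / \<rho>, t / \<rho>]] ** Sigma11 (b t) (w t)
          ** vector [vector [1, - cnj \<alpha> / \<rho>], vector [0, cnj t / \<rho>]] =
        (vector [vector [gram R (K n n) (K n n) t, gram R (Kt (n + 1) n) (K n n) t],
          vector [gram R (K n n) (Kt (n + 1) n) t, gram R (Kt (n + 1) n) (Kt (n + 1) n) t]] :: complex ^ 2 ^ 2)"
      using boundary_Sigma11 v AE_circ_norm
    proof eventually_elim
      case (elim t)
      define p q s where "p = gram R (K n n) (K n n) t" and "q = gram R (Kt n n) (Kt n n) t" and "s = gram R (Kt n n) (K n n) t"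
      have cs: "gram R (K n n) (Kt n n) t = cnj s" unfolding s_def by (rule gram_cnj)
      \<comment> \<open>The formula for the next defect vector holds only at almost every point;
        writing its right-hand side as a function makes the linearity rules for \<open>gram\<close>
        applicable at the given point.\<close>
      define V where "V = (\<lambda>t. (1 / \<rho>) *s (Kt n n t - cnj \<alpha> *s K n n t))"
      have gv: "gram R (Kt (n + 1) n) h t = gram R V h t" "gram R h (Kt (n + 1) n) t = gram R h V t" for h
        using elim(2) by (simp_all add: gram_def V_def)
      have t1: "t * cnj t = 1" using elim(3) by (rule norm_1_mult_cnj)
      have "t * (x * (y * cnj t)) = x * y * (t * cnj t)" for x y by (simp only: mult_ac)
      then have tt: "t * (cnj t * x) = x" "cnj t * (t * x) = x" "t * (x * (y * cnj t)) = x * y" for x y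
        unfolding t1 using t1 by (metis mult.assoc mult.commute mult_1, metis mult.assoc mult.commute mult_1, simp)
      have Sig: "Sigma11 (b t) (w t) = vector [vector [p, t * s], vector [cnj (t * s), q]]"
        using elim(1) by (simp only: b_def w_def p_def q_def s_def)
      have V1: "gram R V (K n n) t = (s - cnj \<alpha> * p) / \<rho>"
        by (simp add: V_def gram_linear p_def s_def diff_divide_distrib)
      have V2: "gram R (K n n) V t = (cnj s - \<alpha> * p) / \<rho>"
        by (simp add: V_def gram_linear_right cs p_def cr diff_divide_distrib)
      have V3: "gram R V V t = ((q - \<alpha> * s) - cnj \<alpha> * (cnj s - \<alpha> * p)) / (\<rho> * \<rho>)"
        by (simp add: V_def gram_linear gram_linear_right cs cr p_def[symmetric] q_def[symmetric] s_def[symmetric] diff_divide_distrib right_diff_distrib)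
      \<comment> \<open>In terms of K and t Kt the vector V has coefficients - cnj \<alpha> / \<rho>
        and cnj t / \<rho>. Their conjugates form the second row of the left factor, since the row
        index belongs to the conjugated argument.\<close>
      show ?case
        unfolding Sig gv V1 V2 V3 p_def[symmetric]
        using rho0
        by (simp add: vec_eq_iff forall_2 matrix_matrix_mult_def sum_2 t1 tt diff_divide_distrib add_divide_distrib ring_distribs mult_ac)
    qed
  qed
qed

end
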